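(* The distinguished $S^1$-fixed-point locus $E_0\subset\mathrm{Quot}_P(\mathcal{E}^n)$, $P(t)=(n-r)t+d+(n-r)$, i.e. the set of $S^1$-fixed points in $\psi^{-1}(Y_0)$, is given by $$E_0=\coprod_{\substack{0\le\alpha_1\le\cdots\le\alpha_r\\ \alpha_1+\cdots+\alpha_r=d}}F_{\alpha_1,\ldots,\alpha_r;0,\ldots,0},$$ a disjoint union of flag manifolds determined by the multiplicities of the entries in $(\alpha_1,\ldots,\alpha_r)$ with $\alpha_1+\cdots+\alpha_r=d$: if the distinct values among the $\alpha_i$, in increasing order, have multiplicities $m_1,\ldots,m_k$, then $F_{\alpha_1,\ldots,\alpha_r;0,\ldots,0}\simeq\mathrm{Fl}_{m_1,m_1+m_2,\ldots,r}(\mathbb{C}^n)$.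
   Context: Let $1\le r\le n$, $d\ge 0$. $C=\mathbb{CP}^1=\mathrm{Proj}\,\mathbb{C}[z_0,z_1]=\mathbb{C}\cup\{\infty\}$ with $z=z_0/z_1$, $w=1/z$, $U_0=\mathrm{Spec}\,\mathbb{C}[z]$, $U_\infty=\mathrm{Spec}\,\mathbb{C}[w]$. $\mathcal{E}^n=\mathcal{O}_C\otimes\mathbb{C}^n$. $\mathrm{Quot}_P(\mathcal{E}^n)$ parametrizes coherent subsheaves $\mathcal{V}\subset\mathcal{E}^n$ of rank $r$ with $\deg(\mathcal{E}^n/\mathcal{V})=d$. $S^1=U(1)$ acts on $C$ by $z\mapsto tz$, on $\mathcal{E}^n$ by $(z,v)\mapsto(tz,v)$, and on subsheaves through $(t\cdot s)(z)=s(t^{-1}z)$. For integers $0\le\alpha_1\le\cdots\le\alpha_r$ with $\sum\alpha_i=d$, $F_{\alpha_1,\ldots,\alpha_r;0,\ldots,0}$ is the set of $S^1$-fixed points $\mathcal{V}$ for which there are an $r$-dimensional $W\subset\mathbb{C}^n$ with basis $u_1,\ldots,u_r$ such that $\mathcal{V}\subset\mathcal{O}_C\otimes W$, $\mathcal{V}|_{U_\infty}=(\mathcal{O}_C\otimes W)|_{U_\infty}$ and $\mathcal{V}|_{U_0}$ is associated to $\bigoplus_i\mathbb{C}[z]z^{\alpha_i}u_i$. $W_d=\mathbb{P}(H^0(C,\mathcal{O}_C(d))\otimes\Lambda^r\mathbb{C}^n)$ is the projective space of $\binom{n}{r}$-tuples of degree-$d$ homogeneous polynomials in $z_0,z_1$.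 $Y_0\subset W_d$ is the set of points of the form $[c_1z_0^d:c_2z_0^d:\cdots]$ with $c_i\in\mathbb{C}$. The map $\psi:\mathrm{Quot}_P(\mathcal{E}^n)\to W_d$ is defined as follows: $\mathcal{V}\subset\mathcal{E}^n$ corresponds to the graded submodule $\mathfrak{N}_{\mathcal V}=\bigoplus_mH^0(C,\mathcal{V}(m))$ of $\mathbb{C}[z_0,z_1]^{\oplus n}$, which is free of rank $r$; let $A_{\mathcal V}$ be the $n\times r$ matrix whose columns are a homogeneous basis of $\mathfrak{N}_{\mathcal V}$; then $\psi(\mathcal{V})$ is the tuple of $r\times r$ minors of $A_{\mathcal V}$ (each zero or homogeneous of degree $d$). $\mathrm{Fl}_{m_1,m_1+m_2,\ldots,r}(\mathbb{C}^n)$ is the manifold of flags of subspaces of $\mathbb{C}^n$ of the indicated dimensions. *)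

theory Defs
  imports "HOL-Analysis.Analysis" "HOL-Computational_Algebra.Polynomial"
begin

text \<open>
  Throughout, \<open>n = CARD('n)\<close> and \<open>r = CARD('r)\<close>; the linear orders on the finite index types
  play the role of the orders on \<open>{1,\<dots>,n}\<close> and \<open>{1,\<dots>,r}\<close>.
\<close>


section \<open>The homogeneous coordinate ring of the projective line\<close>

text \<open>
  \<open>\<complex>[z\<^sub>0,z\<^sub>1]\<close> is represented as \<open>(\<complex>[z\<^sub>1])[z\<^sub>0]\<close>: the outer variable is \<open>z\<^sub>0\<close>, so
  the coefficient of \<open>z\<^sub>0^i z\<^sub>1^j\<close> in \<open>p\<close> is \<open>coeff (coeff p i) j\<close>.
\<close>

type_synonym hpoly = "complex poly poly"

definition homogeneous :: "nat \<Rightarrow> hpoly \<Rightarrow> bool" where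
  "homogeneous m p \<longleftrightarrow> (\<forall>i j. coeff (coeff p i) j \<noteq> 0 \<longrightarrow> i + j = m)"

definition homogeneous_vec :: "nat \<Rightarrow> hpoly ^ 'n \<Rightarrow> bool" where
  "homogeneous_vec m s \<longleftrightarrow> (\<forall>k. homogeneous m (s $ k))"

text \<open>
  The expressions of a section \<open>s\<close> of \<open>\<O>(m)\<^sup>n\<close> on the two charts: \<open>s(z,1)\<close>
  on \<open>U\<^sub>0 = Spec \<complex>[z]\<close>, trivialising \<open>\<O>(m)\<close> by \<open>z\<^sub>1^m\<close>, and \<open>s(1,w)\<close> on
  \<open>U\<^sub>\<infinity> = Spec \<complex>[w]\<close>, trivialising by \<open>z\<^sub>0^m\<close>.
\<close>

definition chart0 :: "hpoly ^ 'n \<Rightarrow> complex poly ^ 'n" where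
  "chart0 s = (\<chi> k. map_poly (\<lambda>c. poly c 1) (s $ k))"

definition chart_inf :: "hpoly ^ 'n \<Rightarrow> complex poly ^ 'n" where
  "chart_inf s = (\<chi> k. poly (s $ k) 1)"

definition cscale :: "complex \<Rightarrow> hpoly ^ 'n \<Rightarrow> hpoly ^ 'n" where
  "cscale c s = [:[:c:]:] *s s"

lemma module_vec: "module ((*s) :: 'a::comm_ring_1 \<Rightarrow> 'a ^ 'n \<Rightarrow> 'a ^ 'n)"
  by unfold_locales (simp_all add: vec_eq_iff algebra_simps)

lemma vector_space_cscale: "vector_space (cscale :: complex \<Rightarrow> hpoly ^ 'n \<Rightarrow> hpoly ^ 'n)"
proof -
  have add: "[:[:a + b:]:] = [:[:a:]:] + ([:[:b:]:] :: hpoly)" for a b by simp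
  have mult: "[:[:a * b:]:] = [:[:a:]:] * ([:[:b:]:] :: hpoly)" for a b by simp
  have one: "[:[:1:]:] = (1 :: hpoly)" by (simp add: one_pCons)
  show ?thesis
    by unfold_locales
      (simp_all only: cscale_def add mult one vector_add_ldistrib vector_sadd_rdistrib
        vector_smult_assoc vector_smult_lid)
qed


section \<open>Coherent subsheaves of the trivial bundle and the Quot scheme\<close>

text \<open>
  A quasi-coherent subsheaf of \<open>\<O>\<^sup>n\<close> is the pair of its modules of sections over \<open>U\<^sub>0\<close> and
  \<open>U\<^sub>\<infinity>\<close>, which have to become equal after localisation to \<open>U\<^sub>0 \<inter> U\<^sub>\<infinity>\<close>; it is automatically coherent
  since \<open>\<complex>[z]\<^sup>n\<close> and \<open>\<complex>[w]\<^sup>n\<close> are Noetherian.  Gluing: every element of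
  \<open>\<complex>[z,1/z]\<^sup>n\<close> is, up to a power of \<open>z\<close>, of the form \<open>s(z,1)\<close> with \<open>s\<close> homogeneous, and
  \<open>s(1,w)\<close> differs from \<open>s(z,1)\<close> by a power of \<open>z = 1/w\<close> only.
\<close>

type_synonym 'n sheaf = "(complex poly ^ 'n) set \<times> (complex poly ^ 'n) set"

definition coherent_subsheaf :: "'n::finite sheaf \<Rightarrow> bool" where
  "coherent_subsheaf V \<longleftrightarrow>
     module.subspace (*s) (fst V) \<and> module.subspace (*s) (snd V) \<and>
     (\<forall>N s. homogeneous_vec N s \<longrightarrow>
        ((\<exists>k. monom 1 k *s chart0 s \<in> fst V) \<longleftrightarrow> (\<exists>k. monom 1 k *s chart_inf s \<in> snd V)))"

definition sheaf_rank :: "'n::finite sheaf \<Rightarrow> nat" where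
  "sheaf_rank V = Max {card B |B. finite B \<and> B \<subseteq> fst V \<and> \<not> module.dependent (*s) B}"

text \<open>\<open>H\<^sup>0(C, V(m))\<close> as a subspace of \<open>H\<^sup>0(C, \<O>(m))\<^sup>n\<close>:\<close>

definition sections :: "nat \<Rightarrow> 'n::finite sheaf \<Rightarrow> (hpoly ^ 'n) set" where
  "sections m V = {s. homogeneous_vec m s \<and> chart0 s \<in> fst V \<and> chart_inf s \<in> snd V}"

definition h0 :: "nat \<Rightarrow> 'n::finite sheaf \<Rightarrow> nat" where
  "h0 m V = vector_space.dim cscale (sections m V)"

text \<open>
  \<open>P\<close> is the Hilbert polynomial of \<open>\<O>\<^sup>n / V\<close>.  For large \<open>m\<close> we have \<open>H\<^sup>1(C, V(m)) = 0\<close>, so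
  \<open>h\<^sup>0((\<O>\<^sup>n / V)(m)) = h\<^sup>0(\<O>(m)\<^sup>n) - h\<^sup>0(V(m))\<close>.
\<close>

definition quotient_hilbert_poly :: "'n::finite sheaf \<Rightarrow> int poly \<Rightarrow> bool" where
  "quotient_hilbert_poly V P \<longleftrightarrow>
     (\<forall>\<^sub>F m in sequentially. int (h0 m (UNIV, UNIV :: (complex poly ^ 'n) set)) - int (h0 m V)
        = poly P (int m))"

text \<open>
  By Riemann--Roch, a sheaf of rank \<open>n - r\<close> and degree \<open>d\<close> on the projective line has the Hilbert
  polynomial \<open>(n - r) (t + 1) + d\<close>.
\<close>

definition quot_poly :: "nat \<Rightarrow> nat \<Rightarrow> nat \<Rightarrow> int poly" where
  "quot_poly n r d = [: int d + (int n - int r), int n - int r :]"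

definition Quot :: "nat \<Rightarrow> nat \<Rightarrow> 'n::finite sheaf set" where
  "Quot r d = {V. coherent_subsheaf V \<and> sheaf_rank V = r \<and>
                  quotient_hilbert_poly V (quot_poly CARD('n) r d)}"


section \<open>The circle action and its fixed points\<close>

text \<open>\<open>(t \<cdot> s)(z) = s(t\<inverse> z)\<close>; in the coordinate \<open>w = 1/z\<close> this reads \<open>(t \<cdot> s)(w) = s(t w)\<close>.\<close>

definition act :: "complex \<Rightarrow> 'n::finite sheaf \<Rightarrow> 'n sheaf" where
  "act t V = ((\<lambda>s. \<chi> k. pcompose (s $ k) [:0, inverse t:]) ` fst V,
              (\<lambda>s. \<chi> k. pcompose (s $ k) [:0, t:]) ` snd V)"

definition circle_fixed :: "'n::finite sheaf \<Rightarrow> bool" where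
  "circle_fixed V \<longleftrightarrow> (\<forall>t. cmod t = 1 \<longrightarrow> act t V = V)"

definition const_vec :: "complex ^ 'n \<Rightarrow> complex poly ^ 'n" where
  "const_vec u = (\<chi> k. [:u $ k:])"

text \<open>Sections of \<open>\<O> \<otimes> W\<close> on either chart:\<close>

definition const_sections :: "(complex ^ 'n::finite) set \<Rightarrow> (complex poly ^ 'n) set" where
  "const_sections W = module.span (*s) (const_vec ` W)"

text \<open>
  The locus \<open>F\<^bsub>\<alpha>;0\<^esub>\<close>.  As the \<open>u i\<close> are linearly independent, the span is the direct
  sum of the \<open>\<complex>[z] z^(\<alpha> i) u i\<close>.
\<close>

definition F_locus :: "('r::finite \<Rightarrow> nat) \<Rightarrow> 'n::finite sheaf set" where
  "F_locus \<alpha> = {V \<in> Quot CARD('r) (sum \<alpha> UNIV). circle_fixed V \<and>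
     (\<exists>W (u :: 'r \<Rightarrow> complex ^ 'n).
        vec.subspace W \<and> vec.dim W = CARD('r) \<and>
        inj u \<and> vec.independent (range u) \<and> vec.span (range u) = W \<and>
        fst V \<subseteq> const_sections W \<and> snd V \<subseteq> const_sections W \<and>
        snd V = const_sections W \<and>
        fst V = module.span (*s) (range (\<lambda>i. monom 1 (\<alpha> i) *s const_vec (u i))))}"


section \<open>The map to the projective space of minors\<close>

text \<open>
  The \<open>r\<close>-subsets of \<open>{1,\<dots>,n}\<close> are encoded by the strictly increasing maps \<open>'r \<Rightarrow> 'n\<close>;
  tuples are \<open>0\<close> at all other maps.  A point of a projective space is the set of nonzero complex
  multiples of a nonzero tuple.
\<close>

type_synonym ('r, 'n) tuple = "('r \<Rightarrow> 'n) \<Rightarrow> hpoly"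

definition proj_point :: "('r, 'n) tuple \<Rightarrow> ('r, 'n) tuple set" where
  "proj_point T = {\<lambda>f. [:[:c:]:] * T f |c. c \<noteq> 0}"

definition W_space :: "nat \<Rightarrow> ('r::{finite,linorder}, 'n::{finite,linorder}) tuple set set" where
  "W_space d = {proj_point T |T. (\<exists>f. T f \<noteq> 0) \<and> (\<forall>f. \<not> strict_mono f \<longrightarrow> T f = 0) \<and>
                                 (\<forall>f. homogeneous d (T f))}"

definition Y0 :: "nat \<Rightarrow> ('r::{finite,linorder}, 'n::{finite,linorder}) tuple set set" where
  "Y0 d = {p \<in> W_space d. \<exists>c :: ('r \<Rightarrow> 'n) \<Rightarrow> complex.
             p = proj_point (\<lambda>f. if strict_mono f then monom [:c f:] d else 0)}"

text \<open>\<open>\<Oplus>\<^sub>m H\<^sup>0(C, V(m))\<close> inside \<open>\<complex>[z\<^sub>0,z\<^sub>1]\<^sup>n\<close>:\<close>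

definition graded_module :: "'n::finite sheaf \<Rightarrow> (hpoly ^ 'n) set" where
  "graded_module V = module.span cscale (\<Union>m. sections m V)"

definition homogeneous_basis_matrix :: "'n::finite sheaf \<Rightarrow> hpoly ^ 'r::finite ^ 'n \<Rightarrow> bool" where
  "homogeneous_basis_matrix V A \<longleftrightarrow>
     (\<forall>j. \<exists>m. homogeneous_vec m (column j A)) \<and>
     inj (\<lambda>j. column j A) \<and> \<not> module.dependent (*s) (range (\<lambda>j. column j A)) \<and>
     module.span (*s) (range (\<lambda>j. column j A)) = graded_module V"

definition minors ::
    "hpoly ^ 'r::{finite,linorder} ^ 'n::{finite,linorder} \<Rightarrow> ('r, 'n) tuple" where
  "minors A f = (if strict_mono f then det (\<chi> i. A $ f i) else 0)"

text \<open>
  Two homogeneous bases differ by an invertible matrix over \<open>\<complex>[z\<^sub>0,z\<^sub>1]\<close>, whose determinant is a nonzero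
  constant, so the choice of the basis does not matter.
\<close>

definition psi :: "'n::{finite,linorder} sheaf \<Rightarrow> ('r::{finite,linorder}, 'n) tuple set" where
  "psi V = proj_point (minors (SOME A. homogeneous_basis_matrix V A))"

text \<open>The type argument carries \<open>r\<close>.\<close>

definition E0 :: "'r::{finite,linorder} itself \<Rightarrow> nat \<Rightarrow> 'n::{finite,linorder} sheaf set" where
  "E0 _ d = {V \<in> Quot CARD('r) d. circle_fixed V \<and> psi V \<in> (Y0 d :: ('r, 'n) tuple set set)}"


definition weights :: "nat \<Rightarrow> ('r::{finite,linorder} \<Rightarrow> nat) set" where
  "weights d = {\<alpha>. mono \<alpha> \<and> sum \<alpha> UNIV = d}"


section \<open>Varieties of tuples of subspaces\<close>

text \<open>
  A variety is given as a set \<open>X\<close> with an injective map \<open>e\<close> into a product of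
  Grassmannians of a complex vector space, i.e. into tuples \<open>[U\<^sub>1,\<dots>,U\<^sub>k]\<close> of finite-dimensional
  subspaces whose dimensions do not depend on the point of \<open>X\<close>.  The product of Grassmannians
  being the quotient of the space of frames by general linear groups, a subset is Zariski open, and a
  function is regular, iff its pullback to frames is so; the latter means open,
  respectively locally a quotient of polynomials, in the coordinates of the frame vectors.
  The vectors \<open>b j i\<close> with \<open>j \<ge> k\<close> or \<open>i \<ge> dim U\<^sub>j\<close> are unconstrained dummies.
\<close>

definition frame :: "(complex \<Rightarrow> 'v \<Rightarrow> 'v) \<Rightarrow> 'v::ab_group_add set list \<Rightarrow> (nat \<Rightarrow> nat \<Rightarrow> 'v) \<Rightarrow> bool"
  where
  "frame sc Us b \<longleftrightarrow>
     (\<forall>j < length Us. let I = {..<vector_space.dim sc (Us ! j)} in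
        inj_on (b j) I \<and> \<not> module.dependent sc (b j ` I) \<and> module.span sc (b j ` I) = Us ! j)"

inductive_set frame_polys :: "(complex \<Rightarrow> 'v \<Rightarrow> 'v) \<Rightarrow> ((nat \<Rightarrow> nat \<Rightarrow> 'v::ab_group_add) \<Rightarrow> complex) set"
  for sc :: "complex \<Rightarrow> 'v \<Rightarrow> 'v" where
  const: "(\<lambda>b. c) \<in> frame_polys sc"
| coordinate: "Vector_Spaces.linear sc (*) l \<Longrightarrow> (\<lambda>b. l (b j i)) \<in> frame_polys sc"
| add: "p \<in> frame_polys sc \<Longrightarrow> q \<in> frame_polys sc \<Longrightarrow> (\<lambda>b. p b + q b) \<in> frame_polys sc"
| mult: "p \<in> frame_polys sc \<Longrightarrow> q \<in> frame_polys sc \<Longrightarrow> (\<lambda>b. p b * q b) \<in> frame_polys sc"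

definition zariski_open ::
    "(complex \<Rightarrow> 'v \<Rightarrow> 'v) \<Rightarrow> ('x \<Rightarrow> 'v::ab_group_add set list) \<Rightarrow> 'x set \<Rightarrow> 'x set \<Rightarrow> bool" where
  "zariski_open sc e X U \<longleftrightarrow> U \<subseteq> X \<and>
     (\<forall>x\<in>U. \<exists>b\<^sub>0. \<exists>q \<in> frame_polys sc. frame sc (e x) b\<^sub>0 \<and> q b\<^sub>0 \<noteq> 0 \<and>
        (\<forall>y\<in>X. \<forall>b. frame sc (e y) b \<and> q b \<noteq> 0 \<longrightarrow> y \<in> U))"

definition regular_on ::
    "(complex \<Rightarrow> 'v \<Rightarrow> 'v) \<Rightarrow> ('x \<Rightarrow> 'v::ab_group_add set list) \<Rightarrow> 'x set \<Rightarrow> ('x \<Rightarrow> complex) \<Rightarrow> bool" where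
  "regular_on sc e U f \<longleftrightarrow>
     (\<forall>x\<in>U. \<exists>b\<^sub>0. \<exists>p \<in> frame_polys sc. \<exists>q \<in> frame_polys sc.
        frame sc (e x) b\<^sub>0 \<and> q b\<^sub>0 \<noteq> 0 \<and>
        (\<forall>y\<in>U. \<forall>b. frame sc (e y) b \<and> q b \<noteq> 0 \<longrightarrow> f y = p b / q b))"

definition variety_morphism ::
    "(complex \<Rightarrow> 'v \<Rightarrow> 'v) \<Rightarrow> ('x \<Rightarrow> 'v::ab_group_add set list) \<Rightarrow> 'x set \<Rightarrow>
     (complex \<Rightarrow> 'w \<Rightarrow> 'w) \<Rightarrow> ('y \<Rightarrow> 'w::ab_group_add set list) \<Rightarrow> 'y set \<Rightarrow> ('x \<Rightarrow> 'y) \<Rightarrow> bool" where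
  "variety_morphism sc e X sc' e' Y \<phi> \<longleftrightarrow> \<phi> ` X \<subseteq> Y \<and>
     (\<forall>U. zariski_open sc' e' Y U \<longrightarrow>
        zariski_open sc e X {x \<in> X. \<phi> x \<in> U} \<and>
        (\<forall>f. regular_on sc' e' U f \<longrightarrow> regular_on sc e {x \<in> X. \<phi> x \<in> U} (f \<circ> \<phi>)))"

definition variety_iso ::
    "(complex \<Rightarrow> 'v \<Rightarrow> 'v) \<Rightarrow> ('x \<Rightarrow> 'v::ab_group_add set list) \<Rightarrow> 'x set \<Rightarrow>
     (complex \<Rightarrow> 'w \<Rightarrow> 'w) \<Rightarrow> ('y \<Rightarrow> 'w::ab_group_add set list) \<Rightarrow> 'y set \<Rightarrow> ('x \<Rightarrow> 'y) \<Rightarrow> bool" where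
  "variety_iso sc e X sc' e' Y \<phi> \<longleftrightarrow> bij_betw \<phi> X Y \<and>
     variety_morphism sc e X sc' e' Y \<phi> \<and>
     variety_morphism sc' e' Y sc e X (inv_into X \<phi>)"

text \<open>
  Grothendieck's embedding of the Quot scheme into a Grassmannian.  A subsheaf in \<open>Quot r d\<close> is a sum of
  line bundles \<open>\<O>(-a)\<close> with \<open>0 \<le> a \<le> d\<close>, so every \<open>m \<ge> d\<close> is admissible.
\<close>

definition quot_embedding :: "nat \<Rightarrow> 'n::finite sheaf \<Rightarrow> (hpoly ^ 'n) set list" where
  "quot_embedding m V = [sections m V]"


section \<open>Flag manifolds\<close>

text \<open>Flags in \<open>\<complex>\<^sup>n\<close>; the embedding into the product of Grassmannians is the identity.\<close>

definition flag_variety :: "nat list \<Rightarrow> (complex ^ 'n::finite) set list set" where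
  "flag_variety ds = {Ws. length Ws = length ds \<and>
     (\<forall>j < length ds. vec.subspace (Ws ! j) \<and> vec.dim (Ws ! j) = ds ! j) \<and>
     sorted_wrt (\<subseteq>) Ws}"

definition multiplicities :: "('r::finite \<Rightarrow> nat) \<Rightarrow> nat list" where
  "multiplicities \<alpha> = map (\<lambda>a. card {i. \<alpha> i = a}) (sorted_list_of_set (range \<alpha>))"

definition partial_sums :: "nat list \<Rightarrow> nat list" where
  "partial_sums ms = map (\<lambda>j. sum_list (take (Suc j) ms)) [0..<length ms]"

end

theory Submission
  imports Defs "HOL-Computational_Algebra.Polynomial_Factorial"
begin

text \<open>
  A circle-fixed subsheaf is graded on both charts, hence given by two increasing filtrations
  \<open>A\<close>, \<open>B\<close> of \<open>\<complex>\<^sup>n\<close> with the same union \<open>W\<close>.  A basis of \<open>W\<close> adapted to both filtrations yields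
  a homogeneous basis of the graded module, so that \<open>psi\<close> is computed by its minors.  If these are
  multiples of \<open>z\<^sub>0^d\<close>, then evaluation at \<open>z\<^sub>1 = 0\<close> gives \<open>r\<close> independent vectors in \<open>B 0\<close>, whence
  \<open>B\<close> is constantly \<open>W\<close>.  What remains is the filtration \<open>A\<close>, whose dimensions are encoded by the
  weights \<open>\<alpha>\<close> and whose distinct steps form a flag.

  The sections of the twisted sheaf split into the weight spaces \<open>A w\<close>.  A frame of them is made dual to
  given functionals by elimination without division; its weight components are then frames of the \<open>A w\<close>.
  This gives the morphism to the flag variety, and shows that the dimensions of all \<open>A w\<close> can only
  increase in a neighbourhood; their sum being constant, the loci are open.
\<close>

section \<open>Coefficient vectors\<close>

text \<open>Varieties are described by frames, and an arbitrary frame of the sections of V(m) mixes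
  all weights. Splitting it into weight vectors would involve choices depending on the point,
  whereas a map of frames has to be one polynomial formula near a given frame, and
  \<open>frame_polys\<close> contains no quotients. Functionals that each read a single weight
  component avoid this: once the frame is dual to them up to a common factor, the weight w
  components of the vectors labelled by w are independent wherever the factor is nonzero, although
  the vectors themselves may stay mixed. Over a sheaf of another type this still bounds the
  dimension in each weight from below.

  The witnesses in \<open>zariski_open\<close> and \<open>regular_on\<close> live at some frame that
  cannot be chosen. A lift to frames therefore has to reach every prescribed frame, the dummy
  entries included; this explains the shape of the maps \<open>G\<close> near the end.\<close>

interpretation cvec: module "(*s) :: 'a::comm_ring_1 \<Rightarrow> 'a ^ 'n \<Rightarrow> 'a ^ 'n"
  by (rule module_vec)

interpretation hvec: vector_space "cscale :: complex \<Rightarrow> hpoly ^ 'n \<Rightarrow> hpoly ^ 'n"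
  by (rule vector_space_cscale)

definition coeff_vec :: "nat \<Rightarrow> 'a::zero poly ^ 'n \<Rightarrow> 'a ^ 'n" where
  "coeff_vec i s = (\<chi> k. coeff (s $ k) i)"

definition monom_vec :: "nat \<Rightarrow> 'a::zero ^ 'n \<Rightarrow> 'a poly ^ 'n" where
  "monom_vec i v = (\<chi> k. monom (v $ k) i)"

text \<open>Since \<open>hpoly\<close> has z0 as its outer variable, this is the vector coefficient
  of z0^i z1^j.\<close>

definition bicoeff :: "nat \<Rightarrow> nat \<Rightarrow> hpoly ^ 'n \<Rightarrow> complex ^ 'n" where
  "bicoeff i j s = coeff_vec j (coeff_vec i s)"

definition bimonom :: "nat \<Rightarrow> nat \<Rightarrow> complex ^ 'n \<Rightarrow> hpoly ^ 'n" where
  "bimonom i j v = monom_vec i (monom_vec j v)"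

lemma coeff_vec_add: "coeff_vec i (s + t) = coeff_vec i s + coeff_vec i t"
  by (simp add: coeff_vec_def vec_eq_iff)

lemma coeff_vec_0 [simp]: "coeff_vec i 0 = 0"
  by (simp add: coeff_vec_def vec_eq_iff)

lemma coeff_vec_const_smult: "coeff_vec i ([:c:] *s s) = c *s coeff_vec i s"
  by (simp add: coeff_vec_def vec_eq_iff)

lemma coeff_vec_smult:
  "coeff_vec i (p *s s) = (\<Sum>j\<le>i. coeff p j *s coeff_vec (i - j) s)"
  by (simp add: coeff_vec_def vec_eq_iff coeff_mult)

lemma coeff_vec_monom_smult:
  fixes s :: "'a::comm_semiring_1 poly ^ 'n"
  shows   "coeff_vec i (monom 1 k *s s) = (if k \<le> i then coeff_vec (i - k) s else 0)"
  by (simp add: coeff_vec_def vec_eq_iff coeff_monom_mult)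

lemma coeff_vec_sum: "coeff_vec i (\<Sum>x\<in>X. f x) = (\<Sum>x\<in>X. coeff_vec i (f x))"
  by (induction X rule: infinite_finite_induct) (simp_all add: coeff_vec_add)

lemma coeff_vec_monom_vec [simp]: "coeff_vec i (monom_vec j v) = (if i = j then v else 0)"
  by (auto simp: coeff_vec_def monom_vec_def vec_eq_iff)

lemma coeff_vec_eqI: "(\<And>i. coeff_vec i s = coeff_vec i t) \<Longrightarrow> s = t"
  by (simp add: coeff_vec_def vec_eq_iff poly_eq_iff)

lemma monom_vec_add: "monom_vec i (s + t) = monom_vec i s + monom_vec i t"
  by (simp add: monom_vec_def vec_eq_iff add_monom)

lemma monom_vec_scale: "monom_vec i (c *s v) = [:c:] *s monom_vec i v"
  by (simp add: monom_vec_def vec_eq_iff smult_monom)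

lemma monom_vec_0 [simp]: "monom_vec i 0 = 0"
  by (simp add: monom_vec_def vec_eq_iff)

lemma monom_smult_const_vec: "monom 1 k *s const_vec v = monom_vec k v"
  by (simp add: monom_vec_def const_vec_def vec_eq_iff smult_monom)

lemma const_vec_eq: "const_vec v = monom_vec 0 v"
  by (simp add: const_vec_def monom_vec_def vec_eq_iff monom_0)

lemma monom_smult_monom_vec: "monom 1 k *s monom_vec i v = monom_vec (k + i) (v :: 'a::comm_semiring_1 ^ 'n)"
  by (simp add: monom_vec_def vec_eq_iff mult_monom)

lemma coeff_vec_eventually_0:
  fixes s :: "'a::zero poly ^ 'n::finite"
  obtains N where "\<And>i. i \<ge> N \<Longrightarrow> coeff_vec i s = 0"
proof
  fix i assume "i \<ge> Suc (\<Sum>k\<in>UNIV. degree (s $ k))"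
  moreover have "degree (s $ k) \<le> (\<Sum>k\<in>UNIV. degree (s $ k))" for k
    by (rule member_le_sum) auto
  ultimately have "degree (s $ k) < i" for k
    by (meson Suc_le_lessD order.strict_trans1)
  then show "coeff_vec i s = 0"
    by (simp add: coeff_vec_def vec_eq_iff coeff_eq_0)
qed

lemma monom_vec_decomposition:
  assumes "\<And>i. i \<ge> N \<Longrightarrow> coeff_vec i s = 0"
  shows "s = (\<Sum>i<N. monom_vec i (coeff_vec i s))"
proof (rule coeff_vec_eqI)
  fix i show "coeff_vec i s = coeff_vec i (\<Sum>i<N. monom_vec i (coeff_vec i s))"
    using assms[of i] by (auto simp: coeff_vec_sum)
qed

lemma bicoeff_add: "bicoeff i j (s + t) = bicoeff i j s + bicoeff i j t"
  by (simp add: bicoeff_def coeff_vec_add)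

lemma bicoeff_0 [simp]: "bicoeff i j 0 = 0"
  by (simp add: bicoeff_def)

lemma bicoeff_cscale: "bicoeff i j (cscale c s) = c *s bicoeff i j s"
  by (simp add: bicoeff_def cscale_def coeff_vec_const_smult)

lemma bicoeff_sum: "bicoeff i j (\<Sum>x\<in>X. f x) = (\<Sum>x\<in>X. bicoeff i j (f x))"
  by (simp add: bicoeff_def coeff_vec_sum)

lemma linear_bicoeff: "Vector_Spaces.linear cscale (*s) (bicoeff i j)"
  by (rule Vector_Spaces.linear_iff[THEN iffD2])
     (auto simp: bicoeff_add bicoeff_cscale vector_space_cscale vec.vector_space_axioms)

lemma bicoeff_bimonom [simp]:
  "bicoeff i j (bimonom a b v) = (if i = a \<and> j = b then v else 0)"
  by (simp add: bicoeff_def bimonom_def)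

lemma bicoeff_eqI: "(\<And>i j. bicoeff i j s = bicoeff i j t) \<Longrightarrow> s = t"
  unfolding bicoeff_def by (intro coeff_vec_eqI)

lemma bimonom_add: "bimonom i j (v + w) = bimonom i j v + bimonom i j w"
  by (simp add: bimonom_def monom_vec_add)

lemma bimonom_scale: "bimonom i j (c *s v) = cscale c (bimonom i j v)"
  by (simp add: bimonom_def cscale_def monom_vec_scale)

lemma linear_bimonom: "Vector_Spaces.linear (*s) cscale (bimonom i j)"
  by (rule Vector_Spaces.linear_iff[THEN iffD2])
     (auto simp: bimonom_add bimonom_scale vector_space_cscale vec.vector_space_axioms)

lemma bicoeff_eventually_0:
  fixes s :: "hpoly ^ 'n::finite"
  obtains N where "\<And>i j. i \<ge> N \<or> j \<ge> N \<Longrightarrow> bicoeff i j s = 0"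
proof -
  obtain M where M: "\<And>i. i \<ge> M \<Longrightarrow> coeff_vec i s = 0"
    using coeff_vec_eventually_0 by blast
  have "\<exists>N. \<forall>j\<ge>N. coeff_vec j (coeff_vec i s) = 0" for i
    by (meson coeff_vec_eventually_0)
  then obtain L where L: "\<And>i j. j \<ge> L i \<Longrightarrow> coeff_vec j (coeff_vec i s) = 0"
    by metis
  \<comment> \<open>Only the finitely many i < M matter, and the sum dominates each of their bounds
    \<open>L i\<close>.\<close>
  show thesis
  proof (rule that[of "M + sum L {..<M}"])
    fix i j assume ij: "i \<ge> M + sum L {..<M} \<or> j \<ge> M + sum L {..<M}"
    show "bicoeff i j s = 0"
    proof (cases "i < M")
      case True
      then have "L i \<le> sum L {..<M}" by (intro member_le_sum) auto
      then show ?thesis using ij True L[of i j] by (auto simp: bicoeff_def)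
    qed (simp add: bicoeff_def M)
  qed
qed

lemma bimonom_decomposition:
  assumes "\<And>i j. i \<ge> N \<or> j \<ge> N \<Longrightarrow> bicoeff i j s = 0"
  shows "s = (\<Sum>i<N. \<Sum>j<N. bimonom i j (bicoeff i j s))"
proof (rule bicoeff_eqI)
  fix a b
  have "bicoeff a b (\<Sum>i<N. \<Sum>j<N. bimonom i j (bicoeff i j s)) =
      (\<Sum>i<N. \<Sum>j<N. if a = i \<and> b = j then bicoeff a b s else 0)"
    by (auto simp: bicoeff_sum intro!: sum.cong)
  also have "\<dots> = (\<Sum>i<N. if a = i then \<Sum>j<N. if b = j then bicoeff a b s else 0 else 0)"
    by (intro sum.cong) auto
  also have "\<dots> = bicoeff a b s"
    using assms[of a b] by (auto simp: not_less)
  finally show "bicoeff a b s = bicoeff a b (\<Sum>i<N. \<Sum>j<N. bimonom i j (bicoeff i j s))" ..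
qed

lemma homogeneous_vec_iff:
  "homogeneous_vec m s \<longleftrightarrow> (\<forall>i j. bicoeff i j s \<noteq> 0 \<longrightarrow> i + j = m)"
  by (auto simp: homogeneous_vec_def homogeneous_def bicoeff_def coeff_vec_def vec_eq_iff)

lemma homogeneous_vec_bimonom: "homogeneous_vec (i + j) (bimonom i j v)"
  by (auto simp: homogeneous_vec_iff split: if_splits)

text \<open>By homogeneity the coefficient of z0^i is a single monomial in z1, so putting z1 = 1
  merges no terms.\<close>

lemma coeff_vec_chart0:
  assumes "homogeneous_vec m s"
  shows "coeff_vec i (chart0 s) = (if i \<le> m then bicoeff i (m - i) s else 0)"
proof -
  have "poly (coeff (s $ k) i) 1 = (if i \<le> m then coeff (coeff (s $ k) i) (m - i) else 0)" for k
  proof -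
    have "coeff (s $ k) i = (if i \<le> m then monom (coeff (coeff (s $ k) i) (m - i)) (m - i) else 0)"
    proof (rule poly_eqI)
      fix n
      have "coeff (coeff (s $ k) i) n \<noteq> 0 \<Longrightarrow> i + n = m"
        using assms by (simp add: homogeneous_vec_def homogeneous_def)
      then show "coeff (coeff (s $ k) i) n =
          coeff (if i \<le> m then monom (coeff (coeff (s $ k) i) (m - i)) (m - i) else 0) n"
        by (cases "coeff (coeff (s $ k) i) n = 0") auto
    qed
    then show ?thesis
      by (metis (no_types) mult.right_neutral poly_0 poly_monom power_one)
  qed
  then show ?thesis
    by (simp add: coeff_vec_def chart0_def bicoeff_def vec_eq_iff coeff_map_poly)
qed

lemma coeff_poly_1: "coeff (poly (p :: 'a::comm_semiring_1 poly poly) 1) j = (\<Sum>i\<le>degree p. coeff (coeff p i) j)"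
  by (simp add: poly_altdef coeff_sum)

text \<open>Putting z0 = 1 sums over all powers of z0, of which homogeneity leaves the one with
  exponent m - j.\<close>

lemma coeff_vec_chart_inf:
  assumes "homogeneous_vec m s"
  shows "coeff_vec j (chart_inf s) = (if j \<le> m then bicoeff (m - j) j s else 0)"
proof -
  have "(\<Sum>i\<le>degree (s $ k). coeff (coeff (s $ k) i) j)
      = (if j \<le> m then coeff (coeff (s $ k) (m - j)) j else 0)" for k
  proof -
    have *: "coeff (coeff (s $ k) i) j = 0" if "i + j \<noteq> m" for i
      using assms that by (auto simp: homogeneous_vec_def homogeneous_def)
    have "(\<Sum>i\<le>degree (s $ k). coeff (coeff (s $ k) i) j) =
        (\<Sum>i\<le>degree (s $ k). if i = m - j \<and> j \<le> m then coeff (coeff (s $ k) (m - j)) j else 0)"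
      by (intro sum.cong) (auto intro: *)
    also have "\<dots> = (if j \<le> m then coeff (coeff (s $ k) (m - j)) j else 0)"
      by (auto simp: coeff_eq_0)
    finally show ?thesis .
  qed
  then show ?thesis
    by (simp add: coeff_vec_def chart_inf_def bicoeff_def vec_eq_iff coeff_poly_1)
qed

section \<open>Graded sheaves\<close>

text \<open>\<open>A i\<close> will be the degree i part of a graded submodule. It increases with i
  because multiplication by the coordinate raises the degree by one.\<close>

definition filtration :: "(nat \<Rightarrow> (complex ^ 'n::finite) set) \<Rightarrow> bool" where
  "filtration A \<longleftrightarrow> (\<forall>i. vec.subspace (A i)) \<and> mono A"

definition graded :: "(nat \<Rightarrow> (complex ^ 'n::finite) set) \<Rightarrow> (complex poly ^ 'n) set" where
  "graded A = {s. \<forall>i. coeff_vec i s \<in> A i}"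

lemma filtrationD:
  assumes "filtration A"
  shows "vec.subspace (A i)" "i \<le> j \<Longrightarrow> A i \<subseteq> A j" "mono A" "0 \<in> A i"
  using assms by (auto simp: filtration_def mono_def vec.subspace_0)

lemma filtration_const: "vec.subspace W \<Longrightarrow> filtration (\<lambda>_. W)"
  by (simp add: filtration_def mono_def)

text \<open>The dimensions are bounded by n, so a step of maximal dimension equals all later ones,
  and by monotonicity it contains all earlier ones.\<close>

lemma filtration_stable:
  fixes A :: "nat \<Rightarrow> (complex ^ 'n::finite) set"
  assumes "filtration A"
  obtains N where "\<And>i. i \<ge> N \<Longrightarrow> A i = (\<Union>i. A i)"
proof -
  have bdd: "vec.dim (A i) \<le> CARD('n)" for i
    using vec.dim_subset_UNIV[of "A i"] by (simp add: vec.dimension_def card_cart_basis)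
  define D where "D = Max (range (\<lambda>i. vec.dim (A i)))"
  have fin: "finite (range (\<lambda>i. vec.dim (A i)))"
    by (rule finite_subset[of _ "{..CARD('n)}"]) (use bdd in auto)
  have "D \<in> range (\<lambda>i. vec.dim (A i))"
    unfolding D_def by (rule Max_in) (use fin in auto)
  then obtain N where N: "D = vec.dim (A N)" by auto
  have max: "vec.dim (A i) \<le> D" for i
    unfolding D_def by (rule Max_ge) (use fin in auto)
  have eq: "A N = A i" if "i \<ge> N" for i
    using filtrationD[OF assms] that max N by (metis vec.subspace_dim_equal)
  have "A i = (\<Union>i. A i)" if "i \<ge> N" for i
  proof -
    have "A j \<subseteq> A i" for j
      using filtrationD(2)[OF assms, of j "max i j"] eq[OF that] eq[of "max i j"] that by auto
    then show ?thesis by auto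
  qed
  then show thesis by (rule that)
qed

lemma subspace_UN_filtration:
  "filtration A \<Longrightarrow> vec.subspace (\<Union>i. A i)"
  by (metis filtration_stable filtrationD(1) le_refl)

lemma subspace_graded:
  assumes "filtration A"
  shows "cvec.subspace (graded A)"
proof (rule cvec.subspaceI)
  show "0 \<in> graded A" using filtrationD(4)[OF assms] by (simp add: graded_def)
  show "s + t \<in> graded A" if "s \<in> graded A" "t \<in> graded A" for s t
    using that filtrationD(1)[OF assms] by (auto simp: graded_def coeff_vec_add intro: vec.subspace_add)
  show "p *s s \<in> graded A" if "s \<in> graded A" for p s
    unfolding graded_def coeff_vec_smult mem_Collect_eq
  proof (intro allI vec.subspace_sum filtrationD(1)[OF assms])
    fix i j
    have "coeff_vec (i - j) s \<in> A i"
      using that filtrationD(2)[OF assms, of "i - j" i] by (auto simp: graded_def)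
    then show "coeff p j *s coeff_vec (i - j) s \<in> A i"
      by (rule vec.subspace_scale[OF filtrationD(1)[OF assms]])
  qed
qed

lemma monom_vec_in_graded:
  "filtration A \<Longrightarrow> monom_vec i v \<in> graded A \<longleftrightarrow> v \<in> A i"
  using filtrationD(4)[of A] by (auto simp: graded_def)

lemma graded_inject:
  assumes "filtration A" "filtration B"
  shows "graded A = graded B \<longleftrightarrow> A = B"
proof
  assume "graded A = graded B"
  then have "v \<in> A i \<longleftrightarrow> v \<in> B i" for i v
    using monom_vec_in_graded[OF assms(1), of i v] monom_vec_in_graded[OF assms(2), of i v] by simp
  then show "A = B" by (intro ext set_eqI)
qed simp

lemma graded_mono: "(\<And>i. A i \<subseteq> B i) \<Longrightarrow> graded A \<subseteq> graded B"
  by (auto simp: graded_def)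

text \<open>For a primitive root of unity \<open>t\<close> of large order, the operators \<open>s(z) \<mapsto> s(tz) - t^j s(z)\<close>
  successively remove the coefficients \<open>j \<noteq> i\<close>.\<close>

lemma circle_invariant_monom_vec:
  fixes V :: "(complex poly ^ 'n::finite) set"
  assumes V: "cvec.subspace V"
    and inv: "\<And>t s. cmod t = 1 \<Longrightarrow> s \<in> V \<Longrightarrow> (\<chi> k. pcompose (s $ k) [:0, t:]) \<in> V"
    and s: "s \<in> V"
  shows "monom_vec i (coeff_vec i s) \<in> V"
proof -
  obtain N where N: "\<And>i. i \<ge> N \<Longrightarrow> coeff_vec i s = 0"
    using coeff_vec_eventually_0 by blast
  \<comment> \<open>The order \<open>Suc N\<close> is positive even for N = 0, and the powers of t
    with exponents below N are distinct.\<close>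
  define t where "t = cis (2 * pi / real (Suc N))"
  have t1: "cmod t = 1" by (simp add: t_def)
  have tpow: "t ^ a \<noteq> t ^ b" if "a < N" "b < N" "a \<noteq> b" for a b
  proof -
    have "inj_on (\<lambda>k. cis (2 * pi * real k / real (Suc N))) {..<Suc N}"
      using Complex.bij_betw_roots_unity[of "Suc N"] by (auto simp: bij_betw_def)
    then have "cis (2 * pi * real a / real (Suc N)) \<noteq> cis (2 * pi * real b / real (Suc N))"
      using that by (auto dest: inj_onD)
    then show ?thesis by (simp add: t_def Complex.DeMoivre mult_ac)
  qed
  have "\<exists>s'\<in>V. \<forall>i. coeff_vec i s' = (\<Prod>j\<in>J. t ^ i - t ^ j) *s coeff_vec i s" if "finite J" for J :: "nat set"
    using that
  proof (induction J)
    case empty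
    show ?case using s by auto
  next
    case (insert j J)
    then obtain s' where s': "s' \<in> V" "\<And>i. coeff_vec i s' = (\<Prod>j\<in>J. t ^ i - t ^ j) *s coeff_vec i s"
      by auto
    let ?s = "(\<chi> k. pcompose (s' $ k) [:0, t:]) - [:t ^ j:] *s s'"
    have "?s \<in> V"
      using s'(1) by (intro cvec.subspace_diff[OF V] cvec.subspace_scale[OF V] inv t1)
    moreover have "coeff_vec i ?s = (t ^ i - t ^ j) *s coeff_vec i s'" for i
      by (simp add: coeff_vec_def vec_eq_iff coeff_pcompose_linear algebra_simps)
    ultimately show ?case
      using insert.hyps by (auto intro!: bexI[of _ ?s] simp: s'(2) vector_smult_assoc)
  qed
  \<comment> \<open>All exponents below N except i are removed; for i < N the remaining term has a
    nonzero factor, which is divided out below.\<close>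
  from this[of "{..<N} - {i}"] obtain s' where
    s': "s' \<in> V" "\<And>a. coeff_vec a s' = (\<Prod>j\<in>{..<N} - {i}. t ^ a - t ^ j) *s coeff_vec a s"
    by auto
  show ?thesis
  proof (cases "i < N")
    case True
    define c where "c = (\<Prod>j\<in>{..<N} - {i}. t ^ i - t ^ j)"
    have "c \<noteq> 0" using tpow True by (auto simp: c_def)
    have "[:1 / c:] *s s' = monom_vec i (coeff_vec i s)"
    proof (rule coeff_vec_eqI)
      fix a
      have "coeff_vec a s' = (if a = i then c *s coeff_vec i s else 0)"
      proof (cases "a = i \<or> a \<ge> N")
        case True
        then show ?thesis using N[of a] by (auto simp: s'(2) c_def)
      next
        case False
        then have "(\<Prod>j\<in>{..<N} - {i}. t ^ a - t ^ j) = 0"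
          by (intro prod_zero) auto
        then show ?thesis using False by (simp add: s'(2))
      qed
      then show "coeff_vec a ([:1 / c:] *s s') = coeff_vec a (monom_vec i (coeff_vec i s))"
        using \<open>c \<noteq> 0\<close> by (simp add: coeff_vec_const_smult vector_smult_assoc)
    qed
    then show ?thesis using cvec.subspace_scale[OF V s'(1)] by metis
  next
    case False
    then show ?thesis using N[of i] cvec.subspace_0[OF V] by simp
  qed
qed

lemma circle_invariant_graded:
  fixes V :: "(complex poly ^ 'n::finite) set"
  assumes V: "cvec.subspace V"
    and inv: "\<And>t s. cmod t = 1 \<Longrightarrow> s \<in> V \<Longrightarrow> (\<chi> k. pcompose (s $ k) [:0, t:]) \<in> V"
  obtains A where "filtration A" "V = graded A"
proof
  \<comment> \<open>Every homogeneous component of an element of \<open>V\<close> lies in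
    \<open>V\<close> again, so these pieces determine \<open>V\<close>.\<close>
  define A where "A = (\<lambda>i. {v. monom_vec i v \<in> V})"
  show "filtration A"
    unfolding filtration_def
  proof (intro conjI allI)
    show "vec.subspace (A i)" for i
      unfolding A_def
      by (rule vec.subspaceI)
         (auto simp: monom_vec_add monom_vec_scale intro: cvec.subspace_0[OF V]
           cvec.subspace_add[OF V] cvec.subspace_scale[OF V])
    show "mono A"
    proof (rule monoI, rule subsetI)
      fix i j :: nat and v assume "i \<le> j" "v \<in> A i"
      then have "monom 1 (j - i) *s monom_vec i v \<in> V"
        by (auto simp: A_def intro: cvec.subspace_scale[OF V])
      then show "v \<in> A j" using \<open>i \<le> j\<close> by (simp add: A_def monom_smult_monom_vec)
    qed
  qed
  show "V = graded A"
  proof (intro set_eqI iffI)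
    fix s assume "s \<in> V"
    then show "s \<in> graded A"
      using circle_invariant_monom_vec[OF V inv] by (auto simp: graded_def A_def)
  next
    fix s assume *: "s \<in> graded A"
    obtain N where "\<And>i. i \<ge> N \<Longrightarrow> coeff_vec i s = 0"
      using coeff_vec_eventually_0 by blast
    then have "s = (\<Sum>i<N. monom_vec i (coeff_vec i s))"
      by (rule monom_vec_decomposition)
    moreover have "\<dots> \<in> V"
      using * by (intro cvec.subspace_sum[OF V]) (auto simp: graded_def A_def)
    ultimately show "s \<in> V" by simp
  qed
qed

lemma graded_circle_invariant:
  assumes "filtration A" "s \<in> graded A"
  shows "(\<chi> k. pcompose (s $ k) [:0, t:]) \<in> graded A"
proof -
  have "coeff_vec i (\<chi> k. pcompose (s $ k) [:0, t:]) = t ^ i *s coeff_vec i s" for i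
    by (simp add: coeff_vec_def vec_eq_iff coeff_pcompose_linear)
  then show ?thesis
    using assms filtrationD(1)[OF assms(1)] by (auto simp: graded_def intro: vec.subspace_scale)
qed

lemma pcompose_scale_scale:
  fixes s :: "'a::field poly ^ 'n"
  assumes "a * b = 1"
  shows "(\<chi> k. pcompose ((\<chi> k. pcompose (s $ k) [:0, a:]) $ k) [:0, b:]) = s"
  using assms
  by (simp add: vec_eq_iff poly_eq_iff coeff_pcompose_linear power_mult_distrib[symmetric] mult.commute[of b a]
      flip: mult.assoc)

lemma circle_fixed_graded:
  assumes "filtration A" "filtration B"
  shows "circle_fixed (graded A, graded B)"
proof -
  have *: "(\<lambda>s. \<chi> k. pcompose (s $ k) [:0, t:]) ` graded C = graded C"
    if "filtration C" "t \<noteq> 0" for C :: "nat \<Rightarrow> (complex ^ 'n) set" and t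
  proof
    show "(\<lambda>s. \<chi> k. pcompose (s $ k) [:0, t:]) ` graded C \<subseteq> graded C"
      using graded_circle_invariant[OF that(1)] by blast
    show "graded C \<subseteq> (\<lambda>s. \<chi> k. pcompose (s $ k) [:0, t:]) ` graded C"
    proof
      fix s assume "s \<in> graded C"
      then show "s \<in> (\<lambda>s. \<chi> k. pcompose (s $ k) [:0, t:]) ` graded C"
        using pcompose_scale_scale[of "inverse t" t s] graded_circle_invariant[OF that(1), of s "inverse t"] that(2)
        by (intro image_eqI[of _ _ "\<chi> k. pcompose (s $ k) [:0, inverse t:]"]) auto
    qed
  qed
  show ?thesis
    unfolding circle_fixed_def act_def
  proof (intro allI impI)
    fix t :: complex assume "cmod t = 1"
    then have "t \<noteq> 0" by auto
    then show "((\<lambda>s. \<chi> k. s $ k \<circ>\<^sub>p [:0, inverse t:]) ` fst (graded A, graded B),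
          (\<lambda>s. \<chi> k. s $ k \<circ>\<^sub>p [:0, t:]) ` snd (graded A, graded B)) = (graded A, graded B)"
      using *[OF assms(1), of "inverse t"] *[OF assms(2), of t] by simp
  qed
qed

lemma circle_fixed_imp_graded:
  assumes "circle_fixed V" "coherent_subsheaf V"
  obtains A B where "filtration A" "filtration B" "V = (graded A, graded B)"
proof -
  have sub: "cvec.subspace (fst V)" "cvec.subspace (snd V)"
    using assms(2) by (auto simp: coherent_subsheaf_def)
  have 1: "(\<chi> k. pcompose (s $ k) [:0, t:]) \<in> fst V" if "cmod t = 1" "s \<in> fst V" for t s
  proof -
    \<comment> \<open>On U_0 the action of t substitutes \<open>inverse t\<close>; hence
      substituting t is the action of \<open>inverse t\<close>.\<close>
    have "cmod (inverse t) = 1" using that by (simp add: norm_inverse)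
    then have "act (inverse t) V = V" using assms(1) by (simp add: circle_fixed_def)
    then have "fst (act (inverse t) V) = fst V" by simp
    then show ?thesis using that(2) by (auto simp: act_def)
  qed
  have 2: "(\<chi> k. pcompose (s $ k) [:0, t:]) \<in> snd V" if "cmod t = 1" "s \<in> snd V" for t s
  proof -
    have "snd (act t V) = snd V" using assms(1) that(1) by (simp add: circle_fixed_def)
    then show ?thesis using that(2) by (auto simp: act_def)
  qed
  from circle_invariant_graded[OF sub(1) 1] obtain A where A: "filtration A" "fst V = graded A" by blast
  from circle_invariant_graded[OF sub(2) 2] obtain B where B: "filtration B" "snd V = graded B" by blast
  show thesis using that[OF A(1) B(1)] A(2) B(2) by (simp add: prod_eq_iff)
qed

text \<open>Multiplication by z^k shifts the coefficients by k degrees, into the stable range once k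
  is large. Over the overlap of the charts only the union of the filtration is remembered.\<close>

lemma ex_monom_smult_graded:
  assumes "filtration A"
  shows "(\<exists>k. monom 1 k *s s \<in> graded A) \<longleftrightarrow> (\<forall>i. coeff_vec i s \<in> (\<Union>i. A i))"
proof
  assume "\<exists>k. monom 1 k *s s \<in> graded A"
  then obtain k where "monom 1 k *s s \<in> graded A" ..
  then have "coeff_vec i s \<in> A (k + i)" for i
    by (auto simp: graded_def coeff_vec_monom_smult dest: spec[of _ "k + i"])
  then show "\<forall>i. coeff_vec i s \<in> (\<Union>i. A i)" by blast
next
  assume *: "\<forall>i. coeff_vec i s \<in> (\<Union>i. A i)"
  obtain N where "\<And>i. i \<ge> N \<Longrightarrow> A i = (\<Union>i. A i)"
    using filtration_stable[OF assms] by blast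
  then have "monom 1 N *s s \<in> graded A"
    using * filtrationD(4)[OF assms] by (auto simp: graded_def coeff_vec_monom_smult)
  then show "\<exists>k. monom 1 k *s s \<in> graded A" ..
qed

lemma coherent_subsheaf_graded:
  assumes "filtration A" "filtration B"
  shows "coherent_subsheaf (graded A, graded B) \<longleftrightarrow> (\<Union>i. A i) = (\<Union>i. B i)" (is "?l \<longleftrightarrow> ?A = ?B")
proof
  assume ?l
  have "v \<in> ?A \<longleftrightarrow> v \<in> ?B" for v
  proof -
    \<comment> \<open>The constant section v tests the gluing condition on a single vector.\<close>
    have h: "homogeneous_vec 0 (bimonom 0 0 v)"
      using homogeneous_vec_bimonom[of 0 0 v] by simp
    have "(\<forall>i. coeff_vec i (chart0 (bimonom 0 0 v)) \<in> ?A) \<longleftrightarrow> (\<forall>i. coeff_vec i (chart_inf (bimonom 0 0 v)) \<in> ?B)"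
      using \<open>?l\<close> h unfolding coherent_subsheaf_def fst_conv snd_conv
      by (metis ex_monom_smult_graded[OF assms(1)] ex_monom_smult_graded[OF assms(2)])
    moreover have "coeff_vec i (chart0 (bimonom 0 0 v)) = (if i = 0 then v else 0)"
      "coeff_vec i (chart_inf (bimonom 0 0 v)) = (if i = 0 then v else 0)" for i
      by (auto simp: coeff_vec_chart0[OF h] coeff_vec_chart_inf[OF h])
    moreover have "0 \<in> ?A" "0 \<in> ?B"
      using filtrationD(4)[OF assms(1)] filtrationD(4)[OF assms(2)] by blast+
    ultimately show ?thesis by (metis (full_types))
  qed
  then show "?A = ?B" by blast
next
  assume eq: "?A = ?B"
  have "(\<forall>i. coeff_vec i (chart0 s) \<in> ?A) \<longleftrightarrow> (\<forall>i. coeff_vec i (chart_inf s) \<in> ?B)"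
    if "homogeneous_vec N s" for N s
  proof -
    have "0 \<in> ?B" using filtrationD(4)[OF assms(2)] by blast
    \<comment> \<open>The two charts list the same coefficients in opposite orders.\<close>
    have "(\<forall>i\<le>N. bicoeff i (N - i) s \<in> ?B) \<longleftrightarrow> (\<forall>i\<le>N. bicoeff (N - i) i s \<in> ?B)"
      by (metis diff_diff_cancel diff_le_self)
    then show ?thesis
      using \<open>0 \<in> ?B\<close> unfolding eq coeff_vec_chart0[OF that] coeff_vec_chart_inf[OF that]
      by (metis (full_types))
  qed
  then show ?l
    unfolding coherent_subsheaf_def fst_conv snd_conv ex_monom_smult_graded[OF assms(1)] ex_monom_smult_graded[OF assms(2)]
    using subspace_graded[OF assms(1)] subspace_graded[OF assms(2)] by blast
qed

lemma sections_graded: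
  assumes "filtration A" "filtration B"
  shows "sections m (graded A, graded B) =
    {s. homogeneous_vec m s \<and> (\<forall>i\<le>m. bicoeff i (m - i) s \<in> A i \<inter> B (m - i))}"
proof -
  have "chart0 s \<in> graded A \<and> chart_inf s \<in> graded B \<longleftrightarrow> (\<forall>i\<le>m. bicoeff i (m - i) s \<in> A i \<inter> B (m - i))"
    if "homogeneous_vec m s" for s
  proof -
    have "chart0 s \<in> graded A \<longleftrightarrow> (\<forall>i\<le>m. bicoeff i (m - i) s \<in> A i)"
      using filtrationD(4)[OF assms(1)] by (auto simp: graded_def coeff_vec_chart0[OF that])
    moreover have "chart_inf s \<in> graded B \<longleftrightarrow> (\<forall>i\<le>m. bicoeff i (m - i) s \<in> B (m - i))"
    proof -
      have "chart_inf s \<in> graded B \<longleftrightarrow> (\<forall>i\<le>m. bicoeff (m - i) i s \<in> B i)"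
        using filtrationD(4)[OF assms(2)] by (auto simp: graded_def coeff_vec_chart_inf[OF that])
      also have "\<dots> \<longleftrightarrow> (\<forall>i\<le>m. bicoeff i (m - i) s \<in> B (m - i))"
        by (metis diff_diff_cancel diff_le_self)
      finally show ?thesis .
    qed
    ultimately show ?thesis by auto
  qed
  then show ?thesis by (auto simp: sections_def)
qed

section \<open>Bases given as families\<close>

text \<open>Stated for modules because it is applied over polynomial rings as well as over the
  complex numbers.\<close>

lemma (in module) independent_image_iff:
  assumes "finite I" "inj_on f I"
  shows "independent (f ` I) \<longleftrightarrow> (\<forall>c. (\<Sum>i\<in>I. scale (c i) (f i)) = 0 \<longrightarrow> (\<forall>i\<in>I. c i = 0))"
proof
  assume ind: "independent (f ` I)"
  show "\<forall>c. (\<Sum>i\<in>I. scale (c i) (f i)) = 0 \<longrightarrow> (\<forall>i\<in>I. c i = 0)"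
  proof (intro allI impI ballI)
    fix c i assume sum: "(\<Sum>i\<in>I. scale (c i) (f i)) = 0" and "i \<in> I"
    have "(\<Sum>x\<in>f ` I. scale (c (inv_into I f x)) x) = 0"
      using sum assms(2) by (simp add: sum.reindex)
    then have "c (inv_into I f (f i)) = 0"
      using \<open>i \<in> I\<close> assms(1) by (intro independentD[OF ind]) auto
    then show "c i = 0" using assms(2) \<open>i \<in> I\<close> by simp
  qed
next
  assume *: "\<forall>c. (\<Sum>i\<in>I. scale (c i) (f i)) = 0 \<longrightarrow> (\<forall>i\<in>I. c i = 0)"
  have "c x = 0" if "(\<Sum>x\<in>f ` I. scale (c x) x) = 0" "x \<in> f ` I" for c x
    using *[rule_format, of "c \<circ> f"] that by (auto simp: sum.reindex[OF assms(2)])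
  then show "independent (f ` I)"
    using assms(1) by (auto simp: dependent_finite)
qed

text \<open>Coefficients are attached to indices, so \<open>f\<close> may repeat values: a further
  term c x is added at any one index i with x = f i.\<close>

lemma (in module) span_image_iff:
  assumes "finite I"
  shows "x \<in> span (f ` I) \<longleftrightarrow> (\<exists>c. x = (\<Sum>i\<in>I. scale (c i) (f i)))"
proof
  show "x \<in> span (f ` I)" if "\<exists>c. x = (\<Sum>i\<in>I. scale (c i) (f i))"
    using that by (auto intro!: span_sum span_scale intro: span_base)
  assume "x \<in> span (f ` I)"
  then show "\<exists>c. x = (\<Sum>i\<in>I. scale (c i) (f i))"
  proof (induction rule: span_induct_alt)
    case base
    show ?case by (rule exI[of _ "\<lambda>_. 0"]) simp
  next
    case (step c x y)
    then obtain i d where "i \<in> I" "x = f i" "y = (\<Sum>i\<in>I. scale (d i) (f i))" by auto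
    then have "scale c x + y = (\<Sum>j\<in>I. scale ((if j = i then c else 0) + d j) (f j))"
      using assms by (simp add: scale_left_distrib sum.distrib if_distrib[of "\<lambda>c. scale c _"] cong: if_cong)
    then show ?case by (rule exI[of _ "\<lambda>j. (if j = i then c else 0) + d j"])
  qed
qed

text \<open>Two equal members at different indices would give a relation with coefficients 1 and
  -1.\<close>

lemma (in vector_space) independent_family_inj:
  assumes "finite I" "\<And>c i. (\<Sum>i\<in>I. scale (c i) (f i)) = 0 \<Longrightarrow> i \<in> I \<Longrightarrow> c i = 0"
  shows "inj_on f I"
proof (rule inj_onI, rule ccontr)
  fix i j assume ij: "i \<in> I" "j \<in> I" "f i = f j" "i \<noteq> j"
  have "(\<Sum>k\<in>I. scale ((if k = i then 1 else 0) + (if k = j then - 1 else 0)) (f k)) = 0"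
    using ij assms(1)
    by (simp add: scale_left_distrib sum.distrib if_distrib[of "\<lambda>c. scale c _"] cong: if_cong)
  from assms(2)[OF this ij(1)] show False using ij by simp
qed

text \<open>The index set is arbitrary so that frames, indexed by numbers, and bases of sections,
  indexed by pairs of a weight and a number, are treated alike.\<close>

definition basis_family :: "(complex \<Rightarrow> 'v \<Rightarrow> 'v) \<Rightarrow> 'i set \<Rightarrow> ('i \<Rightarrow> 'v::ab_group_add) \<Rightarrow> 'v set \<Rightarrow> bool" where
  "basis_family sc I f S \<longleftrightarrow> inj_on f I \<and> \<not> module.dependent sc (f ` I) \<and> module.span sc (f ` I) = S"

lemma frame_iff_basis_family:
  "frame sc Us b \<longleftrightarrow> (\<forall>j<length Us. basis_family sc {..<vector_space.dim sc (Us ! j)} (b j) (Us ! j))"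
  by (simp add: frame_def basis_family_def Let_def)

lemma basis_familyI:
  assumes "vector_space sc" "finite I"
    and "\<And>c i. (\<Sum>i\<in>I. sc (c i) (f i)) = 0 \<Longrightarrow> i \<in> I \<Longrightarrow> c i = 0"
    and "module.span sc (f ` I) = S"
  shows "basis_family sc I f S"
proof -
  interpret vector_space sc by fact
  have "inj_on f I" using assms(2,3) by (rule independent_family_inj)
  then show ?thesis
    using assms by (auto simp: basis_family_def independent_image_iff)
qed

lemma basis_familyD:
  assumes "vector_space sc" "finite I" "basis_family sc I f S"
  shows "inj_on f I" "module.span sc (f ` I) = S" "vector_space.dim sc S = card I"
    "(\<Sum>i\<in>I. sc (c i) (f i)) = 0 \<Longrightarrow> i \<in> I \<Longrightarrow> c i = 0"
    "i \<in> I \<Longrightarrow> f i \<in> S"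
proof -
  interpret vector_space sc by fact
  have bf: "inj_on f I" "independent (f ` I)" "span (f ` I) = S"
    using assms(3) by (auto simp: basis_family_def)
  show "inj_on f I" "span (f ` I) = S" by fact+
  show "dim S = card I" using bf dim_span_eq_card_independent card_image by metis
  show "(\<Sum>i\<in>I. sc (c i) (f i)) = 0 \<Longrightarrow> i \<in> I \<Longrightarrow> c i = 0"
    using bf(2) independent_image_iff[OF assms(2) bf(1)] by blast
  show "i \<in> I \<Longrightarrow> f i \<in> S" using bf(3) span_base by blast
qed

lemma basis_family_reindex:
  assumes "bij_betw h J I" "basis_family sc I f S"
  shows "basis_family sc J (f \<circ> h) S"
  using assms unfolding basis_family_def bij_betw_def image_comp[symmetric] by (metis comp_inj_on)

lemma basis_family_exists:
  fixes S :: "(complex ^ 'n::finite) set"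
  assumes "vec.subspace S"
  obtains f where "basis_family (*s) {..<vec.dim S} f S"
proof -
  obtain B where B: "B \<subseteq> S" "vec.independent B" "S \<subseteq> vec.span B" "card B = vec.dim S"
    using vec.basis_exists by blast
  have "finite B" using B(2) vec.finiteI_independent by blast
  then obtain f where "bij_betw f {..<vec.dim S} B"
    using ex_bij_betw_nat_finite[of B] B(4) by (auto simp: atLeast0LessThan)
  moreover have "vec.span B = S"
    using B assms by (simp add: vec.span_minimal subset_antisym)
  ultimately have "basis_family (*s) {..<vec.dim S} f S"
    using B(2) by (auto simp: basis_family_def bij_betw_def)
  then show thesis by (rule that)
qed

text \<open>The expansions of x over \<open>P\<close> and over \<open>Q\<close> differ by a relation
  inside \<open>B\<close>, which has to be trivial.\<close>

lemma (in vector_space) disjoint_spans: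
  assumes "independent B" "finite B" "P \<subseteq> B" "Q \<subseteq> B" "P \<inter> Q = {}" "x \<in> span P" "x \<in> span Q"
  shows "x = 0"
proof -
  have fin: "finite P" "finite Q" using assms finite_subset by blast+
  obtain a where a: "x = (\<Sum>v\<in>P. scale (a v) v)"
    using span_image_iff[OF fin(1), of x "\<lambda>v. v"] assms(6) by auto
  obtain b where b: "x = (\<Sum>v\<in>Q. scale (b v) v)"
    using span_image_iff[OF fin(2), of x "\<lambda>v. v"] assms(7) by auto
  have "(\<Sum>v\<in>P \<union> Q. scale (if v \<in> P then a v else - b v) v)
      = (\<Sum>v\<in>P. scale (a v) v) + (\<Sum>v\<in>Q. scale (- b v) v)"
    using fin assms(5) by (subst sum.union_disjoint) (auto intro!: sum.cong arg_cong2[of _ _ _ _ "(+)"])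
  also have "\<dots> = 0" unfolding scale_minus_left sum_negf a[symmetric] b[symmetric] by simp
  finally have "(if v \<in> P then a v else - b v) = 0" if "v \<in> P \<union> Q" for v
    using that assms fin by (intro independentD[OF assms(1), of "P \<union> Q"]) auto
  then have "a v = 0" if "v \<in> P" for v using that by force
  then show ?thesis unfolding a by (auto intro: sum.neutral)
qed

text \<open>The difference \<open>S - T\<close> in the last hypothesis allows the two sets to
  overlap, as they do when part of a basis is kept while it is extended inside another
  subspace.\<close>

lemma (in vector_space) independent_Un:
  assumes "independent S" "independent T" "finite S" "finite T"
    and "\<And>x. x \<in> span (S - T) \<Longrightarrow> x \<in> span T \<Longrightarrow> x = 0"
  shows "independent (S \<union> T)"
proof -
  have "c v = 0" if c: "(\<Sum>v\<in>S \<union> T. scale (c v) v) = 0" and v: "v \<in> S \<union> T" for c v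
  proof -
    have split: "(\<Sum>v\<in>S \<union> T. scale (c v) v) = (\<Sum>v\<in>S - T. scale (c v) v) + (\<Sum>v\<in>T. scale (c v) v)"
      using assms(3,4) by (subst sum.union_disjoint[symmetric]) (auto intro: sum.cong)
    then have eq: "(\<Sum>v\<in>S - T. scale (c v) v) = - (\<Sum>v\<in>T. scale (c v) v)"
      using c by (simp add: eq_neg_iff_add_eq_0)
    have "(\<Sum>v\<in>S - T. scale (c v) v) \<in> span (S - T)"
      by (intro span_sum span_scale span_base)
    moreover have "(\<Sum>v\<in>S - T. scale (c v) v) \<in> span T"
      unfolding eq by (intro span_neg span_sum span_scale span_base)
    ultimately have 0: "(\<Sum>v\<in>S - T. scale (c v) v) = 0" by (rule assms(5))
    show ?thesis
    proof (cases "v \<in> T")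
      case True
      have "(\<Sum>v\<in>T. scale (c v) v) = 0" using 0 eq by simp
      then show ?thesis using independentD[OF assms(2,4) subset_refl] True by blast
    next
      case False
      then show ?thesis using independentD[OF assms(1) _ _ 0] v assms(3) by blast
    qed
  qed
  then show ?thesis using assms(3,4) by (auto simp: dependent_finite)
qed

section \<open>A basis adapted to two filtrations\<close>

text \<open>For independent \<open>S\<close> this means that the members of \<open>S\<close> lying
  in \<open>U\<close> form a basis of \<open>U\<close>.\<close>

definition adapted :: "(complex ^ 'n::finite) set \<Rightarrow> (complex ^ 'n) set \<Rightarrow> bool" where
  "adapted S U \<longleftrightarrow> vec.span (S \<inter> U) = U"

lemma adapted_mono:
  assumes "vec.subspace U" "adapted S U" "S \<subseteq> T"
  shows "adapted T U"
proof -
  have "U \<subseteq> vec.span (T \<inter> U)"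
    using assms(2) vec.span_mono[of "S \<inter> U" "T \<inter> U"] assms(3) by (auto simp: adapted_def)
  then show ?thesis
    unfolding adapted_def using vec.span_minimal[OF Int_lower2 assms(1)] by blast
qed

text \<open>A single step from \<open>P\<close> to \<open>Q\<close> of the first filtration, carried
  through all steps of the second. Old and new vectors remain independent because a common vector x
  of their spans lies in \<open>P \<inter> B J\<close>, which is spanned by members of
  \<open>S\<close> already contained in the new set \<open>Y\<close>.\<close>

lemma adapted_basis_step:
  fixes P Q :: "(complex ^ 'n::finite) set"
  assumes P: "vec.subspace P" and Q: "vec.subspace Q" and PQ: "P \<subseteq> Q" and B: "filtration B"
    and ind: "vec.independent S" and SP: "\<And>j. adapted S (P \<inter> B j)" and "S \<subseteq> P"
  obtains T where "S \<subseteq> T" "T \<subseteq> Q" "vec.independent T" "\<And>j. adapted T (Q \<inter> B j)"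
proof -
  have QB: "vec.subspace (Q \<inter> B j)" for j using Q filtrationD(1)[OF B] by (rule vec.subspace_inter)
  have "\<exists>X. X \<subseteq> Q \<and> vec.independent (S \<union> X) \<and> X \<subseteq> B J \<and> (\<forall>j\<le>J. adapted (S \<union> X) (Q \<inter> B j))" for J
  proof -
    have step: "\<exists>Y. Y \<subseteq> Q \<and> vec.independent (S \<union> Y) \<and> X \<subseteq> Y \<and> Y \<subseteq> B J \<and> adapted (S \<union> Y) (Q \<inter> B J)"
      if X: "X \<subseteq> Q" "X \<subseteq> B J" "vec.independent (S \<union> X)" for X J
    proof -
      \<comment> \<open>All vectors found so far that lie in \<open>B J\<close> are put into
        \<open>Y\<close>, so that \<open>S - Y\<close> has no member in \<open>B J\<close>.\<close>
      let ?U = "(S \<union> X) \<inter> B J"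
      have "?U \<subseteq> Q \<inter> B J" using X assms by auto
      moreover have "vec.independent ?U"
        using X(3) by (rule vec.independent_mono) auto
      ultimately obtain Y where Y: "?U \<subseteq> Y" "Y \<subseteq> Q \<inter> B J" "vec.independent Y" "Q \<inter> B J \<subseteq> vec.span Y"
        using vec.maximal_independent_subset_extend by metis
      have "vec.independent (S \<union> Y)"
      proof (rule vec.independent_Un[OF ind Y(3)])
        show "finite S" "finite Y" using ind Y(3) vec.finiteI_independent by blast+
        fix x assume x: "x \<in> vec.span (S - Y)" "x \<in> vec.span Y"
        have "x \<in> P" using x(1) vec.span_minimal[OF _ P, of "S - Y"] \<open>S \<subseteq> P\<close> by blast
        moreover have "x \<in> B J"
          using x(2) Y(2) vec.span_minimal[OF _ filtrationD(1)[OF B], of Y J] by blast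
        ultimately have "x \<in> vec.span (S \<inter> P \<inter> B J)"
          using SP[of J] by (simp add: adapted_def Int_assoc)
        moreover have "(S - Y) \<inter> (S \<inter> P \<inter> B J) = {}" using Y(1) by auto
        ultimately show "x = 0"
          using x(1) by (intro vec.disjoint_spans[OF ind \<open>finite S\<close>, of "S - Y" "S \<inter> P \<inter> B J" x]) auto
      qed
      moreover have "adapted Y (Q \<inter> B J)"
        unfolding adapted_def Int_absorb2[OF Y(2)] using Y(4) vec.span_minimal[OF Y(2) QB] by auto
      then have "adapted (S \<union> Y) (Q \<inter> B J)" by (rule adapted_mono[OF QB]) auto
      ultimately show ?thesis using Y(1,2) X(2) by (intro exI[of _ Y]) auto
    qed
    show ?thesis
    proof (induction J)
      case 0
      from step[of "{}" 0] obtain Y where "Y \<subseteq> Q" "vec.independent (S \<union> Y)" "Y \<subseteq> B 0"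
        "adapted (S \<union> Y) (Q \<inter> B 0)"
        using ind by auto
      then show ?case by (intro exI[of _ Y]) auto
    next
      case (Suc J)
      then obtain X where X: "X \<subseteq> Q" "vec.independent (S \<union> X)" "X \<subseteq> B J"
        "\<forall>j\<le>J. adapted (S \<union> X) (Q \<inter> B j)" by blast
      have "X \<subseteq> B (Suc J)" using X(3) filtrationD(2)[OF B, of J "Suc J"] by auto
      from step[OF X(1) this X(2)] obtain Y where Y: "Y \<subseteq> Q" "vec.independent (S \<union> Y)" "X \<subseteq> Y" "Y \<subseteq> B (Suc J)"
        "adapted (S \<union> Y) (Q \<inter> B (Suc J))" by auto
      have "adapted (S \<union> Y) (Q \<inter> B j)" if "j \<le> Suc J" for j
      proof (cases "j = Suc J")
        case False
        then have "adapted (S \<union> X) (Q \<inter> B j)" using X(4) that by auto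
        moreover have "S \<union> X \<subseteq> S \<union> Y" using Y(3) by auto
        ultimately show ?thesis by (rule adapted_mono[OF QB])
      qed (use Y(5) in simp)
      then show ?case using Y by (intro exI[of _ Y]) auto
    qed
  qed
  note steps = this
  \<comment> \<open>From N on the second filtration is constant, so finitely many steps
    suffice.\<close>
  obtain N where N: "\<And>i. i \<ge> N \<Longrightarrow> B i = (\<Union>i. B i)"
    using filtration_stable[OF B] by blast
  from steps[of N] obtain X where X: "X \<subseteq> Q" "vec.independent (S \<union> X)"
    "\<And>j. j \<le> N \<Longrightarrow> adapted (S \<union> X) (Q \<inter> B j)" by blast
  have "adapted (S \<union> X) (Q \<inter> B j)" for j
  proof (cases "j \<le> N")
    case False
    then have "B j = B N" using N[of j] N[of N] by auto
    then show ?thesis using X(3)[of N] by simp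
  qed (rule X(3))
  then show thesis using that[of "S \<union> X"] X(1,2) assms(3,7) by auto
qed

text \<open>A common adapted basis of two filtrations always exists, as in the Bruhat decomposition;
  three distinct lines in a plane show that three filtrations need not have one.\<close>

lemma adapted_basis_exists:
  fixes A B :: "nat \<Rightarrow> (complex ^ 'n::finite) set"
  assumes A: "filtration A" and B: "filtration B"
  obtains S where "vec.independent S" "\<And>i j. adapted S (A i \<inter> B j)"
proof -
  have AB: "vec.subspace (A i \<inter> B j)" for i j
    using filtrationD(1)[OF A] filtrationD(1)[OF B] by (rule vec.subspace_inter)
  have "\<exists>S. S \<subseteq> A I \<and> vec.independent S \<and> (\<forall>i\<le>I. \<forall>j. adapted S (A i \<inter> B j))" for I
  proof (induction I)
    case 0
    \<comment> \<open>The zero space with the empty set serves as the step preceding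
      \<open>A 0\<close>.\<close>
    have "adapted {} ({0} \<inter> B j)" for j
      using filtrationD(4)[OF B, of j] by (auto simp: adapted_def)
    then obtain T where "T \<subseteq> A 0" "vec.independent T" "\<And>j. adapted T (A 0 \<inter> B j)"
      using adapted_basis_step[OF _ filtrationD(1)[OF A, of 0] _ B, of "{0}" "{}"] filtrationD(4)[OF A, of 0]
      by (auto simp: vec.subspace_single_0 vec.independent_empty)
    then show ?case by (intro exI[of _ T]) auto
  next
    case (Suc I)
    then obtain S where S: "S \<subseteq> A I" "vec.independent S"
      "\<And>i j. i \<le> I \<Longrightarrow> adapted S (A i \<inter> B j)" by blast
    obtain T where T: "S \<subseteq> T" "T \<subseteq> A (Suc I)" "vec.independent T"
      "\<And>j. adapted T (A (Suc I) \<inter> B j)"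
      using adapted_basis_step[OF filtrationD(1)[OF A, of I] filtrationD(1)[OF A, of "Suc I"]
          filtrationD(2)[OF A, of I "Suc I"] B S(2) S(3) S(1)] by auto
    have "adapted T (A i \<inter> B j)" if "i \<le> Suc I" for i j
    proof (cases "i = Suc I")
      case False
      then have "adapted S (A i \<inter> B j)" using S(3) that by auto
      from this T(1) show ?thesis by (rule adapted_mono[OF AB])
    qed (use T(4) in simp)
    then show ?case using T by (intro exI[of _ T]) auto
  qed
  note steps = this
  obtain N where N: "\<And>i. i \<ge> N \<Longrightarrow> A i = (\<Union>i. A i)"
    using filtration_stable[OF A] by blast
  from steps[of N] obtain S where S: "vec.independent S"
    "\<And>i j. i \<le> N \<Longrightarrow> adapted S (A i \<inter> B j)" by blast
  have "adapted S (A i \<inter> B j)" for i j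
  proof (cases "i \<le> N")
    case False
    then have "A i = A N" using N[of i] N[of N] by auto
    then show ?thesis using S(2)[of N] by simp
  qed (rule S(2))
  with S(1) show thesis by (rule that)
qed

section \<open>Rank and Hilbert polynomial of a graded sheaf\<close>

text \<open>In degree i + k exactly the k-th coefficients of the \<open>c v\<close> appear, so a
  relation over the polynomials splits into relations over the complex numbers.\<close>

lemma cvec_independent_monom_vec:
  fixes S :: "(complex ^ 'n) set"
  assumes "vec.independent S" "finite S"
  shows "cvec.independent (monom_vec i ` S)"
proof -
  have inj: "inj_on (monom_vec i) S"
    by (rule inj_on_inverseI[of _ "coeff_vec i"]) simp
  have "c v = 0" if "(\<Sum>v\<in>S. c v *s monom_vec i v) = 0" "v \<in> S" for c v
  proof (rule poly_eqI)
    fix k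
    have "coeff_vec (i + k) (c v *s monom_vec i v) = coeff (c v) k *s v" for v
    proof -
      have "(\<Sum>j\<le>i + k. coeff (c v) j *s (if i + k - j = i then v else 0)) =
          (\<Sum>j\<le>i + k. if j = k then coeff (c v) k *s v else 0)"
        by (intro sum.cong) auto
      then show ?thesis by (simp add: coeff_vec_smult)
    qed
    then have "(\<Sum>v\<in>S. coeff (c v) k *s v) = coeff_vec (i + k) (\<Sum>v\<in>S. c v *s monom_vec i v)"
      by (simp add: coeff_vec_sum)
    also have "\<dots> = 0" using that(1) by simp
    finally show "coeff (c v) k = coeff 0 k"
      using vec.independentD[OF assms subset_refl] that(2) by simp
  qed
  then show ?thesis by (simp add: cvec.independent_image_iff[OF assms(2) inj])
qed

lemma common_denominator:
  fixes c :: "'b \<Rightarrow> 'a::idom fract"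
  assumes "finite I"
  obtains q p where "q \<noteq> 0" "\<And>i. i \<in> I \<Longrightarrow> to_fract q * c i = to_fract (p i)"
proof -
  have "\<exists>q p. q \<noteq> 0 \<and> (\<forall>i\<in>I. to_fract q * c i = to_fract (p i))"
    using assms
  proof (induction I)
    case empty
    show ?case by (rule exI[of _ 1]) simp
  next
    case (insert i I)
    then obtain q p where qp: "q \<noteq> 0" "\<And>i. i \<in> I \<Longrightarrow> to_fract q * c i = to_fract (p i)" by blast
    obtain a b where ab: "c i = Fract a b" "b \<noteq> 0" by (cases "c i")
    have "to_fract b * c i = to_fract a"
      using ab by (simp add: to_fract_def eq_fract)
    then have "to_fract (q * b) * c j = to_fract (if j = i then q * a else b * p j)" if "j \<in> insert i I" for j
      using that insert.hyps qp(2)[of j] by (auto simp: mult.assoc mult.left_commute[of "to_fract q"])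
    then show ?case using qp(1) ab(2) 
      by (intro exI[of _ "q * b"] exI[of _ "\<lambda>j. if j = i then q * a else b * p j"]) auto
  qed
  then show thesis using that by blast
qed

text \<open>Over the fraction field this is the bound for vector spaces. Independence survives the
  passage, since a common denominator turns a relation with fractions into one over the
  ring.\<close>

lemma cvec_independent_card_le:
  fixes S :: "('a::idom ^ 'n::finite) set"
  assumes S: "finite S" and B: "finite B" "B \<subseteq> cvec.span S" "cvec.independent B"
  shows "card B \<le> card S"
proof -
  define h :: "'a ^ 'n \<Rightarrow> 'a fract ^ 'n" where "h = (\<lambda>x. \<chi> k. to_fract (x $ k))"
  have h_add: "h (x + y) = h x + h y" and h_scale: "h (c *s x) = to_fract c *s h x" and h0: "h 0 = 0" for x y c
    by (simp_all add: h_def vec_eq_iff)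
  have h_sum: "h (\<Sum>i\<in>I. f i) = (\<Sum>i\<in>I. h (f i))" for f and I :: "('a ^ 'n) set"
    by (induction I rule: infinite_finite_induct) (simp_all add: h_add h0)
  have inj: "inj h" by (auto intro!: injI simp: h_def vec_eq_iff)
  have "vec.independent (h ` B)"
  proof -
    have "c x = 0" if sum: "(\<Sum>x\<in>B. c x *s h x) = 0" and "x \<in> B" for c x
    proof -
      obtain q p where qp: "q \<noteq> 0" "\<And>x. x \<in> B \<Longrightarrow> to_fract q * c x = to_fract (p x)"
        using common_denominator[OF B(1), of c] by blast
      have "h (\<Sum>x\<in>B. p x *s x) = to_fract q *s (\<Sum>x\<in>B. c x *s h x)"
        by (simp add: h_sum h_scale vec.scale_sum_right vector_smult_assoc qp(2))
      then have "h (\<Sum>x\<in>B. p x *s x) = h 0" using sum by (simp add: h0)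
      then have "(\<Sum>x\<in>B. p x *s x) = 0" by (rule injD[OF inj])
      then have "p x = 0" using cvec.independentD[OF B(3,1) subset_refl] \<open>x \<in> B\<close> by blast
      then show ?thesis using qp(2)[OF \<open>x \<in> B\<close>] qp(1) by simp
    qed
    then show ?thesis
      by (subst vec.independent_image_iff[OF B(1) inj_on_subset[OF inj subset_UNIV]]) blast
  qed
  moreover have "h ` B \<subseteq> vec.span (h ` S)"
  proof -
    have "h x \<in> vec.span (h ` S)" if "x \<in> cvec.span S" for x
      using that
      by (induction rule: cvec.span_induct_alt)
         (auto simp: h0 h_add h_scale intro: vec.span_zero vec.span_add vec.span_scale vec.span_base)
    then show ?thesis using B(2) by blast
  qed
  ultimately have "card (h ` B) \<le> card (h ` S)"
    using vec.independent_span_bound[of "h ` S" "h ` B"] S by simp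
  then show ?thesis
    using card_image[of h B] card_image[of h S] inj_on_subset[OF inj subset_UNIV] by metis
qed

lemma graded_subset_span:
  assumes "\<And>i. A i \<subseteq> vec.span S"
  shows "graded A \<subseteq> cvec.span (monom_vec 0 ` S)"
proof
  fix s assume s: "s \<in> graded A"
  have *: "monom_vec i v \<in> cvec.span (monom_vec 0 ` S)" if "v \<in> vec.span S" for i v
    using that
  proof (induction rule: vec.span_induct_alt)
    case (step c x y)
    have "monom_vec i x = monom 1 i *s monom_vec 0 x" by (simp add: monom_smult_monom_vec)
    then show ?case
      using step by (auto simp: monom_vec_add monom_vec_scale intro!: cvec.span_add cvec.span_scale intro: cvec.span_base)
  qed (simp add: cvec.span_zero)
  obtain N where "\<And>i. i \<ge> N \<Longrightarrow> coeff_vec i s = 0"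
    using coeff_vec_eventually_0 by blast
  then have "s = (\<Sum>i<N. monom_vec i (coeff_vec i s))"
    by (rule monom_vec_decomposition)
  moreover have "\<dots> \<in> cvec.span (monom_vec 0 ` S)"
    using s assms by (intro cvec.span_sum *) (auto simp: graded_def)
  ultimately show "s \<in> cvec.span (monom_vec 0 ` S)" by simp
qed

text \<open>For the upper bound, all sections lie in the free module on a basis of the union. For
  the lower bound, that basis multiplied by z^N lies in the sheaf as soon as \<open>A N\<close> is
  the union.\<close>

lemma sheaf_rank_graded:
  assumes A: "filtration A"
  shows "sheaf_rank (graded A, X) = vec.dim (\<Union>i. A i)"
proof -
  obtain S where S: "S \<subseteq> (\<Union>i. A i)" "vec.independent S" "(\<Union>i. A i) \<subseteq> vec.span S" "card S = vec.dim (\<Union>i. A i)"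
    using vec.basis_exists by blast
  have fin: "finite S" using S(2) vec.finiteI_independent by blast
  obtain N where N: "A N = (\<Union>i. A i)" by (metis filtration_stable[OF A] order_refl)
  show ?thesis
    unfolding sheaf_rank_def fst_conv
  proof (rule Max_eqI)
    have le: "card B \<le> vec.dim (\<Union>i. A i)" if "finite B" "B \<subseteq> graded A" "cvec.independent B" for B
    proof -
      have "graded A \<subseteq> cvec.span (monom_vec 0 ` S)" using S(3) by (intro graded_subset_span) auto
      then have "card B \<le> card (monom_vec 0 ` S)"
        using that fin by (intro cvec_independent_card_le) auto
      then show ?thesis using S(4) card_image_le[OF fin, of "monom_vec 0"] by linarith
    qed
    show "finite {card B |B. finite B \<and> B \<subseteq> graded A \<and> cvec.independent B}"
      by (rule finite_subset[of _ "{..vec.dim (\<Union>i. A i)}"]) (use le in auto)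
    show "y \<le> vec.dim (\<Union>i. A i)" if "y \<in> {card B |B. finite B \<and> B \<subseteq> graded A \<and> cvec.independent B}" for y
      using that le by auto
    have "card (monom_vec N ` S) = card S"
      by (rule card_image, rule inj_on_inverseI[of _ "coeff_vec N"]) simp
    moreover have "monom_vec N ` S \<subseteq> graded A"
      using S(1) N by (auto simp: monom_vec_in_graded[OF A])
    ultimately show "vec.dim (\<Union>i. A i) \<in> {card B |B. finite B \<and> B \<subseteq> graded A \<and> cvec.independent B}"
      using cvec_independent_monom_vec[OF S(2) fin, of N] fin S(4) by (intro CollectI exI[of _ "monom_vec N ` S"]) auto
  qed
qed

text \<open>For subspaces \<open>C w\<close> this is the direct sum of the z0^w z1^(m-w)
  \<open>C w\<close> over w \<le> m, the splitting of sections into weights of the circle.\<close>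

definition hom_part :: "nat \<Rightarrow> (nat \<Rightarrow> (complex ^ 'n::finite) set) \<Rightarrow> (hpoly ^ 'n) set" where
  "hom_part m C = {s. homogeneous_vec m s \<and> (\<forall>i\<le>m. bicoeff i (m - i) s \<in> C i)}"

lemma homogeneous_vec_decomposition:
  assumes "homogeneous_vec m s"
  shows "s = (\<Sum>w\<le>m. bimonom w (m - w) (bicoeff w (m - w) s))"
proof (rule bicoeff_eqI)
  fix a b
  have "bicoeff a b (\<Sum>w\<le>m. bimonom w (m - w) (bicoeff w (m - w) s)) =
      (\<Sum>w\<le>m. if w = a then if b = m - a then bicoeff a (m - a) s else 0 else 0)"
    unfolding bicoeff_sum by (rule sum.cong) auto
  also have "\<dots> = (if a \<le> m \<and> b = m - a then bicoeff a (m - a) s else 0)" by auto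
  also have "\<dots> = bicoeff a b s"
  proof -
    have "bicoeff a b s \<noteq> 0 \<Longrightarrow> a + b = m" using assms by (simp add: homogeneous_vec_iff)
    then show ?thesis by (cases "bicoeff a b s = 0") auto
  qed
  finally show "bicoeff a b s = bicoeff a b (\<Sum>w\<le>m. bimonom w (m - w) (bicoeff w (m - w) s))" ..
qed

lemma bimonom_0 [simp]: "bimonom i j 0 = 0"
  by (simp add: bimonom_def)

lemma basis_family_hom_part:
  fixes N :: "nat \<Rightarrow> nat"
  assumes \<beta>: "\<And>w. w \<le> m \<Longrightarrow> basis_family (*s) {..<N w} (\<beta> w) (C w)"
  shows "basis_family cscale (SIGMA w:{..m}. {..<N w}) (\<lambda>(w, s). bimonom w (m - w) (\<beta> w s)) (hom_part m C)"
proof (rule basis_familyI[OF vector_space_cscale])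
  let ?I = "SIGMA w:{..m}. {..<N w}" and ?g = "\<lambda>(w, s). bimonom w (m - w) (\<beta> w s)"
  note \<beta>D = basis_familyD[OF vec.vector_space_axioms finite_lessThan \<beta>]
  show "finite ?I" by simp
  show "c i = 0" if 0: "(\<Sum>i\<in>?I. cscale (c i) (?g i)) = 0" and i: "i \<in> ?I" for c i
  proof -
    obtain w s where ws: "i = (w, s)" "w \<le> m" "s < N w" using i by auto
    \<comment> \<open>This coefficient map kills all weights other than w.\<close>
    have "0 = bicoeff w (m - w) (\<Sum>(v, s)\<in>?I. cscale (c (v, s)) (?g (v, s)))"
      using 0 by (simp add: case_prod_unfold)
    also have "\<dots> = (\<Sum>v\<le>m. \<Sum>s<N v. bicoeff w (m - w) (cscale (c (v, s)) (?g (v, s))))"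
      by (subst sum.Sigma[symmetric]) (simp_all add: bicoeff_sum)
    also have "\<dots> = (\<Sum>v\<le>m. if v = w then \<Sum>s<N w. c (w, s) *s \<beta> w s else 0)"
      by (intro sum.cong) (auto simp: bicoeff_cscale)
    also have "\<dots> = (\<Sum>s<N w. c (w, s) *s \<beta> w s)" using ws(2) by simp
    finally show ?thesis using \<beta>D(4)[OF ws(2), of "\<lambda>s. c (w, s)" s] ws by simp
  qed
  have subC: "vec.subspace (C w)" if "w \<le> m" for w
    using \<beta>D(2)[OF that] vec.subspace_span by metis
  have "hvec.subspace (hom_part m C)"
  proof (rule hvec.subspaceI)
    show "0 \<in> hom_part m C"
      using subC by (auto simp: hom_part_def homogeneous_vec_iff vec.subspace_0)
    show "x + y \<in> hom_part m C" if "x \<in> hom_part m C" "y \<in> hom_part m C" for x y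
      using that subC by (auto simp: hom_part_def homogeneous_vec_iff bicoeff_add intro!: vec.subspace_add) (metis add_0)
    show "cscale c x \<in> hom_part m C" if "x \<in> hom_part m C" for c x
      using that subC by (auto simp: hom_part_def homogeneous_vec_iff bicoeff_cscale intro!: vec.subspace_scale)
  qed
  moreover have "?g i \<in> hom_part m C" if "i \<in> ?I" for i
    using that \<beta>D(5) vec.subspace_0[OF subC]
    by (auto simp: hom_part_def homogeneous_vec_iff split: if_splits)
  ultimately have "hvec.span (?g ` ?I) \<subseteq> hom_part m C"
    by (intro hvec.span_minimal) auto
  moreover have "hom_part m C \<subseteq> hvec.span (?g ` ?I)"
  proof
    fix s assume s: "s \<in> hom_part m C"
    have *: "bimonom w (m - w) v \<in> hvec.span (?g ` ?I)" if "v \<in> vec.span (\<beta> w ` {..<N w})" "w \<le> m" for v w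
      using that(1)
    proof (induction rule: vec.span_induct_alt)
      case (step c x y)
      then obtain s where "x = \<beta> w s" "s < N w" by auto
      then have "bimonom w (m - w) x \<in> ?g ` ?I" using that(2) by (intro image_eqI[of _ _ "(w, s)"]) auto
      then show ?case
        unfolding bimonom_add bimonom_scale by (intro hvec.span_add hvec.span_scale hvec.span_base step.IH)
    qed (simp add: hvec.span_zero)
    have "s = (\<Sum>w\<le>m. bimonom w (m - w) (bicoeff w (m - w) s))"
      using s by (intro homogeneous_vec_decomposition) (simp add: hom_part_def)
    also have "\<dots> \<in> hvec.span (?g ` ?I)"
      using s \<beta>D(2) by (intro hvec.span_sum *) (auto simp: hom_part_def)
    finally show "s \<in> hvec.span (?g ` ?I)" .
  qed
  ultimately show "hvec.span (?g ` ?I) = hom_part m C" by (rule subset_antisym)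
qed

lemma dim_hom_part:
  assumes "\<And>w. w \<le> m \<Longrightarrow> vec.subspace (C w)"
  shows "hvec.dim (hom_part m C) = (\<Sum>w\<le>m. vec.dim (C w))"
proof -
  have "\<exists>f. basis_family (*s) {..<vec.dim (C w)} f (C w)" if "w \<le> m" for w
    using basis_family_exists[OF assms[OF that]] by blast
  then obtain \<beta> where "\<And>w. w \<le> m \<Longrightarrow> basis_family (*s) {..<vec.dim (C w)} (\<beta> w) (C w)"
    by metis
  from basis_familyD(3)[OF vector_space_cscale _ basis_family_hom_part[OF this]]
  show ?thesis by simp
qed

lemma sections_graded_eq_hom_part:
  assumes "filtration A" "filtration B"
  shows "sections m (graded A, graded B) = hom_part m (\<lambda>i. A i \<inter> B (m - i))"
  unfolding sections_graded[OF assms] hom_part_def ..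

lemma h0_graded:
  assumes "filtration A" "filtration B"
  shows "h0 m (graded A, graded B) = (\<Sum>i\<le>m. vec.dim (A i \<inter> B (m - i)))"
  unfolding h0_def sections_graded_eq_hom_part[OF assms]
  by (rule dim_hom_part) (intro vec.subspace_inter filtrationD(1) assms)

lemma h0_UNIV: "h0 m (UNIV, UNIV :: (complex poly ^ 'n::finite) set) = (m + 1) * CARD('n)"
proof -
  have "filtration (\<lambda>_. UNIV :: (complex ^ 'n) set)" by (simp add: filtration_const)
  moreover have "graded (\<lambda>_. UNIV) = (UNIV :: (complex poly ^ 'n) set)" by (simp add: graded_def)
  ultimately show ?thesis
    using h0_graded[of "\<lambda>_. UNIV :: (complex ^ 'n) set" "\<lambda>_. UNIV" m]
    by (simp add: vec.dimension_def card_cart_basis)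
qed

text \<open>Double counting of the pairs (i, k) with \<alpha> k \<le> i \<le> m: each k contributes
  m + 1 - \<alpha> k.\<close>

lemma sum_card_le:
  fixes \<alpha> :: "'r::finite \<Rightarrow> nat"
  assumes "\<And>k. \<alpha> k \<le> m"
  shows "(\<Sum>i\<le>m. card {k. \<alpha> k \<le> i}) + sum \<alpha> UNIV = (m + 1) * CARD('r)"
proof -
  have "(\<Sum>i\<le>m. card {k. \<alpha> k \<le> i}) = (\<Sum>i\<le>m. \<Sum>k\<in>UNIV. if \<alpha> k \<le> i then 1 else 0)"
    by (simp add: sum.If_cases)
  also have "\<dots> = (\<Sum>k\<in>UNIV. \<Sum>i\<le>m. if \<alpha> k \<le> i then 1 else 0)" by (rule sum.swap)
  also have "\<dots> = (\<Sum>k\<in>UNIV. m + 1 - \<alpha> k)"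
  proof (rule sum.cong)
    fix k
    have "{..m} \<inter> {i. \<alpha> k \<le> i} = {\<alpha> k..m}" by auto
    then show "(\<Sum>i\<le>m. if \<alpha> k \<le> i then 1 else 0) = m + 1 - \<alpha> k" by (simp add: sum.If_cases)
  qed simp
  finally have "(\<Sum>i\<le>m. card {k. \<alpha> k \<le> i}) + sum \<alpha> UNIV = (\<Sum>k\<in>UNIV. (m + 1 - \<alpha> k) + \<alpha> k)"
    by (simp add: sum.distrib)
  also have "\<dots> = (\<Sum>k\<in>(UNIV :: 'r set). m + 1)"
    using assms by (intro sum.cong) (auto simp: le_SucI)
  finally show ?thesis by simp
qed

text \<open>Once m is at least every \<alpha> k, h0 equals (m+1) r minus the sum of \<alpha>. The
  quotient thus has (n-r)(m+1) plus that sum, to be compared with (n-r)(m+1) + d.\<close>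

lemma quotient_hilbert_poly_graded:
  fixes A :: "nat \<Rightarrow> (complex ^ 'n::finite) set" and \<alpha> :: "'r::finite \<Rightarrow> nat"
  assumes A: "filtration A" and dim: "\<And>i. vec.dim (A i) = card {k. \<alpha> k \<le> i}"
  shows "quotient_hilbert_poly (graded A, graded (\<lambda>_. \<Union>i. A i)) (quot_poly CARD('n) CARD('r) d) \<longleftrightarrow> sum \<alpha> UNIV = d"
proof -
  have W: "filtration (\<lambda>_. \<Union>i. A i)"
    by (rule filtration_const, rule subspace_UN_filtration, rule A)
  have "h0 m (graded A, graded (\<lambda>_. \<Union>i. A i)) = (\<Sum>i\<le>m. card {k. \<alpha> k \<le> i})" for m
  proof -
    have "A i \<inter> (\<Union>i. A i) = A i" for i by blast
    then show ?thesis by (simp add: h0_graded[OF A W] dim)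
  qed
  then have eq: "int (h0 m (UNIV, UNIV :: (complex poly ^ 'n) set)) - int (h0 m (graded A, graded (\<lambda>_. \<Union>i. A i)))
        = poly (quot_poly CARD('n) CARD('r) d) (int m) \<longleftrightarrow> sum \<alpha> UNIV = d"
    if "Max (range \<alpha>) \<le> m" for m
  proof -
    have "\<alpha> k \<le> m" for k using that by (auto intro: order_trans[rotated])
    then have "int (\<Sum>i\<le>m. card {k. \<alpha> k \<le> i}) + int (sum \<alpha> UNIV) = (int m + 1) * int CARD('r)"
      using arg_cong[OF sum_card_le[of \<alpha> m], of int] by (simp add: algebra_simps)
    then show ?thesis
      unfolding h0_UNIV \<open>\<And>m. h0 m (graded A, graded (\<lambda>_. \<Union>i. A i)) = _\<close>
      by (auto simp: quot_poly_def algebra_simps simp flip: of_nat_sum of_nat_mult of_nat_add)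
  qed
  show ?thesis
  proof
    assume "quotient_hilbert_poly (graded A, graded (\<lambda>_. \<Union>i. A i)) (quot_poly CARD('n) CARD('r) d)"
    then obtain M where "\<And>m. m \<ge> M \<Longrightarrow>
        int (h0 m (UNIV, UNIV :: (complex poly ^ 'n) set)) - int (h0 m (graded A, graded (\<lambda>_. \<Union>i. A i)))
        = poly (quot_poly CARD('n) CARD('r) d) (int m)"
      unfolding quotient_hilbert_poly_def eventually_sequentially by blast
    then show "sum \<alpha> UNIV = d" using eq[of "max M (Max (range \<alpha>))"] by simp
  next
    assume "sum \<alpha> UNIV = d"
    then show "quotient_hilbert_poly (graded A, graded (\<lambda>_. \<Union>i. A i)) (quot_poly CARD('n) CARD('r) d)"
      unfolding quotient_hilbert_poly_def eventually_sequentially using eq by blast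
  qed
qed

section \<open>Enumerating finite linear orders\<close>

text \<open>The order isomorphism onto \<open>{..<CARD('r)}\<close>, counting from 0.\<close>

definition position :: "'r::{finite,linorder} \<Rightarrow> nat" where
  "position k = card {x. x < k}"

lemma position_less_iff:
  fixes k l :: "'r::{finite,linorder}"
  shows "position k < position l \<longleftrightarrow> k < l"
proof -
  have "position k < position l" if "k < l" for k l :: 'r
    unfolding position_def using that by (intro psubset_card_mono) auto
  then show ?thesis by (metis not_less_iff_gr_or_eq)
qed

lemma position_bij: "bij_betw position (UNIV :: 'r::{finite,linorder} set) {..<CARD('r)}"
proof -
  have inj: "inj (position :: 'r \<Rightarrow> nat)"
    by (rule injI) (metis less_irrefl neqE position_less_iff)
  have "position ` (UNIV :: 'r set) \<subseteq> {..<CARD('r)}"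
    unfolding position_def by (auto intro!: psubset_card_mono)
  moreover have "card (position ` (UNIV :: 'r set)) = card {..<CARD('r)}"
    using inj by (simp add: card_image)
  ultimately have "position ` (UNIV :: 'r set) = {..<CARD('r)}"
    by (intro card_subset_eq) auto
  with inj show ?thesis by (simp add: bij_betw_def)
qed

lemma card_position_less:
  assumes "N \<le> CARD('r::{finite,linorder})"
  shows "card {k :: 'r. position k < N} = N"
proof -
  have "bij_betw position {k :: 'r. position k < N} {..<N}"
    unfolding bij_betw_def
  proof
    show "inj_on position {k :: 'r. position k < N}"
      using position_bij by (metis bij_betw_def inj_on_subset subset_UNIV)
    show "position ` {k :: 'r. position k < N} = {..<N}"
    proof (intro set_eqI iffI)
      fix x assume "x \<in> {..<N}"
      then have "x \<in> position ` (UNIV :: 'r set)"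
        using position_bij[where 'r = 'r] assms by (auto simp: bij_betw_def)
      then show "x \<in> position ` {k :: 'r. position k < N}" using \<open>x \<in> {..<N}\<close> by auto
    qed auto
  qed
  then show ?thesis by (simp add: bij_betw_same_card)
qed

lemma strict_mono_enumeration:
  fixes I :: "'n::linorder set"
  assumes "finite I" "card I = CARD('r::{finite,linorder})"
  obtains f :: "'r::{finite,linorder} \<Rightarrow> 'n" where "strict_mono f" "range f = I"
proof
  let ?xs = "sorted_list_of_set I"
  have len: "length ?xs = CARD('r)" using assms by simp
  have pos: "position k < length ?xs" for k :: 'r
    using position_bij[where 'r = 'r] len by (auto simp: bij_betw_def)
  show "strict_mono (\<lambda>k :: 'r. ?xs ! position k)"
    using sorted_wrt_nth_less[OF strict_sorted_list_of_set, of _ _ I] pos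
    by (intro strict_monoI) (simp add: position_less_iff)
  have "range (\<lambda>k :: 'r. ?xs ! position k) = (!) ?xs ` position ` (UNIV :: 'r set)" by auto
  also have "\<dots> = (!) ?xs ` {..<length ?xs}" using position_bij[where 'r = 'r] len by (simp add: bij_betw_def)
  also have "\<dots> = set ?xs" by (force simp: in_set_conv_nth simp del: set_sorted_list_of_set)
  also have "\<dots> = I" using assms(1) by simp
  finally show "range (\<lambda>k :: 'r. ?xs ! position k) = I" .
qed

section \<open>Homogeneous bases and minors\<close>

lemma subspace_bigraded:
  assumes "filtration A" "filtration B"
  shows "hvec.subspace {s. \<forall>i j. bicoeff i j s \<in> A i \<inter> B j}"
proof (rule hvec.subspaceI, goal_cases)
  case 1
  show ?case using assms by (simp add: filtrationD(4))
next
  case (2 x y)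
  then show ?case using assms by (auto simp: bicoeff_add intro: vec.subspace_add filtrationD(1))
next
  case (3 c x)
  then show ?case using assms by (auto simp: bicoeff_cscale intro: vec.subspace_scale filtrationD(1))
qed

text \<open>The twist is recovered as the total degree i + j, so summing over all twists leaves a
  description by bidegrees alone.\<close>

lemma graded_module_graded:
  assumes "filtration A" "filtration B"
  shows "graded_module (graded A, graded B) = {s. \<forall>i j. bicoeff i j s \<in> A i \<inter> B j}" (is "_ = ?M")
proof
  show "graded_module (graded A, graded B) \<subseteq> ?M"
    unfolding graded_module_def
  proof (rule hvec.span_minimal[OF _ subspace_bigraded[OF assms]], safe)
    fix m s i j
    assume s: "s \<in> sections m (graded A, graded B)"
    have "bicoeff i j s \<in> A i \<inter> B j"
    proof (cases "i + j = m")
      case True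
      then have "j = m - i" "i \<le> m" by auto
      then show ?thesis using s by (auto simp: sections_graded[OF assms])
    next
      case False
      then have "bicoeff i j s = 0" using s by (auto simp: sections_graded[OF assms] homogeneous_vec_iff)
      then show ?thesis using assms by (simp add: filtrationD(4))
    qed
    then show "bicoeff i j s \<in> A i" "bicoeff i j s \<in> B j" by auto
  qed
  show "?M \<subseteq> graded_module (graded A, graded B)"
  proof
    fix s assume s: "s \<in> ?M"
    obtain N where "\<And>i j. i \<ge> N \<or> j \<ge> N \<Longrightarrow> bicoeff i j s = 0"
      using bicoeff_eventually_0 by blast
    then have "s = (\<Sum>i<N. \<Sum>j<N. bimonom i j (bicoeff i j s))"
      by (rule bimonom_decomposition)
    also have "\<dots> \<in> graded_module (graded A, graded B)"
      unfolding graded_module_def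
    proof (intro hvec.span_sum hvec.span_base UN_I UNIV_I)
      fix i j
      show "bimonom i j (bicoeff i j s) \<in> sections (i + j) (graded A, graded B)"
        using s assms by (auto simp: sections_graded[OF assms] homogeneous_vec_bimonom filtrationD(4))
    qed
    finally show "s \<in> graded_module (graded A, graded B)" .
  qed
qed

lemma monom_smult_bimonom: "monom (monom 1 j) i *s bimonom a b v = bimonom (i + a) (j + b) v"
  by (simp add: bimonom_def monom_vec_def vec_eq_iff mult_monom)

text \<open>Monomials raise both indices, and both filtrations increase.\<close>

lemma subspace_bigraded_ring:
  assumes "filtration A" "filtration B"
  shows "cvec.subspace {s. \<forall>i j. bicoeff i j s \<in> A i \<inter> B j}"
proof (rule cvec.subspaceI, goal_cases)
  case 1
  show ?case using assms by (simp add: filtrationD(4))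
next
  case (2 x y)
  then show ?case using assms by (auto simp: bicoeff_add intro: vec.subspace_add filtrationD(1))
next
  case (3 p s)
  have sub: "vec.subspace (A i \<inter> B j)" for i j
    by (intro vec.subspace_inter filtrationD(1) assms)
  have "bicoeff i j (p *s s) \<in> A i \<inter> B j" for i j
    unfolding bicoeff_def coeff_vec_smult coeff_vec_sum
  proof (intro vec.subspace_sum[OF sub] vec.subspace_scale[OF sub])
    fix a b assume "a \<in> {..i}" "b \<in> {..j}"
    have "bicoeff (i - a) (j - b) s \<in> A (i - a) \<inter> B (j - b)" using 3 by auto
    then show "coeff_vec (j - b) (coeff_vec (i - a) s) \<in> A i \<inter> B j"
      using filtrationD(2)[OF assms(1), of "i - a" i] filtrationD(2)[OF assms(2), of "j - b" j]
      by (auto simp: bicoeff_def)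
  qed
  then show ?case by simp
qed

text \<open>The columns z0^(a k) z1^(b k) u k exhibit the splitting of the sheaf into the line
  bundles O(-(a k + b k)).\<close>

lemma homogeneous_basis_matrix_adapted:
  fixes u :: "'r::finite \<Rightarrow> complex ^ 'n::finite"
  assumes A: "filtration A" and B: "filtration B" and u: "inj u" "vec.independent (range u)"
    and AB: "\<And>i j. A i \<inter> B j = vec.span (u ` {k. a k \<le> i \<and> b k \<le> j})"
  shows "homogeneous_basis_matrix (graded A, graded B) (\<chi> i k. bimonom (a k) (b k) (u k) $ i)"
proof -
  let ?M = "\<chi> i k. bimonom (a k) (b k) (u k) $ i"
  have col: "column k ?M = bimonom (a k) (b k) (u k)" for k
    by (simp add: column_def vec_eq_iff)
  have u0: "u k \<noteq> 0" for k using u(2) vec.dependent_zero by (metis rangeI)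
  have inj: "inj (\<lambda>k. column k ?M)"
  proof (rule injI)
    fix k l assume "column k ?M = column l ?M"
    then have "bicoeff (a k) (b k) (bimonom (a k) (b k) (u k)) = bicoeff (a k) (b k) (bimonom (a l) (b l) (u l))"
      by (simp add: col)
    then have "u k = u l" using u0[of k] by (auto split: if_splits)
    then show "k = l" using u(1) by (simp add: inj_eq)
  qed
  have "c k = 0" if sum: "(\<Sum>k\<in>UNIV. c k *s column k ?M) = 0" for c k
  proof -
    \<comment> \<open>With the monomials moved into the coefficients, every column becomes a
      constant vector, and the independence of \<open>u\<close> applies to each bidegree
      separately.\<close>
    define q where "q k = c k * monom (monom 1 (b k)) (a k)" for k
    have q: "c k *s column k ?M = q k *s bimonom 0 0 (u k)" for k
      unfolding col using monom_smult_bimonom[of "b k" "a k" 0 0 "u k"] by (simp add: q_def flip: vector_smult_assoc)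
    have bq: "bicoeff i j (q k *s bimonom 0 0 (u k)) = coeff (coeff (q k) i) j *s u k" for i j k
      by (simp add: bicoeff_def bimonom_def coeff_vec_def monom_vec_def vec_eq_iff monom_0 mult.commute)
    have "(\<Sum>k\<in>UNIV. coeff (coeff (q k) i) j *s u k) = bicoeff i j (\<Sum>k\<in>UNIV. c k *s column k ?M)" for i j
      by (simp add: bicoeff_sum q bq)
    then have "(\<Sum>k\<in>UNIV. coeff (coeff (q k) i) j *s u k) = 0" for i j by (simp add: sum)
    from vec.independent_image_iff[OF finite u(1), THEN iffD1, rule_format, OF u(2) this]
    have "coeff (coeff (q k) i) j = 0" for i j by simp
    then have "q k = 0" by (simp add: poly_eq_iff)
    then show ?thesis by (simp add: q_def)
  qed
  then have ind: "cvec.independent (range (\<lambda>k. column k ?M))"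
    by (simp add: cvec.independent_image_iff[OF finite inj])
  have "cvec.span (range (\<lambda>k. column k ?M)) = {s. \<forall>i j. bicoeff i j s \<in> A i \<inter> B j}" (is "?S = ?R")
  proof
    have mem: "u k \<in> A (a k) \<inter> B (b k)" for k
      unfolding AB by (rule vec.span_base) auto
    then have "range (\<lambda>k. column k ?M) \<subseteq> ?R"
      using A B by (auto simp: col filtrationD(4))
    then show "?S \<subseteq> ?R" by (rule cvec.span_minimal[OF _ subspace_bigraded_ring[OF A B]])
    show "?R \<subseteq> ?S"
    proof
      fix s assume s: "s \<in> ?R"
      have *: "bimonom i j v \<in> ?S" if "v \<in> vec.span (u ` {k. a k \<le> i \<and> b k \<le> j})" for i j v
        using that
      proof (induction rule: vec.span_induct_alt)
        case base
        show ?case by (simp add: cvec.span_zero)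
      next
        case (step c x y)
        then obtain k where k: "x = u k" "a k \<le> i" "b k \<le> j" by auto
        \<comment> \<open>As a k \<le> i and b k \<le> j, the truncated differences are true
          ones.\<close>
        have "bimonom i j x = monom (monom 1 (j - b k)) (i - a k) *s column k ?M"
          using k by (simp add: col monom_smult_bimonom)
        moreover have "\<dots> \<in> ?S" by (intro cvec.span_scale cvec.span_base rangeI)
        ultimately have "bimonom i j x \<in> ?S" by (simp only:)
        then have "cscale c (bimonom i j x) + bimonom i j y \<in> ?S"
          unfolding cscale_def by (intro cvec.span_add cvec.span_scale step.IH)
        then show ?case by (simp add: bimonom_add bimonom_scale)
      qed
      obtain N where "\<And>i j. i \<ge> N \<or> j \<ge> N \<Longrightarrow> bicoeff i j s = 0"
        using bicoeff_eventually_0 by blast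
      then have "s = (\<Sum>i<N. \<Sum>j<N. bimonom i j (bicoeff i j s))"
        by (rule bimonom_decomposition)
      also have "\<dots> \<in> ?S"
        using s unfolding AB by (intro cvec.span_sum *) auto
      finally show "s \<in> ?S" .
    qed
  qed
  moreover have "\<exists>m. homogeneous_vec m (column k ?M)" for k
    unfolding col using homogeneous_vec_bimonom by blast
  ultimately show ?thesis
    using inj ind by (simp add: homogeneous_basis_matrix_def graded_module_graded[OF A B])
qed

section \<open>Change of basis, and the minors of a homogeneous basis\<close>

lemma det_ring_hom:
  fixes A :: "'a::comm_ring_1 ^ 'r::finite ^ 'r" and h :: "'a \<Rightarrow> 'b::comm_ring_1"
  assumes "h 0 = 0" "h 1 = 1" and add: "\<And>x y. h (x + y) = h x + h y" and mult: "\<And>x y. h (x * y) = h x * h y"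
  shows "h (det A) = det (\<chi> i j. h (A $ i $ j))"
proof -
  have "h (- 1) = - 1" using add[of 1 "- 1"] assms(1,2) by (simp add: eq_neg_iff_add_eq_0 add.commute)
  then have "h (of_int (sign p)) = of_int (sign p)" for p :: "'r \<Rightarrow> 'r"
    using assms(2) by (auto simp: sign_def)
  moreover have "h (\<Sum>i\<in>I. f i) = (\<Sum>i\<in>I. h (f i))" for f and I :: "('r \<Rightarrow> 'r) set"
    by (induction I rule: infinite_finite_induct) (simp_all add: add assms(1))
  moreover have "h (\<Prod>i\<in>I. f i) = (\<Prod>i\<in>I. h (f i))" for f and I :: "'r set"
    by (induction I rule: infinite_finite_induct) (simp_all add: mult assms(2))
  ultimately show ?thesis by (simp add: det_def mult)
qed

lemma independent_columns_span:
  fixes A A' :: "'a::comm_ring_1 ^ 'r::finite ^ 'n::finite"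
  assumes "range (\<lambda>j. column j A) \<subseteq> cvec.span (range (\<lambda>j. column j A'))"
  obtains M where "A = A' ** M"
proof -
  have "\<exists>c. column j A = (\<Sum>k\<in>UNIV. c k *s column k A')" for j
    using assms cvec.span_image_iff[OF finite, of _ "\<lambda>j. column j A'" UNIV] by blast
  then obtain c where "\<And>j. column j A = (\<Sum>k\<in>UNIV. c j k *s column k A')" by metis
  then have "A $ i $ j = (\<Sum>k\<in>UNIV. c j k * A' $ i $ k)" for i j
    by (simp add: vec_eq_iff column_def)
  then have "A = A' ** (\<chi> k j. c j k)"
    by (simp add: matrix_matrix_mult_def vec_eq_iff mult.commute)
  then show thesis by (rule that)
qed

text \<open>Each family of columns is expressed through the other, so A' = A' M M'; independence of
  the columns of A' forces M M' = 1.\<close>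

lemma basis_change_unit_det:
  fixes A A' :: "'a::comm_ring_1 ^ 'r::finite ^ 'n::finite"
  assumes A': "inj (\<lambda>j. column j A')" "cvec.independent (range (\<lambda>j. column j A'))"
    and span: "cvec.span (range (\<lambda>j. column j A)) = cvec.span (range (\<lambda>j. column j A'))"
  obtains M where "A = A' ** M" "det M dvd 1"
proof -
  obtain M where M: "A = A' ** M"
    by (rule independent_columns_span[of A A'])
      (use span cvec.span_superset[of "range (\<lambda>j. column j A)"] in auto)
  obtain M' where M': "A' = A ** M'"
    by (rule independent_columns_span[of A' A])
      (use span cvec.span_superset[of "range (\<lambda>j. column j A')"] in auto)
  have "A' = A' ** (M ** M')" unfolding matrix_mul_assoc M[symmetric] by (rule M')
  from arg_cong[OF this, of "\<lambda>X. X $ i $ j" for i j]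
  have *: "A' $ i $ j = (\<Sum>k\<in>UNIV. A' $ i $ k * (M ** M') $ k $ j)" for i j
    unfolding matrix_matrix_mult_def[of A'] vec_lambda_beta .
  have "(M ** M') $ k $ j = (mat 1 :: 'a ^ 'r ^ 'r) $ k $ j" for k j
  proof -
    have "A' $ i $ j = (\<Sum>k\<in>UNIV. (if k = j then A' $ i $ k else 0))" for i by simp
    also have "\<dots> i = (\<Sum>k\<in>UNIV. A' $ i $ k * (mat 1 :: 'a ^ 'r ^ 'r) $ k $ j)" for i
      by (intro sum.cong) (auto simp: mat_def)
    finally have "(\<Sum>k\<in>UNIV. A' $ i $ k * ((M ** M') $ k $ j - (mat 1 :: 'a ^ 'r ^ 'r) $ k $ j)) = 0" for i
      using *[of i j] by (simp add: right_diff_distrib sum_subtractf)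
    then have "(\<Sum>k\<in>UNIV. ((M ** M') $ k $ j - (mat 1 :: 'a ^ 'r ^ 'r) $ k $ j) *s column k A') = 0"
      by (simp add: vec_eq_iff column_def mult.commute left_diff_distrib right_diff_distrib)
    from cvec.independent_image_iff[OF finite A'(1), THEN iffD1, rule_format, OF A'(2) this]
    show ?thesis by simp
  qed
  then have "M ** M' = mat 1" by (simp add: vec_eq_iff)
  then have "1 = det M * det M'" by (metis det_I det_mul)
  then have "det M dvd 1" by (rule dvdI)
  with M show thesis by (rule that)
qed

lemma hpoly_unit:
  assumes "(p :: hpoly) dvd 1"
  obtains c where "c \<noteq> 0" "p = [:[:c:]:]"
  using assms by (auto simp: is_unit_poly_iff dvd_field_iff)

lemma minors_mult:
  fixes A :: "hpoly ^ 'r::{finite,linorder} ^ 'n::{finite,linorder}" 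
    and M :: "hpoly ^ 'r::{finite,linorder} ^ 'r::{finite,linorder}"
  shows "minors (A ** M) f = minors A f * det M"
proof -
  have "(\<chi> i. (A ** M) $ f i) = (\<chi> i. A $ f i) ** M"
    by (simp add: matrix_matrix_mult_def vec_eq_iff)
  then show ?thesis by (simp add: minors_def det_mul)
qed

lemma proj_point_scale:
  assumes "c \<noteq> 0" "\<And>f. T' f = [:[:c:]:] * T f"
  shows "proj_point T' = proj_point T"
proof -
  have "\<exists>b. (\<lambda>f. [:[:a:]:] * T' f) = (\<lambda>f. [:[:b:]:] * T f) \<and> b \<noteq> 0" if "a \<noteq> 0" for a
    using assms that by (intro exI[of _ "a * c"]) (auto simp: fun_eq_iff)
  moreover have "\<exists>b. (\<lambda>f. [:[:a:]:] * T f) = (\<lambda>f. [:[:b:]:] * T' f) \<and> b \<noteq> 0" if "a \<noteq> 0" for a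
    using assms that by (intro exI[of _ "a / c"]) (auto simp: fun_eq_iff)
  ultimately show ?thesis unfolding proj_point_def by blast
qed

lemma psi_eq_proj_point_minors:
  fixes V :: "'n::{finite,linorder} sheaf" and A :: "hpoly ^ 'r::{finite,linorder} ^ 'n::{finite,linorder}"
  assumes "homogeneous_basis_matrix V A"
  shows "psi V = proj_point (minors A)"
proof -
  let ?A = "SOME A :: hpoly ^ 'r::{finite,linorder} ^ 'n::{finite,linorder}. homogeneous_basis_matrix V A"
  have "homogeneous_basis_matrix V ?A" using assms by (rule someI)
  then have "cvec.span (range (\<lambda>j. column j ?A)) = cvec.span (range (\<lambda>j. column j A))"
    using assms by (simp add: homogeneous_basis_matrix_def)
  then obtain M where M: "?A = A ** M" "det M dvd 1"
    using assms basis_change_unit_det[of A ?A] by (auto simp: homogeneous_basis_matrix_def)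
  then obtain c where "c \<noteq> 0" "det M = [:[:c:]:]" using hpoly_unit by blast
  then show ?thesis
    unfolding psi_def M(1) by (intro proj_point_scale[of c]) (simp_all add: minors_mult mult.commute)
qed

text \<open>Independent columns make the rows span the r-dimensional space. A basis is selected
  among the rows, and listing its indices increasingly gives f.\<close>

lemma exists_nonzero_minor:
  fixes u :: "'r::{finite,linorder} \<Rightarrow> complex ^ 'n::{finite,linorder}"
  assumes "inj u" "vec.independent (range u)"
  obtains f where "strict_mono f" "det (\<chi> i j. u j $ f i) \<noteq> 0"
proof -
  let ?U = "(\<chi> i j. u j $ i) :: complex ^ 'r::{finite,linorder} ^ 'n::{finite,linorder}"
  have "column j ?U = u j" for j by (simp add: column_def vec_eq_iff)
  then have "\<exists>B. B ** ?U = mat 1"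
    using vec.independent_image_iff[OF finite assms(1)] assms(2)
    by (subst matrix_left_invertible_independent_columns) auto
  then have "vec.span (rows ?U) = UNIV" by (simp add: matrix_left_invertible_span_rows_gen)
  moreover obtain B where B: "B \<subseteq> rows ?U" "vec.independent B" "rows ?U \<subseteq> vec.span B"
    using vec.maximal_independent_subset by metis
  ultimately have span: "vec.span B = UNIV"
    using vec.span_minimal[OF B(3) vec.subspace_span] by auto
  then have "card B = vec.dim (UNIV :: (complex ^ 'r::{finite,linorder}) set)"
    using vec.dim_span_eq_card_independent[OF B(2)] by simp
  then have card: "card B = CARD('r)" by (simp add: vec.dimension_def card_cart_basis)
  have "rows ?U = range (\<lambda>i. row i ?U)" by (auto simp: rows_def)
  then have "B \<subseteq> range (\<lambda>i. row i ?U)" using B(1) by (simp only:)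
  then obtain I where I: "inj_on (\<lambda>i. row i ?U) I" "B = (\<lambda>i. row i ?U) ` I"
    unfolding subset_image_inj by blast
  have "card I = CARD('r)" using card card_image[OF I(1)] I(2) by (simp only:)
  then obtain f :: "'r \<Rightarrow> 'n" where f: "strict_mono f" "range f = I"
    using strict_mono_enumeration[of I] by auto
  let ?N = "(\<chi> i j. u j $ f i) :: complex ^ 'r::{finite,linorder} ^ 'r::{finite,linorder}"
  have "row i ?N = row (f i) ?U" for i by (simp add: row_def vec_eq_iff)
  then have "rows ?N = (\<lambda>i. row i ?U) ` range f" by (auto simp: rows_def)
  then have "vec.span (rows ?N) = UNIV" using span I(2) f(2) by simp
  then have "invertible ?N"
    by (simp add: invertible_left_inverse matrix_left_invertible_span_rows_gen)
  then have "det ?N \<noteq> 0" by (simp add: invertible_det_nz)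
  with f(1) show thesis by (rule that)
qed

text \<open>Column k has the common factor z0^(\<alpha> k); pulling these factors out leaves a
  constant matrix. The transposition turns columns into the rows on which
  \<open>det_rows_mul\<close> acts.\<close>

lemma minors_standard:
  fixes u :: "'r::{finite,linorder} \<Rightarrow> complex ^ 'n::{finite,linorder}"
  assumes "strict_mono f"
  shows "minors (\<chi> i k. bimonom (\<alpha> k) 0 (u k) $ i) f = monom [:det (\<chi> i j. u j $ f i):] (sum \<alpha> UNIV)"
proof -
  let ?U = "(\<chi> i j. u j $ f i) :: complex ^ 'r::{finite,linorder} ^ 'r::{finite,linorder}"
  have "minors (\<chi> i k. bimonom (\<alpha> k) 0 (u k) $ i) f
      = det (transpose (\<chi> k. monom 1 (\<alpha> k) *s (\<chi> i. [:[:u k $ f i:]:])))"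
    using assms by (simp add: minors_def bimonom_def monom_vec_def monom_0 smult_monom transpose_def)
  also have "\<dots> = (\<Prod>k\<in>UNIV. monom 1 (\<alpha> k)) * det (transpose (\<chi> k i. [:[:u k $ f i:]:]))"
    unfolding det_transpose by (rule det_rows_mul)
  also have "transpose (\<chi> k i. [:[:u k $ f i:]:]) = (\<chi> i j. [:[:?U $ i $ j:]:])"
    by (simp add: transpose_def)
  also have "det \<dots> = [:[:det ?U:]:]"
    by (rule det_ring_hom[of "\<lambda>c. [:[:c:]:]", symmetric]) (simp_all add: one_pCons)
  also have "(\<Prod>k\<in>UNIV. monom (1 :: complex poly) (\<alpha> k)) = monom 1 (sum \<alpha> UNIV)"
  proof -
    have "(\<Prod>k\<in>K. monom (1 :: complex poly) (\<alpha> k)) = monom 1 (sum \<alpha> K)" for K :: "'r set"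
      by (induction K rule: infinite_finite_induct) (simp_all add: mult_monom)
    then show ?thesis .
  qed
  finally show ?thesis by (simp add: smult_monom mult.commute)
qed

lemma psi_in_Y0:
  fixes u :: "'r::{finite,linorder} \<Rightarrow> complex ^ 'n::{finite,linorder}"
  assumes "inj u" "vec.independent (range u)"
    and V: "homogeneous_basis_matrix V (\<chi> i k. bimonom (\<alpha> k) 0 (u k) $ i)"
  shows "psi V \<in> (Y0 (sum \<alpha> UNIV) :: ('r, 'n) tuple set set)"
proof -
  let ?A = "(\<chi> i k. bimonom (\<alpha> k) 0 (u k) $ i) :: hpoly ^ 'r::{finite,linorder} ^ 'n::{finite,linorder}"
  let ?c = "\<lambda>f. det (\<chi> i j. u j $ f i)"
  have eq: "minors ?A = (\<lambda>f. if strict_mono f then monom [:?c f:] (sum \<alpha> UNIV) else 0)"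
  proof
    fix f show "minors ?A f = (if strict_mono f then monom [:?c f:] (sum \<alpha> UNIV) else 0)"
    proof (cases "strict_mono f")
      case True
      then show ?thesis by (simp add: minors_standard)
    qed (simp add: minors_def)
  qed
  obtain f where "strict_mono f" "?c f \<noteq> 0" using exists_nonzero_minor[OF assms(1,2)] by blast
  then have "minors ?A f \<noteq> 0" by (simp add: eq)
  moreover have "homogeneous (sum \<alpha> UNIV) (minors ?A f)" for f
    by (auto simp: eq homogeneous_def coeff_pCons split: if_splits nat.splits)
  ultimately have "proj_point (minors ?A) \<in> W_space (sum \<alpha> UNIV)"
    unfolding W_space_def by (auto simp: eq intro!: exI[of _ "minors ?A"])
  then show ?thesis
    unfolding psi_eq_proj_point_minors[OF V] Y0_def
    by (intro CollectI conjI exI[of _ ?c] arg_cong[OF eq, of proj_point])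
qed

text \<open>Some minor is a nonzero multiple of z0^d, so it does not vanish at z0 = 1, z1 = 0, the
  origin of U_\<infinity>, and the columns stay independent there. Evaluation keeps only terms free
  of z1, whose coefficients lie in \<open>B 0\<close>.\<close>

lemma psi_in_Y0_imp:
  fixes A B :: "nat \<Rightarrow> (complex ^ 'n::{finite,linorder}) set" and M :: "hpoly ^ 'r::{finite,linorder} ^ 'n::{finite,linorder}"
  assumes A: "filtration A" and B: "filtration B"
    and M: "homogeneous_basis_matrix (graded A, graded B) M"
    and psi: "psi (graded A, graded B) \<in> (Y0 d :: ('r, 'n) tuple set set)"
  shows "CARD('r) \<le> vec.dim (B 0)"
proof -
  obtain c where W: "proj_point (minors M) \<in> W_space d"
    and c: "proj_point (minors M) = proj_point (\<lambda>f. if strict_mono f then monom [:c f:] d else 0)"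
    using psi unfolding psi_eq_proj_point_minors[OF M] Y0_def by blast
  have self: "T \<in> proj_point T" for T :: "('r, 'n) tuple"
    unfolding proj_point_def by (auto intro!: exI[of _ 1] simp: one_pCons[symmetric])
  obtain e where e: "minors M = (\<lambda>f. [:[:e:]:] * (if strict_mono f then monom [:c f:] d else 0))"
    using self[of "minors M"] c by (auto simp: proj_point_def)
  \<comment> \<open>Nonvanishing comes from \<open>W_space\<close>: its points have a nonzero
    representative, of which every other one is a nonzero multiple.\<close>
  obtain T f where T: "proj_point (minors M) = proj_point T" "T f \<noteq> 0"
    using W by (auto simp: W_space_def)
  then have "minors M f \<noteq> 0"
    using self[of "minors M"] by (auto simp: proj_point_def)
  then have f: "strict_mono f" "e \<noteq> 0" "c f \<noteq> 0" by (auto simp: e split: if_splits)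
  \<comment> \<open>The outer variable z0 is set to 1 and the inner variable z1 to 0.\<close>
  define h :: "hpoly \<Rightarrow> complex" where "h p = poly (poly p 1) 0" for p
  have "h (minors M f) = e * c f" using f by (simp add: e h_def poly_monom)
  then have "h (det (\<chi> i. M $ f i)) \<noteq> 0" using f by (simp add: minors_def)
  moreover have "h (det (\<chi> i. M $ f i)) = det (\<chi> i j. h ((\<chi> i. M $ f i) $ i $ j))"
    by (rule det_ring_hom) (simp_all add: h_def)
  ultimately have det: "det (\<chi> i j. h (M $ f i $ j)) \<noteq> 0" by simp
  define v where "v j = (\<chi> i. h (M $ i $ j))" for j
  have "inj v \<and> vec.independent (range v)"
  proof -
    have "c j = 0" if "(\<Sum>j\<in>UNIV. c j *s v j) = 0" for c j
    proof -
      let ?N = "(\<chi> i j. h (M $ f i $ j)) :: complex ^ 'r::{finite,linorder} ^ 'r::{finite,linorder}"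
      have "invertible ?N" using det by (simp add: invertible_det_nz)
      then have "\<exists>N'. N' ** ?N = mat 1" by (simp add: invertible_left_inverse)
      moreover have "(\<Sum>j\<in>UNIV. c j *s column j ?N) = 0"
        using that by (simp add: vec_eq_iff column_def v_def)
      ultimately show ?thesis using matrix_left_invertible_independent_columns by blast
    qed
    then have "inj v" by (intro vec.independent_family_inj) auto
    then show ?thesis
      using \<open>\<And>c j. (\<Sum>j\<in>UNIV. c j *s v j) = 0 \<Longrightarrow> c j = 0\<close> by (simp add: vec.independent_image_iff[OF finite])
  qed
  moreover have "v j \<in> B 0" for j
  proof -
    \<comment> \<open>A bound common to all entries of the column, so that the sums over the entries
      combine into one sum of vectors.\<close>
    obtain N where N: "\<And>i. i \<ge> N \<Longrightarrow> coeff_vec i (column j M) = 0"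
      using coeff_vec_eventually_0 by blast
    have "h (M $ i $ j) = (\<Sum>a<N. bicoeff a 0 (column j M) $ i)" for i
    proof -
      have "h (M $ i $ j) = (\<Sum>a\<le>degree (M $ i $ j). coeff (coeff (M $ i $ j) a) 0)"
        by (simp add: h_def poly_0_coeff_0 coeff_poly_1)
      also have "\<dots> = (\<Sum>a<N + Suc (degree (M $ i $ j)). coeff (coeff (M $ i $ j) a) 0)"
        by (intro sum.mono_neutral_left) (auto simp: coeff_eq_0)
      also have "\<dots> = (\<Sum>a<N. coeff (coeff (M $ i $ j) a) 0)"
        using N by (intro sum.mono_neutral_right) (auto simp: coeff_vec_def column_def vec_eq_iff)
      finally show ?thesis by (simp add: bicoeff_def coeff_vec_def column_def)
    qed
    then have "v j = (\<Sum>a<N. bicoeff a 0 (column j M))" by (simp add: v_def vec_eq_iff)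
    moreover have "column j M \<in> graded_module (graded A, graded B)"
      using M cvec.span_base[OF rangeI, of "\<lambda>j. column j M" j] by (simp add: homogeneous_basis_matrix_def)
    then have "bicoeff a 0 (column j M) \<in> B 0" for a
      by (simp add: graded_module_graded[OF A B])
    ultimately show ?thesis by (simp add: vec.subspace_sum[OF filtrationD(1)[OF B]])
  qed
  ultimately show ?thesis
    using vec.independent_card_le_dim[of "range v" "B 0"] by (auto simp: card_image)
qed

section \<open>The fixed loci\<close>

text \<open>Over U_\<infinity> the filtration is constant; its value has to be the union, as gluing
  requires equal unions.\<close>

definition sheaf_of :: "(nat \<Rightarrow> (complex ^ 'n::finite) set) \<Rightarrow> 'n sheaf" where
  "sheaf_of A = (graded A, graded (\<lambda>_. \<Union>i. A i))"

lemma Least_filtration_le_iff: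
  assumes "filtration A" "v \<in> (\<Union>i. A i)"
  shows "(LEAST i. v \<in> A i) \<le> j \<longleftrightarrow> v \<in> A j"
proof
  have "v \<in> A (LEAST i. v \<in> A i)" using assms(2) by (auto intro: LeastI)
  then show "v \<in> A j" if "(LEAST i. v \<in> A i) \<le> j"
    using filtrationD(2)[OF assms(1) that] by blast
qed (rule Least_le)

lemma graded_eq_span:
  fixes u :: "'r::finite \<Rightarrow> complex ^ 'n::finite"
  assumes A: "filtration A" and Au: "\<And>i. A i = vec.span (u ` {k. \<alpha> k \<le> i})"
  shows "graded A = cvec.span (range (\<lambda>k. monom_vec (\<alpha> k) (u k)))" (is "_ = ?S")
proof
  have *: "monom_vec i v \<in> ?S" if "v \<in> vec.span (u ` {k. \<alpha> k \<le> i})" for i v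
    using that
  proof (induction rule: vec.span_induct_alt)
    case base
    show ?case by (simp add: cvec.span_zero)
  next
    case (step c x y)
    then obtain k where k: "x = u k" "\<alpha> k \<le> i" by auto
    then have "monom_vec i x = monom 1 (i - \<alpha> k) *s monom_vec (\<alpha> k) (u k)"
      by (simp add: monom_smult_monom_vec)
    moreover have "\<dots> \<in> ?S" by (intro cvec.span_scale cvec.span_base rangeI)
    ultimately have "monom_vec i x \<in> ?S" by (simp only:)
    then show ?case unfolding monom_vec_add monom_vec_scale
      by (intro cvec.span_add cvec.span_scale step.IH)
  qed
  show "graded A \<subseteq> ?S"
  proof
    fix s assume s: "s \<in> graded A"
    obtain N where "\<And>i. i \<ge> N \<Longrightarrow> coeff_vec i s = 0"
      using coeff_vec_eventually_0 by blast
    then have "s = (\<Sum>i<N. monom_vec i (coeff_vec i s))"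
      by (rule monom_vec_decomposition)
    also have "\<dots> \<in> ?S"
      using s by (intro cvec.span_sum *) (auto simp: graded_def Au)
    finally show "s \<in> ?S" .
  qed
  have "u k \<in> A (\<alpha> k)" for k unfolding Au by (rule vec.span_base) auto
  then show "?S \<subseteq> graded A"
    by (intro cvec.span_minimal[OF _ subspace_graded[OF A]]) (auto simp: monom_vec_in_graded[OF A])
qed

lemma const_sections_eq_graded:
  assumes "vec.subspace W"
  shows "const_sections W = graded (\<lambda>_. W)"
proof
  note W = filtration_const[OF assms]
  show "const_sections W \<subseteq> graded (\<lambda>_. W)"
    unfolding const_sections_def
    by (rule cvec.span_minimal[OF _ subspace_graded[OF W]])
      (auto simp: const_vec_eq monom_vec_in_graded[OF W])
  show "graded (\<lambda>_. W) \<subseteq> const_sections W"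
    using graded_subset_span[of "\<lambda>_. W" W] vec.span_superset
    by (auto simp: const_sections_def const_vec_eq[abs_def])
qed

lemma filtration_span:
  fixes u :: "'r::finite \<Rightarrow> complex ^ 'n::finite" and \<alpha> :: "'r \<Rightarrow> nat"
  shows "filtration (\<lambda>i. vec.span (u ` {k. \<alpha> k \<le> i}))"
  unfolding filtration_def by (auto simp: mono_def intro!: vec.span_mono image_mono)

lemma UN_span:
  fixes u :: "'r::finite \<Rightarrow> complex ^ 'n::finite" and \<alpha> :: "'r \<Rightarrow> nat"
  shows "(\<Union>i. vec.span (u ` {k. \<alpha> k \<le> i})) = vec.span (range u)"
proof
  show "(\<Union>i. vec.span (u ` {k. \<alpha> k \<le> i})) \<subseteq> vec.span (range u)"
    by (intro UN_least vec.span_mono) auto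
  have "\<alpha> k \<le> Max (range \<alpha>)" for k by (rule Max_ge) auto
  then have "range u = u ` {k. \<alpha> k \<le> Max (range \<alpha>)}" by auto
  from arg_cong[OF this, of vec.span]
  show "vec.span (range u) \<subseteq> (\<Union>i. vec.span (u ` {k. \<alpha> k \<le> i}))" by blast
qed

lemma card_fibre_Suc:
  assumes "finite Z"
  shows "card {z \<in> Z. b z = Suc j} = card {z \<in> Z. b z \<le> Suc j} - card {z \<in> Z. b z \<le> j}"
proof -
  have eq: "{z \<in> Z. b z = Suc j} = {z \<in> Z. b z \<le> Suc j} - {z \<in> Z. b z \<le> j}" by auto
  show ?thesis unfolding eq using assms by (intro card_Diff_subset) auto
qed

text \<open>Differences of the cumulative counts show that corresponding fibres have equal size;
  bijections between the fibres are then glued.\<close>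

lemma bij_betw_fibres:
  fixes a :: "'x \<Rightarrow> nat" and \<alpha> :: "'y \<Rightarrow> nat"
  assumes X: "finite X" and Y: "finite Y"
    and card: "\<And>i. card {x \<in> X. a x \<le> i} = card {y \<in> Y. \<alpha> y \<le> i}"
  shows "\<exists>u. bij_betw u Y X \<and> (\<forall>y\<in>Y. a (u y) = \<alpha> y)"
proof -
  have "card {x \<in> X. a x = i} = card {y \<in> Y. \<alpha> y = i}" for i
  proof (cases i)
    case 0
    then show ?thesis using card[of 0] by simp
  next
    case (Suc j)
    show ?thesis unfolding Suc card_fibre_Suc[OF X] card_fibre_Suc[OF Y] card ..
  qed
  then have "\<exists>h. bij_betw h {y \<in> Y. \<alpha> y = i} {x \<in> X. a x = i}" for i
    using X Y by (intro finite_same_card_bij) auto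
  then obtain h where h: "\<And>i. bij_betw (h i) {y \<in> Y. \<alpha> y = i} {x \<in> X. a x = i}" by metis
  define u where "u y = h (\<alpha> y) y" for y
  have u: "u y \<in> X \<and> a (u y) = \<alpha> y" if "y \<in> Y" for y
    using that bij_betwE[OF h[of "\<alpha> y"]] by (auto simp: u_def)
  have "bij_betw u Y X"
    unfolding bij_betw_def
  proof
    show "inj_on u Y"
    proof (rule inj_onI)
      fix y z assume yz: "y \<in> Y" "z \<in> Y" "u y = u z"
      then have "\<alpha> y = \<alpha> z" using u by metis
      then show "y = z"
        using yz h[of "\<alpha> z"] by (auto simp: u_def bij_betw_def dest: inj_onD)
    qed
    show "u ` Y = X"
    proof
      show "X \<subseteq> u ` Y"
      proof
        fix x assume "x \<in> X"
        then have "x \<in> h (a x) ` {y \<in> Y. \<alpha> y = a x}"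
          using h[of "a x"] by (simp add: bij_betw_def)
        then obtain y where "y \<in> Y" "\<alpha> y = a x" "x = h (a x) y" by auto
        then show "x \<in> u ` Y" by (intro image_eqI[of _ _ y]) (simp_all add: u_def)
      qed
    qed (use u in auto)
  qed
  with u show ?thesis by blast
qed

text \<open>The indices at which the vectors of an adapted basis enter \<open>A\<close> have the
  same cumulative counts as \<alpha>. The basis can therefore be labelled so that \<open>u k\<close>
  enters exactly at \<alpha> k.\<close>

lemma adapted_family_exists:
  fixes A :: "nat \<Rightarrow> (complex ^ 'n::finite) set" and \<alpha> :: "'r::finite \<Rightarrow> nat"
  assumes A: "filtration A" and dim: "\<And>i. vec.dim (A i) = card {k. \<alpha> k \<le> i}"
  obtains u where "inj u" "vec.independent (range u)" "\<And>i. A i = vec.span (u ` {k. \<alpha> k \<le> i})"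
proof -
  define W where "W = (\<Union>i. A i)"
  have W: "filtration (\<lambda>_. W)"
    unfolding W_def by (rule filtration_const, rule subspace_UN_filtration, rule A)
  \<comment> \<open>With a constant second filtration, a basis adapted to both is simply one adapted
    to \<open>A\<close>.\<close>
  obtain S where S: "vec.independent S" "\<And>i. adapted S (A i \<inter> W)"
    using adapted_basis_exists[OF A W] by metis
  define T where "T = S \<inter> W"
  have T: "vec.independent T" "T \<subseteq> W" "finite T"
    unfolding T_def
    using vec.independent_mono[OF S(1) Int_lower1] vec.finiteI_independent[OF S(1)] by auto
  have AT: "A i = vec.span (T \<inter> A i)" for i
  proof -
    have "A i \<inter> W = A i" "S \<inter> (A i \<inter> W) = T \<inter> A i" by (auto simp: W_def T_def)
    then show ?thesis using S(2)[of i] by (simp add: adapted_def)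
  qed
  define a where "a v = (LEAST i. v \<in> A i)" for v
  have a: "a v \<le> i \<longleftrightarrow> v \<in> A i" if "v \<in> T" for v i
    unfolding a_def using that T(2) by (intro Least_filtration_le_iff[OF A]) (auto simp: W_def)
  have "card {v \<in> T. a v \<le> i} = card {k \<in> UNIV. \<alpha> k \<le> i}" for i
  proof -
    have "{v \<in> T. a v \<le> i} = T \<inter> A i" using a by auto
    moreover have "vec.independent (T \<inter> A i)" using T(1) by (rule vec.independent_mono) auto
    then have "vec.dim (A i) = card (T \<inter> A i)"
      by (subst AT) (rule vec.dim_span_eq_card_independent)
    ultimately show ?thesis by (simp add: dim)
  qed
  from bij_betw_fibres[OF T(3) finite this]
  obtain u where u: "bij_betw u UNIV T" "\<forall>k\<in>UNIV. a (u k) = \<alpha> k" by (elim exE conjE)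
  have range: "range u = T" using u(1) by (simp add: bij_betw_def)
  then have "\<alpha> k \<le> i \<longleftrightarrow> u k \<in> A i" for k i
    using a[of "u k" i] u(2) by auto
  then have "u ` {k. \<alpha> k \<le> i} = T \<inter> A i" for i
    using range by auto
  then have "A i = vec.span (u ` {k. \<alpha> k \<le> i})" for i using AT by simp
  then show thesis using that[of u] u(1) T(1) by (simp add: bij_betw_def)
qed

lemma dim_UN_filtration:
  fixes A :: "nat \<Rightarrow> (complex ^ 'n::finite) set" and \<alpha> :: "'r::finite \<Rightarrow> nat"
  assumes A: "filtration A" and dim: "\<And>i. vec.dim (A i) = card {k. \<alpha> k \<le> i}"
  shows "vec.dim (\<Union>i. A i) = CARD('r)"
proof -
  obtain N where N: "\<And>i. i \<ge> N \<Longrightarrow> A i = (\<Union>i. A i)"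
    by (metis filtration_stable[OF A])
  have "\<alpha> k \<le> max N (Max (range \<alpha>))" for k by (simp add: le_max_iff_disj)
  then have "vec.dim (A (max N (Max (range \<alpha>)))) = CARD('r)" by (simp add: dim)
  then show ?thesis using N[of "max N (Max (range \<alpha>))"] by simp
qed

lemma sheaf_of_in_Quot:
  fixes A :: "nat \<Rightarrow> (complex ^ 'n::finite) set" and \<alpha> :: "'r::finite \<Rightarrow> nat"
  assumes A: "filtration A" and dim: "\<And>i. vec.dim (A i) = card {k. \<alpha> k \<le> i}"
  shows "sheaf_of A \<in> Quot CARD('r) (sum \<alpha> UNIV)" "circle_fixed (sheaf_of A)"
proof -
  have W: "filtration (\<lambda>_. \<Union>i. A i)"
    by (rule filtration_const, rule subspace_UN_filtration, rule A)
  show "sheaf_of A \<in> Quot CARD('r) (sum \<alpha> UNIV)"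
    using coherent_subsheaf_graded[OF A W] sheaf_rank_graded[OF A] dim_UN_filtration[OF A dim]
      quotient_hilbert_poly_graded[OF A dim]
    by (simp add: Quot_def sheaf_of_def)
  show "circle_fixed (sheaf_of A)" unfolding sheaf_of_def by (rule circle_fixed_graded[OF A W])
qed

text \<open>Trades the chosen basis u for the filtration, which V determines, so that disjointness
  and the comparison with flags become statements about filtrations and their dimensions.\<close>

lemma F_locus_iff:
  fixes \<alpha> :: "'r::finite \<Rightarrow> nat" and V :: "'n::finite sheaf"
  shows "V \<in> F_locus \<alpha> \<longleftrightarrow>
    (\<exists>A. filtration A \<and> (\<forall>i. vec.dim (A i) = card {k. \<alpha> k \<le> i}) \<and> V = sheaf_of A)"
proof
  assume "V \<in> F_locus \<alpha>"
  then obtain W and u :: "'r \<Rightarrow> complex ^ 'n" where W: "vec.subspace W"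
    and u: "inj u" "vec.independent (range u)" "vec.span (range u) = W"
    and V: "snd V = const_sections W" "fst V = cvec.span (range (\<lambda>i. monom 1 (\<alpha> i) *s const_vec (u i)))"
    unfolding F_locus_def by blast
  define A where "A i = vec.span (u ` {k. \<alpha> k \<le> i})" for i
  have A: "filtration A" unfolding A_def by (rule filtration_span)
  have "vec.dim (A i) = card {k. \<alpha> k \<le> i}" for i
  proof -
    have "vec.independent (u ` {k. \<alpha> k \<le> i})" using u(2) by (rule vec.independent_mono) auto
    then have "vec.dim (A i) = card (u ` {k. \<alpha> k \<le> i})"
      unfolding A_def by (rule vec.dim_span_eq_card_independent)
    then show ?thesis using u(1) by (simp add: card_image inj_on_subset)
  qed
  moreover have "(\<Union>i. A i) = W" unfolding A_def UN_span by (rule u(3))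
  then have "V = sheaf_of A"
    using V graded_eq_span[OF A A_def] const_sections_eq_graded[OF W]
    by (simp add: sheaf_of_def prod_eq_iff monom_smult_const_vec)
  ultimately show "\<exists>A. filtration A \<and> (\<forall>i. vec.dim (A i) = card {k. \<alpha> k \<le> i}) \<and> V = sheaf_of A"
    using A by blast
next
  assume "\<exists>A. filtration A \<and> (\<forall>i. vec.dim (A i) = card {k. \<alpha> k \<le> i}) \<and> V = sheaf_of A"
  then obtain A where A: "filtration A" and dim: "\<And>i. vec.dim (A i) = card {k. \<alpha> k \<le> i}"
    and V: "V = sheaf_of A" by blast
  obtain u where u: "inj u" "vec.independent (range u)" and Au: "\<And>i. A i = vec.span (u ` {k. \<alpha> k \<le> i})"
    using adapted_family_exists[OF A dim] by blast
  have W: "(\<Union>i. A i) = vec.span (range u)" unfolding Au by (rule UN_span)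
  have sub: "vec.subspace (\<Union>i. A i)" by (rule subspace_UN_filtration[OF A])
  have snd: "snd V = const_sections (\<Union>i. A i)"
    by (simp add: V sheaf_of_def const_sections_eq_graded[OF sub])
  have fst: "fst V = cvec.span (range (\<lambda>i. monom 1 (\<alpha> i) *s const_vec (u i)))"
    by (simp add: V sheaf_of_def graded_eq_span[OF A Au] monom_smult_const_vec)
  have sub_const: "fst V \<subseteq> const_sections (\<Union>i. A i)"
    unfolding V sheaf_of_def const_sections_eq_graded[OF sub] fst_conv by (rule graded_mono) auto
  show "V \<in> F_locus \<alpha>"
    unfolding F_locus_def
    using sheaf_of_in_Quot[OF A dim] sub dim_UN_filtration[OF A dim] u W snd fst sub_const
    by (intro CollectI conjI exI[of _ "\<Union>i. A i"] exI[of _ u]) (simp_all add: V)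
qed

lemma sheaf_of_inject:
  assumes "filtration A" "filtration B"
  shows "sheaf_of A = sheaf_of B \<longleftrightarrow> A = B"
  using graded_inject[OF assms] by (auto simp: sheaf_of_def)

lemma F_locus_disjoint:
  fixes \<alpha> \<beta> :: "'r::{finite,linorder} \<Rightarrow> nat"
  assumes "mono \<alpha>" "mono \<beta>" "V \<in> F_locus \<alpha>" "V \<in> F_locus \<beta>"
  shows "\<alpha> = \<beta>"
proof -
  obtain A where A: "filtration A" "\<And>i. vec.dim (A i) = card {k. \<alpha> k \<le> i}" "V = sheaf_of A"
    using assms(3) by (auto simp: F_locus_iff)
  obtain B where B: "filtration B" "\<And>i. vec.dim (B i) = card {k. \<beta> k \<le> i}" "V = sheaf_of B"
    using assms(4) by (auto simp: F_locus_iff)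
  have "A = B" using A(1,3) B(1,3) sheaf_of_inject by metis
  then have card: "card {k. \<alpha> k \<le> i} = card {k. \<beta> k \<le> i}" for i using A(2) B(2) by metis
  have "{k. \<alpha> k \<le> i} = {k. \<beta> k \<le> i}" for i
  proof -
    \<comment> \<open>Sublevel sets of monotone functions are initial segments of a linear order,
      hence nested; equal size makes them equal.\<close>
    have "{k. \<alpha> k \<le> i} \<subseteq> {k. \<beta> k \<le> i} \<or> {k. \<beta> k \<le> i} \<subseteq> {k. \<alpha> k \<le> i}"
      using assms(1,2) by (smt (verit) linear mem_Collect_eq monoD order_trans subsetI)
    then show ?thesis using card[of i] by (metis card_subset_eq finite)
  qed
  then have "\<alpha> k \<le> i \<longleftrightarrow> \<beta> k \<le> i" for k i by blast
  then show ?thesis by (intro ext) (metis order_antisym order_refl)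
qed

text \<open>The exponents of a vector of the common adapted basis are the least indices at which it
  enters \<open>A\<close> and \<open>B\<close>.\<close>

lemma homogeneous_basis_exists:
  fixes A B :: "nat \<Rightarrow> (complex ^ 'n::finite) set"
  assumes A: "filtration A" and B: "filtration B"
    and W: "(\<Union>i. A i) = (\<Union>i. B i)" "vec.dim (\<Union>i. A i) = CARD('r::finite)"
  obtains M :: "hpoly ^ 'r::finite ^ 'n" where "homogeneous_basis_matrix (graded A, graded B) M"
proof -
  obtain S where S: "vec.independent S" "\<And>i j. adapted S (A i \<inter> B j)"
    using adapted_basis_exists[OF A B] by metis
  let ?W = "\<Union>i. A i"
  obtain N where N: "A N = ?W" by (metis filtration_stable[OF A] order_refl)
  obtain M where M: "B M = ?W" unfolding W(1) by (metis filtration_stable[OF B] order_refl)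
  define T where "T = S \<inter> ?W"
  have T: "vec.independent T" "finite T"
    unfolding T_def
    using vec.independent_mono[OF S(1) Int_lower1] vec.finiteI_independent[OF S(1)] by auto
  have "vec.span T = ?W" using S(2)[of N M] by (simp add: N M T_def adapted_def)
  then have "card T = CARD('r)" using vec.dim_span_eq_card_independent[OF T(1)] W(2) by simp
  then obtain u :: "'r \<Rightarrow> complex ^ 'n" where u: "bij_betw u UNIV T"
    using finite_same_card_bij[of "UNIV :: 'r set" T] T(2) by auto
  then have uW: "u k \<in> (\<Union>i. A i)" "u k \<in> (\<Union>i. B i)" for k
    using W(1) by (auto simp: bij_betw_def T_def)
  have AB: "A i \<inter> B j = vec.span (u ` {k. (LEAST i. u k \<in> A i) \<le> i \<and> (LEAST j. u k \<in> B j) \<le> j})" for i j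
  proof -
    have "u ` {k. (LEAST i. u k \<in> A i) \<le> i \<and> (LEAST j. u k \<in> B j) \<le> j} = range u \<inter> (A i \<inter> B j)"
      unfolding Least_filtration_le_iff[OF A uW(1)] Least_filtration_le_iff[OF B uW(2)] by auto
    also have "\<dots> = S \<inter> (A i \<inter> B j)" using u by (auto simp: bij_betw_def T_def)
    finally show ?thesis using S(2)[of i j] by (simp add: adapted_def)
  qed
  have "inj u" "vec.independent (range u)" using u T(1) by (simp_all add: bij_betw_def)
  from that[OF homogeneous_basis_matrix_adapted[OF A B this AB]] show thesis .
qed

lemma E0_eq_UN_F_locus:
  "(E0 TYPE('r::{finite,linorder}) d :: 'n::{finite,linorder} sheaf set) =
    (\<Union>\<alpha> \<in> (weights d :: ('r \<Rightarrow> nat) set). F_locus \<alpha>)"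
proof (intro set_eqI iffI)
  fix V :: "'n sheaf"
  assume "V \<in> E0 TYPE('r) d"
  then have V: "coherent_subsheaf V" "sheaf_rank V = CARD('r)" "circle_fixed V"
    "quotient_hilbert_poly V (quot_poly CARD('n) CARD('r) d)"
    and psi: "psi V \<in> (Y0 d :: ('r, 'n) tuple set set)"
    by (auto simp: E0_def Quot_def)
  obtain A B where A: "filtration A" and B: "filtration B" and VAB: "V = (graded A, graded B)"
    using circle_fixed_imp_graded[OF V(3,1)] by blast
  have W: "(\<Union>i. A i) = (\<Union>i. B i)"
    using V(1) coherent_subsheaf_graded[OF A B] by (simp add: VAB)
  have dimW: "vec.dim (\<Union>i. A i) = CARD('r)"
    using V(2) sheaf_rank_graded[OF A] by (simp add: VAB)
  obtain M :: "hpoly ^ 'r::{finite,linorder} ^ 'n::{finite,linorder}" where "homogeneous_basis_matrix (graded A, graded B) M"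
    using homogeneous_basis_exists[OF A B W dimW] by blast
  then have "CARD('r) \<le> vec.dim (B 0)"
    using psi_in_Y0_imp[OF A B] psi by (simp add: VAB)
  \<comment> \<open>\<open>B 0\<close> is contained in the union, whose dimension is r, so the bound
    forces equality.\<close>
  then have B0: "B 0 = (\<Union>i. B i)"
    using dimW W by (intro vec.subspace_dim_equal filtrationD(1)[OF B] subspace_UN_filtration[OF B]) auto
  have BW: "B = (\<lambda>_. \<Union>i. A i)"
  proof
    fix i
    have "(\<Union>i. A i) \<subseteq> B i" using filtrationD(2)[OF B, of 0 i] B0 W by simp
    moreover have "B i \<subseteq> (\<Union>i. A i)" unfolding W by blast
    ultimately show "B i = (\<Union>i. A i)" by (rule subset_antisym[rotated])
  qed
  \<comment> \<open>The jumps of \<open>A\<close> in increasing order, with multiplicity: \<alpha> k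
    is the first index at which the dimension exceeds the number of elements below k.\<close>
  define \<alpha> where "\<alpha> k = (LEAST i. position k < vec.dim (A i))" for k :: 'r
  have le: "vec.dim (A i) \<le> CARD('r)" for i
    using dimW vec.dim_subset[of "A i" "\<Union>i. A i"] by auto
  obtain N where N: "A N = (\<Union>i. A i)" by (metis filtration_stable[OF A] order_refl)
  have \<alpha>: "\<alpha> k \<le> i \<longleftrightarrow> position k < vec.dim (A i)" for k i
  proof
    have "position k < vec.dim (A N)"
      using N dimW position_bij[where 'r = 'r] by (auto simp: bij_betw_def)
    then have "position k < vec.dim (A (\<alpha> k))" unfolding \<alpha>_def by (rule LeastI)
    moreover assume "\<alpha> k \<le> i"
    then have "vec.dim (A (\<alpha> k)) \<le> vec.dim (A i)" by (intro vec.dim_subset filtrationD(2)[OF A])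
    ultimately show "position k < vec.dim (A i)" by simp
  qed (simp add: \<alpha>_def Least_le)
  have dim: "vec.dim (A i) = card {k. \<alpha> k \<le> i}" for i
    unfolding \<alpha> using card_position_less[OF le] by simp
  have "mono \<alpha>"
  proof (rule monoI)
    fix k l :: 'r assume "k \<le> l"
    then have "position k \<le> position l" by (metis leD leI position_less_iff)
    moreover have "position l < vec.dim (A (\<alpha> l))" using \<alpha>[of l "\<alpha> l"] by simp
    ultimately show "\<alpha> k \<le> \<alpha> l" unfolding \<alpha> by simp
  qed
  moreover have "sum \<alpha> UNIV = d"
    using V(4) quotient_hilbert_poly_graded[OF A dim] by (simp add: VAB BW)
  ultimately have "\<alpha> \<in> weights d" by (simp add: weights_def)
  moreover have "V \<in> F_locus \<alpha>"
    unfolding F_locus_iff using A dim by (intro exI[of _ A]) (simp add: VAB BW sheaf_of_def)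
  ultimately show "V \<in> (\<Union>\<alpha> \<in> (weights d :: ('r \<Rightarrow> nat) set). F_locus \<alpha>)" by blast
next
  fix V :: "'n sheaf"
  assume "V \<in> (\<Union>\<alpha> \<in> (weights d :: ('r \<Rightarrow> nat) set). F_locus \<alpha>)"
  then obtain \<alpha> :: "'r \<Rightarrow> nat" where \<alpha>: "sum \<alpha> UNIV = d" and VF: "V \<in> F_locus \<alpha>"
    by (auto simp: weights_def)
  then obtain A where A: "filtration A" and dim: "\<And>i. vec.dim (A i) = card {k. \<alpha> k \<le> i}"
    and V: "V = sheaf_of A" by (auto simp: F_locus_iff)
  obtain u where u: "inj u" "vec.independent (range u)" and Au: "\<And>i. A i = vec.span (u ` {k. \<alpha> k \<le> i})"
    using adapted_family_exists[OF A dim] by blast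
  have W: "filtration (\<lambda>_. \<Union>i. A i)"
    by (rule filtration_const, rule subspace_UN_filtration, rule A)
  \<comment> \<open>Every basis vector enters the constant second filtration at 0, so the columns
    carry no power of z1.\<close>
  have "A i \<inter> (\<Union>i. A i) = vec.span (u ` {k. \<alpha> k \<le> i \<and> 0 \<le> j})" for i j :: nat
    using Au by auto
  then have "homogeneous_basis_matrix V (\<chi> i k. bimonom (\<alpha> k) 0 (u k) $ i)"
    unfolding V sheaf_of_def by (rule homogeneous_basis_matrix_adapted[OF A W u])
  then have "psi V \<in> (Y0 d :: ('r, 'n) tuple set set)"
    using psi_in_Y0[OF u] \<alpha> by blast
  then show "V \<in> E0 TYPE('r) d"
    using VF \<alpha> by (simp add: E0_def F_locus_def)
qed

section \<open>Polynomial maps of frames\<close>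

text \<open>Tested on all linear functionals, since \<open>frame_polys\<close> has no preferred
  coordinates and the vectors with entries in \<open>hpoly\<close> form an infinite-dimensional
  space.\<close>

definition frame_poly_map ::
    "(complex \<Rightarrow> 'v \<Rightarrow> 'v) \<Rightarrow> (complex \<Rightarrow> 'w \<Rightarrow> 'w) \<Rightarrow>
     ((nat \<Rightarrow> nat \<Rightarrow> 'v::ab_group_add) \<Rightarrow> 'w::ab_group_add) \<Rightarrow> bool" where
  "frame_poly_map sc sc' g \<longleftrightarrow> (\<forall>l. Vector_Spaces.linear sc' (*) l \<longrightarrow> (\<lambda>b. l (g b)) \<in> frame_polys sc)"

lemma linear_functionalD:
  assumes "Vector_Spaces.linear sc (*) (l :: 'v::ab_group_add \<Rightarrow> complex)"
  shows "l (x + y) = l x + l y" "l (x - y) = l x - l y" "l (sc c x) = c * l x" "l 0 = 0"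
    "l (\<Sum>i\<in>I. f i) = (\<Sum>i\<in>I. l (f i))"
proof -
  interpret Vector_Spaces.linear sc "(*)" l by fact
  show "l (x + y) = l x + l y" "l (x - y) = l x - l y" "l (sc c x) = c * l x" "l 0 = 0"
    "l (\<Sum>i\<in>I. f i) = (\<Sum>i\<in>I. l (f i))"
    by (rule add diff scale zero sum)+
qed

lemma frame_poly_map_const: "frame_poly_map sc sc' (\<lambda>b. c)"
  by (simp add: frame_poly_map_def frame_polys.const)

lemma frame_poly_map_coordinate: "frame_poly_map sc sc (\<lambda>b. b j i)"
  by (simp add: frame_poly_map_def frame_polys.coordinate)

lemma frame_poly_map_linear:
  assumes "frame_poly_map sc sc' g" "Vector_Spaces.linear sc' sc'' T"
  shows "frame_poly_map sc sc'' (\<lambda>b. T (g b))"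
  unfolding frame_poly_map_def
proof (intro allI impI)
  fix l assume "Vector_Spaces.linear sc'' (*) l"
  then have "Vector_Spaces.linear sc' (*) (l \<circ> T)" by (rule Vector_Spaces.linear_compose[OF assms(2)])
  then show "(\<lambda>b. l (T (g b))) \<in> frame_polys sc"
    using assms(1)[unfolded frame_poly_map_def, rule_format, of "l \<circ> T"] by (simp add: o_def)
qed

lemma frame_poly_map_add:
  assumes "frame_poly_map sc sc' g" "frame_poly_map sc sc' h"
  shows "frame_poly_map sc sc' (\<lambda>b. g b + h b)"
  using assms by (simp add: frame_poly_map_def linear_functionalD(1) frame_polys.add)

lemma frame_poly_map_scale:
  assumes "p \<in> frame_polys sc" "frame_poly_map sc sc' g"
  shows "frame_poly_map sc sc' (\<lambda>b. sc' (p b) (g b))"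
  using assms by (simp add: frame_poly_map_def linear_functionalD(3) frame_polys.mult)

lemma frame_poly_map_diff:
  assumes "frame_poly_map sc sc' g" "frame_poly_map sc sc' h"
  shows "frame_poly_map sc sc' (\<lambda>b. g b - h b)"
  unfolding frame_poly_map_def
proof (intro allI impI)
  fix l assume l: "Vector_Spaces.linear sc' (*) l"
  have "(\<lambda>b. l (g b) + (- 1) * l (h b)) \<in> frame_polys sc"
    using assms l by (intro frame_polys.add frame_polys.mult frame_polys.const) (simp_all add: frame_poly_map_def)
  then show "(\<lambda>b. l (g b - h b)) \<in> frame_polys sc"
    by (simp add: linear_functionalD(2)[OF l])
qed

lemma frame_poly_map_sum:
  assumes "\<And>i. i \<in> I \<Longrightarrow> frame_poly_map sc sc' (g i)"
  shows "frame_poly_map sc sc' (\<lambda>b. \<Sum>i\<in>I. g i b)"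
  using assms
  by (induction I rule: infinite_finite_induct) (simp_all add: frame_poly_map_const frame_poly_map_add)

lemma frame_poly_map_if:
  "frame_poly_map sc sc' g \<Longrightarrow> frame_poly_map sc sc' h \<Longrightarrow>
    frame_poly_map sc sc' (\<lambda>b. if P then g b else h b)"
  by (cases P) simp_all

lemma frame_polys_comp:
  assumes "q \<in> frame_polys sc'" "\<And>j i. frame_poly_map sc sc' (\<lambda>b. G b j i)"
  shows "(\<lambda>b. q (G b)) \<in> frame_polys sc"
  using assms(1)
proof induction
  case (coordinate l j i)
  then show ?case using assms(2)[of j i] by (simp add: frame_poly_map_def)
qed (auto intro: frame_polys.intros)

text \<open>As zariski-open sets and regular functions are described by single frames, it suffices to lift
  the map to frames, locally around any given frame of an image point.\<close>

lemma variety_morphismI: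
  assumes sub: "\<phi> ` X \<subseteq> Y"
    and lift: "\<And>x c. x \<in> X \<Longrightarrow> frame sc' (e' (\<phi> x)) c \<Longrightarrow> \<exists>G \<delta> b\<^sub>0.
      (\<forall>j i. frame_poly_map sc sc' (\<lambda>b. G b j i)) \<and> \<delta> \<in> frame_polys sc \<and>
      frame sc (e x) b\<^sub>0 \<and> \<delta> b\<^sub>0 \<noteq> 0 \<and> G b\<^sub>0 = c \<and>
      (\<forall>y\<in>X. \<forall>b. frame sc (e y) b \<longrightarrow> \<delta> b \<noteq> 0 \<longrightarrow> frame sc' (e' (\<phi> y)) (G b))"
  shows "variety_morphism sc e X sc' e' Y \<phi>"
  unfolding variety_morphism_def
proof (intro conjI allI impI sub)
  fix U assume U: "zariski_open sc' e' Y U"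
  show "zariski_open sc e X {x \<in> X. \<phi> x \<in> U}"
    unfolding zariski_open_def
  proof (intro conjI ballI)
    fix x assume "x \<in> {x \<in> X. \<phi> x \<in> U}"
    then have x: "x \<in> X" "\<phi> x \<in> U" by auto
    obtain c q where q: "q \<in> frame_polys sc'" "frame sc' (e' (\<phi> x)) c" "q c \<noteq> 0"
      and open_q: "\<And>y b. y \<in> Y \<Longrightarrow> frame sc' (e' y) b \<Longrightarrow> q b \<noteq> 0 \<Longrightarrow> y \<in> U"
      using U x(2) unfolding zariski_open_def by blast
    obtain G \<delta> b\<^sub>0 where G: "\<And>j i. frame_poly_map sc sc' (\<lambda>b. G b j i)" and \<delta>: "\<delta> \<in> frame_polys sc"
      and b0: "frame sc (e x) b\<^sub>0" "\<delta> b\<^sub>0 \<noteq> 0" "G b\<^sub>0 = c"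
      and fr: "\<And>y b. y \<in> X \<Longrightarrow> frame sc (e y) b \<Longrightarrow> \<delta> b \<noteq> 0 \<Longrightarrow> frame sc' (e' (\<phi> y)) (G b)"
      using lift[OF x(1) q(2)] by (elim exE conjE) blast
    \<comment> \<open>A nonzero product keeps b where the lift is valid and \<open>G b\<close> where
      the given witness is valid.\<close>
    have "(\<lambda>b. \<delta> b * q (G b)) \<in> frame_polys sc"
      by (rule frame_polys.mult[OF \<delta> frame_polys_comp[OF q(1) G]])
    moreover have "y \<in> {x \<in> X. \<phi> x \<in> U}" if "y \<in> X" "frame sc (e y) b" "\<delta> b * q (G b) \<noteq> 0" for y b
      using that open_q[of "\<phi> y" "G b"] fr[of y b] sub by auto
    ultimately show "\<exists>b\<^sub>0. \<exists>q\<in>frame_polys sc. frame sc (e x) b\<^sub>0 \<and> q b\<^sub>0 \<noteq> 0 \<and>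
        (\<forall>y\<in>X. \<forall>b. frame sc (e y) b \<and> q b \<noteq> 0 \<longrightarrow> y \<in> {x \<in> X. \<phi> x \<in> U})"
      using b0 q(3) by (intro exI[of _ b\<^sub>0] bexI[of _ "\<lambda>b. \<delta> b * q (G b)"]) auto
  qed auto
  fix f assume f: "regular_on sc' e' U f"
  have UY: "U \<subseteq> Y" using U by (simp add: zariski_open_def)
  show "regular_on sc e {x \<in> X. \<phi> x \<in> U} (f \<circ> \<phi>)"
    unfolding regular_on_def
  proof
    fix x assume "x \<in> {x \<in> X. \<phi> x \<in> U}"
    then have x: "x \<in> X" "\<phi> x \<in> U" by auto
    obtain c p q where pq: "p \<in> frame_polys sc'" "q \<in> frame_polys sc'" "frame sc' (e' (\<phi> x)) c" "q c \<noteq> 0"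
      and f_eq: "\<And>y b. y \<in> U \<Longrightarrow> frame sc' (e' y) b \<Longrightarrow> q b \<noteq> 0 \<Longrightarrow> f y = p b / q b"
      using f x(2) unfolding regular_on_def by blast
    obtain G \<delta> b\<^sub>0 where G: "\<And>j i. frame_poly_map sc sc' (\<lambda>b. G b j i)" and \<delta>: "\<delta> \<in> frame_polys sc"
      and b0: "frame sc (e x) b\<^sub>0" "\<delta> b\<^sub>0 \<noteq> 0" "G b\<^sub>0 = c"
      and fr: "\<And>y b. y \<in> X \<Longrightarrow> frame sc (e y) b \<Longrightarrow> \<delta> b \<noteq> 0 \<Longrightarrow> frame sc' (e' (\<phi> y)) (G b)"
      using lift[OF x(1) pq(3)] by (elim exE conjE) blast
    \<comment> \<open>Extending the fraction by \<delta> keeps its value and confines the claim to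
      frames where the lift is valid.\<close>
    have "(\<lambda>b. \<delta> b * p (G b)) \<in> frame_polys sc" "(\<lambda>b. \<delta> b * q (G b)) \<in> frame_polys sc"
      by (rule frame_polys.mult[OF \<delta> frame_polys_comp[OF pq(1) G]])
        (rule frame_polys.mult[OF \<delta> frame_polys_comp[OF pq(2) G]])
    moreover have "(f \<circ> \<phi>) y = (\<delta> b * p (G b)) / (\<delta> b * q (G b))"
      if "y \<in> {x \<in> X. \<phi> x \<in> U}" "frame sc (e y) b" "\<delta> b * q (G b) \<noteq> 0" for y b
      using that f_eq[of "\<phi> y" "G b"] fr[of y b] by auto
    ultimately show "\<exists>b\<^sub>0. \<exists>p\<in>frame_polys sc. \<exists>q\<in>frame_polys sc. frame sc (e x) b\<^sub>0 \<and> q b\<^sub>0 \<noteq> 0 \<and>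
        (\<forall>y\<in>{x \<in> X. \<phi> x \<in> U}. \<forall>b. frame sc (e y) b \<and> q b \<noteq> 0 \<longrightarrow> (f \<circ> \<phi>) y = p b / q b)"
      using b0 pq(4)
      by (intro exI[of _ b\<^sub>0] bexI[of _ "\<lambda>b. \<delta> b * p (G b)"] bexI[of _ "\<lambda>b. \<delta> b * q (G b)"]) auto
  qed
qed

section \<open>Division-free Gauss--Jordan elimination\<close>

text \<open>After step \<open>n\<close>, the functionals \<open>l 0, \<dots>, l (n - 1)\<close> are dual to the vectors up to the common
  factor in the first component.  There is no pivoting: the factor may vanish, but it is \<open>1\<close>
  if the vectors are dual to the functionals from the start.\<close>

primrec gauss_jordan ::
    "(complex \<Rightarrow> 'v \<Rightarrow> 'v) \<Rightarrow> (nat \<Rightarrow> 'v \<Rightarrow> complex) \<Rightarrow> nat \<Rightarrow> (nat \<Rightarrow> 'v::ab_group_add) \<Rightarrow> complex \<times> (nat \<Rightarrow> 'v)" where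
  "gauss_jordan sc l 0 b = (1, b)"
| "gauss_jordan sc l (Suc n) b =
    (let (\<delta>, g) = gauss_jordan sc l n b; e = l n (g n) in
      (e * \<delta>, \<lambda>j. if j = n then sc \<delta> (g n) else sc e (g j) - sc (l n (g j)) (g n)))"

text \<open>The index j is not bounded by n: the functionals treated so far vanish on the later
  vectors as well. This gives l i (g n) = 0 for i < n, so that the next step preserves their
  duality.\<close>

lemma gauss_jordan_dual:
  assumes "\<And>i. i < n \<Longrightarrow> Vector_Spaces.linear sc (*) (l i)" "i < n"
  shows "l i (snd (gauss_jordan sc l n b) j) = (if i = j then fst (gauss_jordan sc l n b) else 0)"
  using assms
proof (induction n arbitrary: i j)
  case (Suc n)
  obtain \<delta> g where g: "gauss_jordan sc l n b = (\<delta>, g)" by fastforce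
  have IH: "l i (g j) = (if i = j then \<delta> else 0)" if "i < n" for i j
    using Suc.IH[of i j] Suc.prems(1) that by (simp add: g)
  note li = linear_functionalD[OF Suc.prems(1)[OF Suc.prems(2)]]
  have Suc_n: "fst (gauss_jordan sc l (Suc n) b) = l n (g n) * \<delta>"
    "snd (gauss_jordan sc l (Suc n) b) j = (if j = n then sc \<delta> (g n) else sc (l n (g n)) (g j) - sc (l n (g j)) (g n))"
    by (simp_all add: g Let_def)
  have l_Suc: "l i (snd (gauss_jordan sc l (Suc n) b) j) =
      (if j = n then \<delta> * l i (g n) else l n (g n) * l i (g j) - l n (g j) * l i (g n))"
    unfolding Suc_n by (simp add: li)
  show ?case
  proof (cases "i = n")
    case True
    then show ?thesis unfolding l_Suc Suc_n(1) by simp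
  next
    case False
    then have "i < n" using Suc.prems(2) by simp
    with False show ?thesis unfolding l_Suc Suc_n(1) by (simp add: IH)
  qed
qed simp

lemma gauss_jordan_span:
  assumes "vector_space sc" "n \<le> D" "j < D"
  shows "snd (gauss_jordan sc l n b) j \<in> module.span sc (b ` {..<D})"
  using assms(2,3)
proof (induction n arbitrary: j)
  case 0
  interpret vector_space sc by fact
  show ?case using 0 by (auto intro: span_base)
next
  case (Suc n)
  interpret vector_space sc by fact
  obtain \<delta> g where g: "gauss_jordan sc l n b = (\<delta>, g)" by fastforce
  have "g j \<in> span (b ` {..<D})" if "j < D" for j
    using Suc.IH[OF _ that] Suc.prems(1) by (simp add: g)
  then show ?case using Suc.prems by (auto simp: g Let_def intro!: span_diff span_scale)
qed

text \<open>In each step e = 1 and nothing is subtracted. This provides a frame at which the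
  elimination factor is nonzero.\<close>

lemma gauss_jordan_dual_start:
  assumes "vector_space sc" "n \<le> D" "\<And>i j. i < D \<Longrightarrow> j < D \<Longrightarrow> l i (b j) = (if i = j then 1 else 0)"
  shows "fst (gauss_jordan sc l n b) = 1" "j < D \<Longrightarrow> snd (gauss_jordan sc l n b) j = b j"
proof -
  interpret vector_space sc by fact
  have "fst (gauss_jordan sc l n b) = 1 \<and> (\<forall>j<D. snd (gauss_jordan sc l n b) j = b j)"
    using assms(2)
  proof (induction n)
    case (Suc n)
    then show ?case using assms(3) by (auto simp: case_prod_unfold Let_def)
  qed simp
  then show "fst (gauss_jordan sc l n b) = 1" "j < D \<Longrightarrow> snd (gauss_jordan sc l n b) j = b j"
    by auto
qed

lemma gauss_jordan_polynomial:
  assumes "\<And>i. i < n \<Longrightarrow> Vector_Spaces.linear sc (*) (l i)"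
  shows "(\<lambda>b. fst (gauss_jordan sc l n (b 0))) \<in> frame_polys sc"
    "frame_poly_map sc sc (\<lambda>b. snd (gauss_jordan sc l n (b 0)) j)"
proof -
  have "(\<lambda>b. fst (gauss_jordan sc l n (b 0))) \<in> frame_polys sc \<and>
    (\<forall>j. frame_poly_map sc sc (\<lambda>b. snd (gauss_jordan sc l n (b 0)) j))"
    using assms
  proof (induction n)
    case 0
    show ?case by (simp add: frame_polys.const frame_poly_map_coordinate)
  next
    case (Suc n)
    let ?f = "\<lambda>b. fst (gauss_jordan sc l n (b 0))" and ?g = "\<lambda>j b. snd (gauss_jordan sc l n (b 0)) j"
    have f: "?f \<in> frame_polys sc" and g: "\<And>j. frame_poly_map sc sc (?g j)"
      using Suc.IH Suc.prems by auto
    have lg: "(\<lambda>b. l n (?g j b)) \<in> frame_polys sc" for j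
      using g[of j] Suc.prems[of n] by (simp add: frame_poly_map_def)
    show ?case
    proof (intro conjI allI)
      show "(\<lambda>b. fst (gauss_jordan sc l (Suc n) (b 0))) \<in> frame_polys sc"
        using frame_polys.mult[OF lg[of n] f] by (simp add: case_prod_unfold Let_def)
      show "frame_poly_map sc sc (\<lambda>b. snd (gauss_jordan sc l (Suc n) (b 0)) j)" for j
      proof (cases "j = n")
        case True
        then show ?thesis
          using frame_poly_map_scale[OF f g[of n]] by (simp add: case_prod_unfold Let_def)
      next
        case False
        then show ?thesis
          using frame_poly_map_diff[OF frame_poly_map_scale[OF lg[of n] g[of j]]
              frame_poly_map_scale[OF lg[of j] g[of n]]]
          by (simp add: case_prod_unfold Let_def)
      qed
    qed
  qed
  then show "(\<lambda>b. fst (gauss_jordan sc l n (b 0))) \<in> frame_polys sc"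
    "frame_poly_map sc sc (\<lambda>b. snd (gauss_jordan sc l n (b 0)) j)" by auto
qed

lemma dual_functionals_exist:
  fixes \<beta> :: "'i \<Rightarrow> complex ^ 'n::finite"
  assumes "basis_family (*s) I \<beta> S"
  obtains \<mu> where "\<And>i. Vector_Spaces.linear (*s) (*) (\<mu> i)"
    "\<And>i j. i \<in> I \<Longrightarrow> j \<in> I \<Longrightarrow> \<mu> i (\<beta> j) = (if i = j then 1 else 0)"
proof -
  have \<beta>: "inj_on \<beta> I" "vec.independent (\<beta> ` I)" using assms by (auto simp: basis_family_def)
  interpret vector_space_pair "(*s) :: complex \<Rightarrow> complex ^ 'n \<Rightarrow> complex ^ 'n" "(*) :: complex \<Rightarrow> complex \<Rightarrow> complex"
    by unfold_locales
  have "\<exists>g. Vector_Spaces.linear (*s) (*) g \<and> (\<forall>x\<in>\<beta> ` I. g x = (if x = \<beta> i then 1 else (0 :: complex)))" for i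
    by (rule linear_independent_extend[OF \<beta>(2)])
  then obtain \<mu> where "\<And>i. Vector_Spaces.linear (*s) (*) (\<mu> i)"
    "\<And>i x. x \<in> \<beta> ` I \<Longrightarrow> \<mu> i x = (if x = \<beta> i then 1 else (0 :: complex))" by metis
  then show thesis using \<beta>(1) by (intro that[of \<mu>]) (auto simp: inj_on_eq_iff)
qed

lemma scaled_dual_imp_independent:
  fixes v :: "'i \<Rightarrow> 'v::ab_group_add" and \<mu> :: "'i \<Rightarrow> 'v \<Rightarrow> complex"
  assumes "\<And>i. i \<in> I \<Longrightarrow> Vector_Spaces.linear sc (*) (\<mu> i)" "finite I" "\<delta> \<noteq> 0"
    and "\<And>i j. i \<in> I \<Longrightarrow> j \<in> I \<Longrightarrow> \<mu> i (v j) = (if i = j then \<delta> else 0)"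
    and "(\<Sum>j\<in>I. sc (c j) (v j)) = 0" "i \<in> I"
  shows "c i = 0"
proof -
  note l = linear_functionalD[OF assms(1)[OF assms(6)]]
  have "0 = \<mu> i (\<Sum>j\<in>I. sc (c j) (v j))" using assms(5) by (simp add: l)
  also have "\<dots> = (\<Sum>j\<in>I. if j = i then c i * \<delta> else 0)"
    unfolding l(5) using assms(4,6) by (intro sum.cong) (auto simp: l(3))
  also have "\<dots> = c i * \<delta>" using assms(2,6) by simp
  finally show ?thesis using assms(3) by simp
qed

text \<open>The basis \<open>h\<close> supplies the dimension of \<open>S\<close>: a vector of
  \<open>S\<close> outside the span of the family could be added to it, giving too many independent
  vectors.\<close>

lemma basis_familyI_card:
  assumes V: "vector_space sc" and h: "basis_family sc J h S" and fin: "finite I" "finite J" and card: "card I = card J"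
    and mem: "\<And>i. i \<in> I \<Longrightarrow> f i \<in> S"
    and ind: "\<And>c i. (\<Sum>i\<in>I. sc (c i) (f i)) = 0 \<Longrightarrow> i \<in> I \<Longrightarrow> c i = 0"
  shows "basis_family sc I f S"
proof (rule basis_familyI[OF V fin(1)])
  show "(\<Sum>i\<in>I. sc (c i) (f i)) = 0 \<Longrightarrow> i \<in> I \<Longrightarrow> c i = 0" for c i by (rule ind)
  interpret vector_space sc by fact
  have inj: "inj_on f I" using fin(1) ind by (rule independent_family_inj)
  then have indep: "independent (f ` I)" using independent_image_iff[OF fin(1) inj] ind by blast
  have hD: "inj_on h J" "span (h ` J) = S" using h by (auto simp: basis_family_def)
  show "span (f ` I) = S"
  proof
    show "span (f ` I) \<subseteq> S"
      using mem hD(2) by (intro span_minimal) auto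
    show "S \<subseteq> span (f ` I)"
    proof (rule ccontr)
      assume "\<not> S \<subseteq> span (f ` I)"
      then obtain x where x: "x \<in> S" "x \<notin> span (f ` I)" by blast
      then have "independent (insert x (f ` I))" using indep by (intro independent_insertI)
      moreover have "insert x (f ` I) \<subseteq> span (h ` J)" using x(1) mem hD(2) by auto
      ultimately have "card (insert x (f ` I)) \<le> card (h ` J)"
        using independent_span_bound[of "h ` J" "insert x (f ` I)"] fin(2) by auto
      moreover have "x \<notin> f ` I" using x(2) span_base by blast
      ultimately show False using fin(1) card inj hD(1) by (simp add: card_image)
    qed
  qed
qed

section \<open>Openness of the fixed loci\<close>

text \<open>Equivalently, the values of \<alpha> are the jumps of \<open>A\<close>, with
  multiplicity.\<close>

definition typed :: "('r::finite \<Rightarrow> nat) \<Rightarrow> (nat \<Rightarrow> (complex ^ 'n::finite) set) \<Rightarrow> bool" where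
  "typed \<alpha> A \<longleftrightarrow> filtration A \<and> (\<forall>i. vec.dim (A i) = card {k. \<alpha> k \<le> i})"

lemma typedD:
  assumes "typed \<alpha> A"
  shows "filtration A" "vec.dim (A i) = card {k. \<alpha> k \<le> i}" "vec.subspace (A i)"
  using assms by (auto simp: typed_def filtration_def)

lemma F_locus_eq: "F_locus \<alpha> = sheaf_of ` {A. typed \<alpha> A}"
  by (auto simp: F_locus_iff typed_def)

lemma sections_sheaf_of:
  assumes "filtration A"
  shows "sections m (sheaf_of A) = hom_part m A"
proof -
  have "filtration (\<lambda>_. \<Union>i. A i)"
    by (rule filtration_const, rule subspace_UN_filtration, rule assms)
  moreover have "A i \<inter> (\<Union>i. A i) = A i" for i by blast
  ultimately show ?thesis
    unfolding sheaf_of_def by (simp add: sections_graded_eq_hom_part[OF assms])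
qed

text \<open>Labels for a basis of the sections in twist m: (w, s) stands for basis vector number s
  of weight w.\<close>

definition weight_index :: "('r::finite \<Rightarrow> nat) \<Rightarrow> nat \<Rightarrow> (nat \<times> nat) set" where
  "weight_index \<alpha> m = (SIGMA w:{..m}. {..<card {k. \<alpha> k \<le> w}})"

text \<open>The number of sections depends on \<alpha> only through its sum, hence is the same on
  all components of the fixed locus.\<close>

lemma card_weight_index:
  fixes \<alpha> :: "'r::finite \<Rightarrow> nat"
  assumes "sum \<alpha> UNIV \<le> m"
  shows "card (weight_index \<alpha> m) + sum \<alpha> UNIV = (m + 1) * CARD('r)"
proof -
  have "\<alpha> k \<le> m" for k using member_le_sum[of k UNIV \<alpha>] assms by simp
  from sum_card_le[of \<alpha>, OF this] show ?thesis by (simp add: weight_index_def)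
qed

lemma frame_quot_embedding:
  assumes "typed \<alpha> A"
  shows "frame cscale (quot_embedding m (sheaf_of A)) b \<longleftrightarrow>
    basis_family cscale {..<card (weight_index \<alpha> m)} (b 0) (hom_part m A)"
proof -
  have "hvec.dim (hom_part m A) = (\<Sum>w\<le>m. vec.dim (A w))"
    by (rule dim_hom_part) (rule typedD(3)[OF assms])
  then have "hvec.dim (hom_part m A) = card (weight_index \<alpha> m)"
    by (simp add: typedD(2)[OF assms] weight_index_def)
  then show ?thesis
    by (simp add: frame_iff_basis_family quot_embedding_def sections_sheaf_of[OF typedD(1)[OF assms]])
qed

lemma finite_weight_index [simp]: "finite (weight_index \<alpha> m)"
  by (simp add: weight_index_def)

lemma weight_enumeration:
  obtains e where "bij_betw e {..<card (weight_index \<alpha> m)} (weight_index \<alpha> m)"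
  using ex_bij_betw_nat_finite[OF finite_weight_index[of \<alpha> m]] by (auto simp: atLeast0LessThan)

lemma weight_basis:
  assumes e: "bij_betw e {..<card (weight_index \<alpha> m)} (weight_index \<alpha> m)"
    and \<beta>: "\<And>w. w \<le> m \<Longrightarrow> basis_family (*s) {..<card {k. \<alpha> k \<le> w}} (\<beta> w) (A w)"
  shows "basis_family cscale {..<card (weight_index \<alpha> m)}
    (\<lambda>t. bimonom (fst (e t)) (m - fst (e t)) (\<beta> (fst (e t)) (snd (e t)))) (hom_part m A)"
  using basis_family_reindex[OF e[unfolded weight_index_def] basis_family_hom_part[OF \<beta>]]
  by (simp add: weight_index_def case_prod_unfold o_def)

text \<open>The functionals see single weight components only, and the sections split into these components.
  Hence vectors dual to all functionals have independent components in each weight.\<close>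

lemma weight_components:
  fixes A :: "nat \<Rightarrow> (complex ^ 'n::finite) set" and \<mu> :: "nat \<Rightarrow> nat \<Rightarrow> complex ^ 'n \<Rightarrow> complex" and m
    and \<alpha> :: "'r::finite \<Rightarrow> nat" and e
  defines "D \<equiv> card (weight_index \<alpha> m)"
  defines "l \<equiv> \<lambda>t s. \<mu> (fst (e t)) (snd (e t)) (bicoeff (fst (e t)) (m - fst (e t)) s)"
  assumes e: "bij_betw e {..<D} (weight_index \<alpha> m)"
    and \<mu>: "\<And>w s. Vector_Spaces.linear (*s) (*) (\<mu> w s)"
    and b: "basis_family cscale {..<D} b (hom_part m A)"
    and \<delta>: "fst (gauss_jordan cscale l D b) \<noteq> 0" and w: "w \<le> m"
  defines "v \<equiv> \<lambda>s. bicoeff w (m - w) (snd (gauss_jordan cscale l D b) (inv_into {..<D} e (w, s)))"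
  shows "s < card {k. \<alpha> k \<le> w} \<Longrightarrow> v s \<in> A w"
    "(\<Sum>s<card {k. \<alpha> k \<le> w}. c s *s v s) = 0 \<Longrightarrow> s < card {k. \<alpha> k \<le> w} \<Longrightarrow> c s = 0"
proof -
  let ?N = "card {k. \<alpha> k \<le> w}" and ?p = "inv_into {..<D} e"
  have lin: "Vector_Spaces.linear cscale (*) (l t)" for t
    using Vector_Spaces.linear_compose[OF linear_bicoeff \<mu>] by (simp add: l_def o_def)
  have p: "?p (w, s) < D" "e (?p (w, s)) = (w, s)" if "s < ?N" for s
  proof -
    have mem: "(w, s) \<in> e ` {..<D}" using e that w by (auto simp: bij_betw_def weight_index_def)
    show "e (?p (w, s)) = (w, s)" by (rule f_inv_into_f[OF mem])
    show "?p (w, s) < D" using inv_into_into[OF mem] by simp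
  qed
  have span: "hvec.span (b ` {..<D}) = hom_part m A" using b by (simp add: basis_family_def)
  show "v s \<in> A w" if "s < ?N" for s
  proof -
    have "snd (gauss_jordan cscale l D b) (?p (w, s)) \<in> hom_part m A"
      using gauss_jordan_span[OF vector_space_cscale order_refl p(1)[OF that], of l b] span by simp
    then show ?thesis using w by (simp add: hom_part_def v_def)
  qed
  show "c s = 0" if "(\<Sum>s<?N. c s *s v s) = 0" "s < ?N" for c s
  proof (rule scaled_dual_imp_independent[of "{..<?N}" "(*s)" "\<mu> w" "fst (gauss_jordan cscale l D b)" v c s])
    show "\<mu> w i (v j) = (if i = j then fst (gauss_jordan cscale l D b) else 0)"
      if "i \<in> {..<?N}" "j \<in> {..<?N}" for i j
    proof -
      have i: "?p (w, i) < D" "e (?p (w, i)) = (w, i)" and j: "?p (w, j) < D" "e (?p (w, j)) = (w, j)"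
        using that p by auto
      have "\<mu> w i (v j) = l (?p (w, i)) (snd (gauss_jordan cscale l D b) (?p (w, j)))"
        by (simp add: l_def i v_def)
      also have "\<dots> = (if ?p (w, i) = ?p (w, j) then fst (gauss_jordan cscale l D b) else 0)"
        by (rule gauss_jordan_dual[OF lin i(1)])
      also have "?p (w, i) = ?p (w, j) \<longleftrightarrow> i = j" using i(2) j(2) by (metis prod.inject)
      finally show ?thesis .
    qed
  qed (use that \<delta> \<mu> in auto)
qed

text \<open>Within a weight the functionals are dual to \<beta>; between different weights duality
  is automatic, since the coefficient map of one weight kills the other.\<close>

lemma weight_functionals:
  fixes A :: "nat \<Rightarrow> (complex ^ 'n::finite) set" and \<alpha> :: "'r::finite \<Rightarrow> nat"
  assumes e: "bij_betw e {..<card (weight_index \<alpha> m)} (weight_index \<alpha> m)"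
    and \<beta>: "\<And>w. w \<le> m \<Longrightarrow> basis_family (*s) {..<card {k. \<alpha> k \<le> w}} (\<beta> w) (A w)"
  obtains \<mu> where "\<And>w s. Vector_Spaces.linear (*s) (*) (\<mu> w s)"
    "\<And>i j. i < card (weight_index \<alpha> m) \<Longrightarrow> j < card (weight_index \<alpha> m) \<Longrightarrow>
      \<mu> (fst (e i)) (snd (e i)) (bicoeff (fst (e i)) (m - fst (e i))
        (bimonom (fst (e j)) (m - fst (e j)) (\<beta> (fst (e j)) (snd (e j))))) = (if i = j then 1 else 0)"
proof -
  have "\<exists>\<mu>. (\<forall>s. Vector_Spaces.linear (*s) (*) (\<mu> s)) \<and> (w \<le> m \<longrightarrow>
      (\<forall>s<card {k. \<alpha> k \<le> w}. \<forall>t<card {k. \<alpha> k \<le> w}. \<mu> s (\<beta> w t) = (if s = t then 1 else (0 :: complex))))" for w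
  proof (cases "w \<le> m")
    case True
    from dual_functionals_exist[OF \<beta>[OF True]] obtain \<mu> where "\<And>i. Vector_Spaces.linear (*s) (*) (\<mu> i)"
      "\<And>i j. i \<in> {..<card {k. \<alpha> k \<le> w}} \<Longrightarrow> j \<in> {..<card {k. \<alpha> k \<le> w}} \<Longrightarrow> \<mu> i (\<beta> w j) = (if i = j then 1 else 0)"
      by metis
    then show ?thesis by (intro exI[of _ \<mu>]) auto
  next
    \<comment> \<open>For w > m only linearity is required, so the functionals of weight 0 may be
      reused.\<close>
    case False
    from dual_functionals_exist[OF \<beta>[OF le0]] obtain \<mu> where "\<And>i :: nat. Vector_Spaces.linear (*s) (*) (\<mu> i :: complex ^ 'n \<Rightarrow> complex)"
      by metis
    then show ?thesis using False by blast
  qed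
  then obtain \<mu> where \<mu>: "\<And>w s. Vector_Spaces.linear (*s) (*) (\<mu> w s)"
    "\<And>w s t. w \<le> m \<Longrightarrow> s < card {k. \<alpha> k \<le> w} \<Longrightarrow> t < card {k. \<alpha> k \<le> w} \<Longrightarrow>
      \<mu> w s (\<beta> w t) = (if s = t then 1 else (0 :: complex))"
    by metis
  show thesis
  proof (rule that[OF \<mu>(1)])
    fix i j assume ij: "i < card (weight_index \<alpha> m)" "j < card (weight_index \<alpha> m)"
    have "e i \<in> weight_index \<alpha> m" "e j \<in> weight_index \<alpha> m" using e ij by (auto dest: bij_betwE)
    then obtain w s w' s' where ws: "e i = (w, s)" "e j = (w', s')" "w \<le> m" "w' \<le> m"
      "s < card {k. \<alpha> k \<le> w}" "s' < card {k. \<alpha> k \<le> w'}"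
      by (auto simp: weight_index_def)
    have "i = j \<longleftrightarrow> e i = e j" using e ij by (auto simp: bij_betw_def inj_on_def)
    then show "\<mu> (fst (e i)) (snd (e i)) (bicoeff (fst (e i)) (m - fst (e i))
        (bimonom (fst (e j)) (m - fst (e j)) (\<beta> (fst (e j)) (snd (e j))))) = (if i = j then 1 else 0)"
      using ws \<mu>(2)[of w s s'] linear_functionalD(4)[OF \<mu>(1)] by auto
  qed
qed

lemma F_locus_zariski_open:
  fixes \<alpha> :: "'r::{finite,linorder} \<Rightarrow> nat"
  assumes \<alpha>: "\<alpha> \<in> weights d" and m: "d \<le> m"
  shows "zariski_open cscale (quot_embedding m) (E0 TYPE('r) d :: 'n::{finite,linorder} sheaf set) (F_locus \<alpha>)"
  unfolding zariski_open_def
proof (intro conjI ballI)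
  show "F_locus \<alpha> \<subseteq> (E0 TYPE('r) d :: 'n sheaf set)"
    unfolding E0_eq_UN_F_locus using \<alpha> by blast
  fix x :: "'n sheaf" assume "x \<in> F_locus \<alpha>"
  then obtain A where A: "typed \<alpha> A" and x: "x = sheaf_of A" by (auto simp: F_locus_eq)
  let ?D = "card (weight_index \<alpha> m)"
  have "\<exists>f. basis_family (*s) {..<card {k. \<alpha> k \<le> w}} f (A w)" for w
    using basis_family_exists[OF typedD(3)[OF A, of w]] typedD(2)[OF A, of w] by metis
  then obtain \<beta> where \<beta>: "\<And>w. basis_family (*s) {..<card {k. \<alpha> k \<le> w}} (\<beta> w) (A w)" by metis
  obtain e where e: "bij_betw e {..<?D} (weight_index \<alpha> m)" by (rule weight_enumeration)
  obtain \<mu> where \<mu>: "\<And>w s. Vector_Spaces.linear (*s) (*) (\<mu> w s)"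
    "\<And>i j. i < ?D \<Longrightarrow> j < ?D \<Longrightarrow>
      \<mu> (fst (e i)) (snd (e i)) (bicoeff (fst (e i)) (m - fst (e i))
        (bimonom (fst (e j)) (m - fst (e j)) (\<beta> (fst (e j)) (snd (e j))))) = (if i = j then 1 else 0)"
    using weight_functionals[OF e \<beta>] by metis
  define l where "l t s = \<mu> (fst (e t)) (snd (e t)) (bicoeff (fst (e t)) (m - fst (e t)) s)" for t s
  \<comment> \<open>The weight basis of the sections of x, to which the functionals are dual: the
    elimination factor is 1 there.\<close>
  define g where "g t = bimonom (fst (e t)) (m - fst (e t)) (\<beta> (fst (e t)) (snd (e t)))" for t
  define b\<^sub>0 :: "nat \<Rightarrow> nat \<Rightarrow> hpoly ^ 'n::{finite,linorder}" where "b\<^sub>0 j = g" for j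
  let ?q = "\<lambda>b. fst (gauss_jordan cscale l ?D (b (0::nat)))"
  have lin: "Vector_Spaces.linear cscale (*) (l t)" for t
    using Vector_Spaces.linear_compose[OF linear_bicoeff \<mu>(1)] by (simp add: l_def[abs_def] o_def)
  have "frame cscale (quot_embedding m x) b\<^sub>0"
    unfolding x frame_quot_embedding[OF A] b\<^sub>0_def g_def by (rule weight_basis[OF e \<beta>])
  moreover have "?q b\<^sub>0 = 1"
    using gauss_jordan_dual_start(1)[OF vector_space_cscale order_refl, of ?D l g] \<mu>(2)
    by (simp add: b\<^sub>0_def l_def g_def)
  moreover have "?q \<in> frame_polys cscale" by (rule gauss_jordan_polynomial(1)[OF lin])
  moreover have "y \<in> F_locus \<alpha>"
    if y: "y \<in> E0 TYPE('r) d" and b: "frame cscale (quot_embedding m y) b" "?q b \<noteq> 0" for y b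
  proof -
    obtain \<gamma> :: "'r \<Rightarrow> nat" where \<gamma>: "\<gamma> \<in> weights d" and "y \<in> F_locus \<gamma>"
      using y unfolding E0_eq_UN_F_locus by blast
    then obtain B where B: "typed \<gamma> B" and y_eq: "y = sheaf_of B" by (auto simp: F_locus_eq)
    \<comment> \<open>Although y may have another type \<gamma>, its frames have the same length, so
      the functionals and labels made for \<alpha> apply to them.\<close>
    have "card (weight_index \<gamma> m) = ?D"
      using card_weight_index[of \<gamma> m] card_weight_index[of \<alpha> m] \<alpha> \<gamma> m by (simp add: weights_def)
    then have bB: "basis_family cscale {..<?D} (b 0) (hom_part m B)"
      using b(1) by (simp add: y_eq frame_quot_embedding[OF B])
    have le: "card {k. \<alpha> k \<le> w} \<le> card {k. \<gamma> k \<le> w}" if "w \<le> m" for w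
    proof -
      let ?N = "card {k. \<alpha> k \<le> w}"
      let ?v = "\<lambda>s. bicoeff w (m - w) (snd (gauss_jordan cscale l ?D (b 0)) (inv_into {..<?D} e (w, s)))"
      note wc = weight_components[OF e \<mu>(1) bB b(2)[unfolded l_def[abs_def]] that, folded l_def]
      have "inj_on ?v {..<?N}" "vec.independent (?v ` {..<?N})"
      proof -
        show inj: "inj_on ?v {..<?N}"
          by (rule vec.independent_family_inj) (use wc(2) in auto)
        show "vec.independent (?v ` {..<?N})"
          unfolding vec.independent_image_iff[OF finite_lessThan inj] using wc(2) by auto
      qed
      moreover have "?v ` {..<?N} \<subseteq> B w" using wc(1) by auto
      ultimately have "?N \<le> vec.dim (B w)"
        using vec.independent_card_le_dim[of "?v ` {..<?N}" "B w"] by (simp add: card_image)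
      then show ?thesis by (simp add: typedD(2)[OF B])
    qed
    have "card {k. \<alpha> k \<le> w} = card {k. \<gamma> k \<le> w}" for w
    proof (cases "w \<le> m")
      case True
      have "(\<Sum>w\<le>m. card {k. \<alpha> k \<le> w}) = (\<Sum>w\<le>m. card {k. \<gamma> k \<le> w})"
        using \<open>card (weight_index \<gamma> m) = ?D\<close> by (simp add: weight_index_def)
      then show ?thesis by (rule sum_mono_inv) (use le True in auto)
    next
      case False
      \<comment> \<open>No weight exceeds d \<le> m, so beyond m both counts are r.\<close>
      have "\<alpha> k \<le> w" "\<gamma> k \<le> w" for k
        using member_le_sum[of k UNIV \<alpha>] member_le_sum[of k UNIV \<gamma>] \<alpha> \<gamma> m False
        by (simp_all add: weights_def)
      then show ?thesis by simp
    qed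
    then have "typed \<alpha> B" using B by (simp add: typed_def)
    then show ?thesis by (simp add: F_locus_eq y_eq)
  qed
  ultimately show "\<exists>b\<^sub>0. \<exists>q\<in>frame_polys cscale. frame cscale (quot_embedding m x) b\<^sub>0 \<and> q b\<^sub>0 \<noteq> 0 \<and>
      (\<forall>y\<in>E0 TYPE('r) d. \<forall>b. frame cscale (quot_embedding m y) b \<and> q b \<noteq> 0 \<longrightarrow> y \<in> F_locus \<alpha>)"
    by (intro exI[of _ b\<^sub>0] bexI[of _ ?q]) auto
qed

section \<open>Flag varieties\<close>

definition weight_values :: "('r::finite \<Rightarrow> nat) \<Rightarrow> nat list" where
  "weight_values \<alpha> = sorted_list_of_set (range \<alpha>)"

text \<open>The position in \<open>weight_values \<alpha>\<close> of the largest weight \<open>\<le> w\<close>; meaningful only if there is one.\<close>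

definition jump_index :: "('r::finite \<Rightarrow> nat) \<Rightarrow> nat \<Rightarrow> nat" where
  "jump_index \<alpha> w = (SOME j. j < length (weight_values \<alpha>) \<and> weight_values \<alpha> ! j \<le> w \<and>
    (\<forall>k. \<alpha> k \<le> w \<longrightarrow> \<alpha> k \<le> weight_values \<alpha> ! j))"

lemma set_weight_values: "set (weight_values \<alpha>) = range \<alpha>"
  by (simp add: weight_values_def)

lemma weight_values_less_iff:
  assumes "i < length (weight_values \<alpha>)" "j < length (weight_values \<alpha>)"
  shows "weight_values \<alpha> ! i < weight_values \<alpha> ! j \<longleftrightarrow> i < j"
proof -
  have "weight_values \<alpha> ! i < weight_values \<alpha> ! j" if "i < j" "j < length (weight_values \<alpha>)" for i j
    using sorted_wrt_nth_less[OF strict_sorted_list_of_set that(1), of "range \<alpha>"] that(2)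
    by (simp add: weight_values_def)
  then show ?thesis using assms by (metis less_asym less_irrefl neqE)
qed

text \<open>Sublevel sets of \<alpha> change only at values of \<alpha>, so the largest value \<le>
  w cuts out the same set as w. The hypothesis guarantees that there is such a value.\<close>

lemma jump_index:
  assumes "\<alpha> k \<le> w"
  shows "jump_index \<alpha> w < length (weight_values \<alpha>)" "weight_values \<alpha> ! jump_index \<alpha> w \<le> w"
    "{k. \<alpha> k \<le> w} = {k. \<alpha> k \<le> weight_values \<alpha> ! jump_index \<alpha> w}"
proof -
  let ?M = "Max {a \<in> range \<alpha>. a \<le> w}"
  have ne: "{a \<in> range \<alpha>. a \<le> w} \<noteq> {}" using assms by auto
  have "?M \<in> {a \<in> range \<alpha>. a \<le> w}" by (rule Max_in[OF _ ne]) simp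
  then obtain j where j: "j < length (weight_values \<alpha>)" "weight_values \<alpha> ! j = ?M" "?M \<le> w"
    by (metis (no_types, lifting) in_set_conv_nth mem_Collect_eq set_weight_values)
  have "\<alpha> k \<le> ?M" if "\<alpha> k \<le> w" for k by (rule Max_ge) (use that in auto)
  with j have "\<exists>j. j < length (weight_values \<alpha>) \<and> weight_values \<alpha> ! j \<le> w \<and>
      (\<forall>k. \<alpha> k \<le> w \<longrightarrow> \<alpha> k \<le> weight_values \<alpha> ! j)" by metis
  from someI_ex[OF this]
  have *: "jump_index \<alpha> w < length (weight_values \<alpha>)" "weight_values \<alpha> ! jump_index \<alpha> w \<le> w"
    "\<And>k. \<alpha> k \<le> w \<Longrightarrow> \<alpha> k \<le> weight_values \<alpha> ! jump_index \<alpha> w"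
    unfolding jump_index_def by auto
  then show "jump_index \<alpha> w < length (weight_values \<alpha>)" "weight_values \<alpha> ! jump_index \<alpha> w \<le> w" by auto
  show "{k. \<alpha> k \<le> w} = {k. \<alpha> k \<le> weight_values \<alpha> ! jump_index \<alpha> w}"
    using *(2,3) by (auto intro: order_trans)
qed

lemma weight_values_nth_in_range:
  assumes "j < length (weight_values \<alpha>)"
  obtains k where "\<alpha> k = weight_values \<alpha> ! j"
proof -
  have "weight_values \<alpha> ! j \<in> range \<alpha>" using assms set_weight_values[of \<alpha>] nth_mem by blast
  then show thesis using that by auto
qed

lemma jump_index_nth:
  assumes j: "j < length (weight_values \<alpha>)"
  shows "jump_index \<alpha> (weight_values \<alpha> ! j) = j"
proof -
  let ?i = "jump_index \<alpha> (weight_values \<alpha> ! j)"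
  obtain k where k: "\<alpha> k = weight_values \<alpha> ! j" using weight_values_nth_in_range[OF j] .
  note ji = jump_index[of \<alpha> k "weight_values \<alpha> ! j", OF eq_refl[OF k]]
  have "k \<in> {k. \<alpha> k \<le> weight_values \<alpha> ! ?i}" unfolding ji(3)[symmetric] by (simp add: k)
  then have "weight_values \<alpha> ! ?i = weight_values \<alpha> ! j" using k ji(2) by simp
  then show ?thesis using weight_values_less_iff[OF ji(1) j] weight_values_less_iff[OF j ji(1)] by auto
qed

text \<open>The dimension of \<open>A w\<close> changes only at weights, and nested subspaces of
  equal dimension agree. Hence \<open>A\<close> is determined by its members at the distinct
  weights.\<close>

lemma typed_eq_jump:
  assumes A: "typed \<alpha> A"
  shows "\<alpha> k \<le> w \<Longrightarrow> A w = A (weight_values \<alpha> ! jump_index \<alpha> w)"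
    "\<not> (\<exists>k. \<alpha> k \<le> w) \<Longrightarrow> A w = {0}"
proof -
  assume k: "\<alpha> k \<le> w"
  note ji = jump_index[of \<alpha> k w, OF k]
  have "A (weight_values \<alpha> ! jump_index \<alpha> w) = A w"
  proof (rule vec.subspace_dim_equal[OF typedD(3)[OF A] typedD(3)[OF A]])
    show "A (weight_values \<alpha> ! jump_index \<alpha> w) \<subseteq> A w"
      by (rule filtrationD(2)[OF typedD(1)[OF A] ji(2)])
    show "vec.dim (A w) \<le> vec.dim (A (weight_values \<alpha> ! jump_index \<alpha> w))"
      unfolding typedD(2)[OF A] ji(3)[symmetric] by simp
  qed
  then show "A w = A (weight_values \<alpha> ! jump_index \<alpha> w)" ..
next
  assume "\<not> (\<exists>k. \<alpha> k \<le> w)"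
  then have "vec.dim (A w) = 0" by (simp add: typedD(2)[OF A])
  moreover have "0 \<in> A w" by (rule filtrationD(4)[OF typedD(1)[OF A]])
  ultimately show "A w = {0}" by auto
qed

text \<open>The fibres over the first j + 1 distinct values partition the sublevel set of value
  number j. This matches the dimensions of the flag with those prescribed by
  \<open>typed\<close>.\<close>

lemma partial_sums_multiplicities:
  fixes \<alpha> :: "'r::finite \<Rightarrow> nat"
  shows "partial_sums (multiplicities \<alpha>) = map (\<lambda>a. card {k. \<alpha> k \<le> a}) (weight_values \<alpha>)"
proof (rule nth_equalityI)
  show "length (partial_sums (multiplicities \<alpha>)) = length (map (\<lambda>a. card {k. \<alpha> k \<le> a}) (weight_values \<alpha>))"
    by (simp add: partial_sums_def multiplicities_def weight_values_def)
  fix j assume "j < length (partial_sums (multiplicities \<alpha>))"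
  then have j: "j < length (weight_values \<alpha>)"
    by (simp add: partial_sums_def multiplicities_def weight_values_def)
  let ?T = "take (Suc j) (weight_values \<alpha>)"
  have "partial_sums (multiplicities \<alpha>) ! j = sum_list (map (\<lambda>a. card {k. \<alpha> k = a}) ?T)"
    using j by (simp add: partial_sums_def multiplicities_def weight_values_def take_map)
  also have "\<dots> = (\<Sum>a\<in>set ?T. card {k. \<alpha> k = a})"
    by (rule sum_list_distinct_conv_sum_set) (simp add: weight_values_def)
  also have "\<dots> = card (\<Union>a\<in>set ?T. {k. \<alpha> k = a})"
    by (rule card_UN_disjoint[symmetric]) auto
  also have "(\<Union>a\<in>set ?T. {k. \<alpha> k = a}) = {k. \<alpha> k \<le> weight_values \<alpha> ! j}"
  proof -
    have "\<alpha> k \<in> set ?T \<longleftrightarrow> \<alpha> k \<le> weight_values \<alpha> ! j" for k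
    proof -
      have "\<alpha> k \<in> set (weight_values \<alpha>)" by (simp add: set_weight_values)
      then obtain i where i: "i < length (weight_values \<alpha>)" "weight_values \<alpha> ! i = \<alpha> k"
        by (auto simp: in_set_conv_nth)
      have "\<alpha> k \<in> set ?T \<longleftrightarrow> i \<le> j"
      proof
        assume "\<alpha> k \<in> set ?T"
        then obtain i' where "i' < length ?T" "?T ! i' = \<alpha> k" by (metis in_set_conv_nth)
        then have i': "i' \<le> j" "i' < length (weight_values \<alpha>)" "weight_values \<alpha> ! i' = \<alpha> k" by auto
        then have "i' = i" using i weight_values_less_iff[OF i(1) i'(2)] weight_values_less_iff[OF i'(2) i(1)] by auto
        then show "i \<le> j" using i' by simp
      next
        assume "i \<le> j"
        then show "\<alpha> k \<in> set ?T" using i j by (auto simp: in_set_conv_nth intro!: exI[of _ i])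
      qed
      also have "\<dots> \<longleftrightarrow> \<alpha> k \<le> weight_values \<alpha> ! j"
        using weight_values_less_iff[OF j i(1)] i(2) by (auto simp: not_less[symmetric])
      finally show ?thesis .
    qed
    then show ?thesis by auto
  qed
  finally show "partial_sums (multiplicities \<alpha>) ! j = map (\<lambda>a. card {k. \<alpha> k \<le> a}) (weight_values \<alpha>) ! j"
    using j by simp
qed

text \<open>The step function through the members of the flag, constant between consecutive weights;
  below the least weight the flag has no member and the value is \<open>{0}\<close>.\<close>

definition flag_filtration ::
    "('r::finite \<Rightarrow> nat) \<Rightarrow> (complex ^ 'n::finite) set list \<Rightarrow> nat \<Rightarrow> (complex ^ 'n) set" where
  "flag_filtration \<alpha> Ws w = (if \<exists>k. \<alpha> k \<le> w then Ws ! jump_index \<alpha> w else {0})"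

text \<open>Reads the filtration off the sheaf itself, so that no choice of \<open>A\<close> enters
  the map.\<close>

definition flag_of :: "('r::finite \<Rightarrow> nat) \<Rightarrow> 'n::finite sheaf \<Rightarrow> (complex ^ 'n) set list" where
  "flag_of \<alpha> V = map (\<lambda>a. {v. monom_vec a v \<in> fst V}) (weight_values \<alpha>)"

lemma flag_of_sheaf_of: "filtration A \<Longrightarrow> flag_of \<alpha> (sheaf_of A) = map A (weight_values \<alpha>)"
  by (simp add: flag_of_def sheaf_of_def monom_vec_in_graded)

lemma map_in_flag_variety:
  assumes A: "typed \<alpha> A"
  shows "map A (weight_values \<alpha>) \<in> flag_variety (partial_sums (multiplicities \<alpha>))"
proof -
  have "sorted_wrt (\<subseteq>) (map A (weight_values \<alpha>))"
    unfolding sorted_wrt_map weight_values_def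
    by (rule sorted_wrt_mono_rel[OF _ sorted_sorted_list_of_set])
      (rule filtrationD(2)[OF typedD(1)[OF A]])
  then show ?thesis
    by (simp add: flag_variety_def partial_sums_multiplicities typedD[OF A])
qed

lemma typed_flag_filtration:
  assumes W: "Ws \<in> flag_variety (partial_sums (multiplicities \<alpha>))"
  shows "typed \<alpha> (flag_filtration \<alpha> Ws)" "map (flag_filtration \<alpha> Ws) (weight_values \<alpha>) = Ws"
proof -
  have len: "length Ws = length (weight_values \<alpha>)"
    and sub: "\<And>j. j < length (weight_values \<alpha>) \<Longrightarrow> vec.subspace (Ws ! j)"
    and dim: "\<And>j. j < length (weight_values \<alpha>) \<Longrightarrow> vec.dim (Ws ! j) = card {k. \<alpha> k \<le> weight_values \<alpha> ! j}"
    and sorted: "sorted_wrt (\<subseteq>) Ws"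
    using W by (auto simp: flag_variety_def partial_sums_multiplicities)
  have subspace: "vec.subspace (flag_filtration \<alpha> Ws w)" for w
    using sub jump_index(1) by (auto simp: flag_filtration_def vec.subspace_single_0)
  have "flag_filtration \<alpha> Ws v \<subseteq> flag_filtration \<alpha> Ws w" if "v \<le> w" for v w
  proof (cases "\<exists>k. \<alpha> k \<le> v")
    case True
    then obtain k where "\<alpha> k \<le> v" by blast
    with that have k: "\<alpha> k \<le> v" "\<alpha> k \<le> w" by auto
    note jv = jump_index[of \<alpha> k v, OF k(1)] and jw = jump_index[of \<alpha> k w, OF k(2)]
    obtain l where l: "\<alpha> l = weight_values \<alpha> ! jump_index \<alpha> v"
      using weight_values_nth_in_range[OF jv(1)] .
    then have "l \<in> {k. \<alpha> k \<le> w}" using jv(2) that by simp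
    then have "\<alpha> l \<le> weight_values \<alpha> ! jump_index \<alpha> w" unfolding jw(3) by simp
    then have "jump_index \<alpha> v \<le> jump_index \<alpha> w"
      using weight_values_less_iff[OF jw(1) jv(1)] l by (auto simp: not_less[symmetric])
    then have "Ws ! jump_index \<alpha> v \<subseteq> Ws ! jump_index \<alpha> w"
      using sorted_wrt_nth_less[OF sorted, of "jump_index \<alpha> v" "jump_index \<alpha> w"] jw(1) len
      by (cases "jump_index \<alpha> v = jump_index \<alpha> w") auto
    then show ?thesis using k by (auto simp: flag_filtration_def)
  next
    case False
    then show ?thesis using vec.subspace_0[OF subspace[of w]] by (simp add: flag_filtration_def)
  qed
  then have "filtration (flag_filtration \<alpha> Ws)"
    using subspace by (simp add: filtration_def mono_def)
  moreover have "vec.dim (flag_filtration \<alpha> Ws w) = card {k. \<alpha> k \<le> w}" for w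
  proof (cases "\<exists>k. \<alpha> k \<le> w")
    case True
    then obtain k where "\<alpha> k \<le> w" by blast
    note jw = jump_index[of \<alpha> k w, OF this]
    show ?thesis using True dim[OF jw(1)] jw(3) by (simp add: flag_filtration_def)
  next
    case False
    then show ?thesis by (simp add: flag_filtration_def)
  qed
  ultimately show "typed \<alpha> (flag_filtration \<alpha> Ws)" by (simp add: typed_def)
  show "map (flag_filtration \<alpha> Ws) (weight_values \<alpha>) = Ws"
  proof (rule nth_equalityI)
    fix j assume "j < length (map (flag_filtration \<alpha> Ws) (weight_values \<alpha>))"
    then have j: "j < length (weight_values \<alpha>)" by simp
    obtain k where "\<alpha> k = weight_values \<alpha> ! j" using weight_values_nth_in_range[OF j] .
    then have "\<exists>k. \<alpha> k \<le> weight_values \<alpha> ! j" by (metis order_refl)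
    then show "map (flag_filtration \<alpha> Ws) (weight_values \<alpha>) ! j = Ws ! j"
      using j by (simp add: flag_filtration_def jump_index_nth)
  qed (simp add: len)
qed

lemma flag_filtration_map:
  assumes A: "typed \<alpha> A"
  shows "flag_filtration \<alpha> (map A (weight_values \<alpha>)) = A"
proof
  fix w show "flag_filtration \<alpha> (map A (weight_values \<alpha>)) w = A w"
  proof (cases "\<exists>k. \<alpha> k \<le> w")
    case True
    then obtain k where k: "\<alpha> k \<le> w" by blast
    then show ?thesis
      using typed_eq_jump(1)[OF A k] jump_index(1)[of \<alpha> k w, OF k] True by (simp add: flag_filtration_def)
  qed (use typed_eq_jump(2)[OF A] in \<open>auto simp: flag_filtration_def\<close>)
qed

lemma bij_betw_flag_of:
  "bij_betw (flag_of \<alpha>) (F_locus \<alpha> :: 'n::finite sheaf set) (flag_variety (partial_sums (multiplicities \<alpha>)))"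
proof (rule bij_betw_byWitness[where f' = "\<lambda>Ws. sheaf_of (flag_filtration \<alpha> Ws)"])
  let ?F = "F_locus \<alpha> :: 'n sheaf set" and ?X = "flag_variety (partial_sums (multiplicities \<alpha>)) :: (complex ^ 'n) set list set"
  show "\<forall>V\<in>?F. sheaf_of (flag_filtration \<alpha> (flag_of \<alpha> V)) = V"
    by (auto simp: F_locus_eq flag_of_sheaf_of typedD(1) flag_filtration_map)
  show "\<forall>Ws\<in>?X. flag_of \<alpha> (sheaf_of (flag_filtration \<alpha> Ws)) = Ws"
  proof
    fix Ws :: "(complex ^ 'n) set list" assume "Ws \<in> ?X"
    from typed_flag_filtration[OF this] show "flag_of \<alpha> (sheaf_of (flag_filtration \<alpha> Ws)) = Ws"
      by (simp add: flag_of_sheaf_of typedD(1)[of \<alpha>])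
  qed
  show "flag_of \<alpha> ` ?F \<subseteq> ?X"
    by (auto simp: F_locus_eq flag_of_sheaf_of typedD(1) map_in_flag_variety)
  show "(\<lambda>Ws. sheaf_of (flag_filtration \<alpha> Ws)) ` ?X \<subseteq> ?F"
    using typed_flag_filtration(1) by (auto simp: F_locus_eq)
qed

section \<open>Regularity of the bijection with flags and of its inverse\<close>

lemma frame_flag:
  assumes A: "typed \<alpha> A"
  shows "frame (*s) (map A (weight_values \<alpha>)) c \<longleftrightarrow>
    (\<forall>j<length (weight_values \<alpha>). basis_family (*s) {..<card {k. \<alpha> k \<le> weight_values \<alpha> ! j}} (c j)
      (A (weight_values \<alpha> ! j)))"
  by (simp add: frame_iff_basis_family typedD(2)[OF A])

text \<open>The filtration is constant between jumps, so the frame of one flag member serves all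
  weights up to the next jump.\<close>

lemma frame_flag_jump:
  assumes A: "typed \<alpha> A" and c: "frame (*s) (map A (weight_values \<alpha>)) c"
  shows "basis_family (*s) {..<card {k. \<alpha> k \<le> w}} (c (jump_index \<alpha> w)) (A w)"
proof (cases "\<exists>k. \<alpha> k \<le> w")
  case True
  then obtain k where k: "\<alpha> k \<le> w" by blast
  show ?thesis
    using c jump_index[of \<alpha> k w, OF k] unfolding frame_flag[OF A] typed_eq_jump(1)[OF A k] by simp
next
  \<comment> \<open>The index set is empty, so whatever \<open>jump_index\<close> returns here
    yields a basis of \<open>{0}\<close>.\<close>
  case False
  then show ?thesis by (simp add: typed_eq_jump(2)[OF A] basis_family_def vec.independent_empty)
qed

lemma flag_of_morphism:
  fixes \<alpha> :: "'r::finite \<Rightarrow> nat"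
  assumes m: "sum \<alpha> UNIV \<le> m"
  shows "variety_morphism cscale (quot_embedding m) (F_locus \<alpha> :: 'n::finite sheaf set)
    (*s) id (flag_variety (partial_sums (multiplicities \<alpha>))) (flag_of \<alpha>)"
proof (rule variety_morphismI)
  show "flag_of \<alpha> ` F_locus \<alpha> \<subseteq> flag_variety (partial_sums (multiplicities \<alpha>))"
    by (rule bij_betw_imp_surj_on[OF bij_betw_flag_of, THEN equalityD1])
  fix x :: "'n sheaf" and c assume "x \<in> F_locus \<alpha>" and fc: "frame (*s) (id (flag_of \<alpha> x)) c"
  then obtain A where A: "typed \<alpha> A" and x: "x = sheaf_of A" by (auto simp: F_locus_eq)
  let ?D = "card (weight_index \<alpha> m)" and ?vs = "weight_values \<alpha>"
  \<comment> \<open>The prescribed frame c supplies the bases in all weights, so that elimination,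
    started at the resulting weight basis, returns c.\<close>
  define \<beta> where "\<beta> w = c (jump_index \<alpha> w)" for w
  have c: "frame (*s) (map A ?vs) c" using fc by (simp add: x flag_of_sheaf_of typedD(1)[OF A])
  have \<beta>: "basis_family (*s) {..<card {k. \<alpha> k \<le> w}} (\<beta> w) (A w)" for w
    unfolding \<beta>_def by (rule frame_flag_jump[OF A c])
  obtain e where e: "bij_betw e {..<?D} (weight_index \<alpha> m)" by (rule weight_enumeration)
  obtain \<mu> where \<mu>: "\<And>w s. Vector_Spaces.linear (*s) (*) (\<mu> w s)"
    "\<And>i j. i < ?D \<Longrightarrow> j < ?D \<Longrightarrow>
      \<mu> (fst (e i)) (snd (e i)) (bicoeff (fst (e i)) (m - fst (e i))
        (bimonom (fst (e j)) (m - fst (e j)) (\<beta> (fst (e j)) (snd (e j))))) = (if i = j then 1 else 0)"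
    using weight_functionals[OF e \<beta>] by metis
  define l where "l t s = \<mu> (fst (e t)) (snd (e t)) (bicoeff (fst (e t)) (m - fst (e t)) s)" for t s
  define g where "g t = bimonom (fst (e t)) (m - fst (e t)) (\<beta> (fst (e t)) (snd (e t)))" for t
  define b\<^sub>0 :: "nat \<Rightarrow> nat \<Rightarrow> hpoly ^ 'n" where "b\<^sub>0 j = g" for j
  define p where "p w s = inv_into {..<?D} e (w, s)" for w s
  \<comment> \<open>Entries outside the flag frame are copied from c, because the lift has to
    reproduce c on the dummies too.\<close>
  define G :: "(nat \<Rightarrow> nat \<Rightarrow> hpoly ^ 'n) \<Rightarrow> nat \<Rightarrow> nat \<Rightarrow> complex ^ 'n" where
    "G b j s = (if j < length ?vs \<and> s < card {k. \<alpha> k \<le> ?vs ! j}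
      then bicoeff (?vs ! j) (m - ?vs ! j) (snd (gauss_jordan cscale l ?D (b 0)) (p (?vs ! j) s)) else c j s)" for b j s
  have lin: "Vector_Spaces.linear cscale (*) (l t)" for t
    using Vector_Spaces.linear_compose[OF linear_bicoeff \<mu>(1)] by (simp add: l_def[abs_def] o_def)
  have vs_le: "?vs ! j \<le> m" if "j < length ?vs" for j
    using weight_values_nth_in_range[OF that] member_le_sum[of _ UNIV \<alpha>] m
    by (metis UNIV_I finite le0 order_trans)
  have start: "fst (gauss_jordan cscale l ?D g) = 1" "t < ?D \<Longrightarrow> snd (gauss_jordan cscale l ?D g) t = g t" for t
    using gauss_jordan_dual_start[OF vector_space_cscale order_refl, of ?D l g] \<mu>(2)
    by (simp_all add: l_def g_def)
  have "frame_poly_map cscale (*s) (\<lambda>b. G b j s)" for j s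
    unfolding G_def
    by (intro frame_poly_map_if frame_poly_map_const
        frame_poly_map_linear[OF gauss_jordan_polynomial(2)[OF lin] linear_bicoeff])
  moreover have "(\<lambda>b. fst (gauss_jordan cscale l ?D (b 0))) \<in> frame_polys cscale"
    by (rule gauss_jordan_polynomial(1)[OF lin])
  moreover have "frame cscale (quot_embedding m x) b\<^sub>0"
    unfolding x frame_quot_embedding[OF A] b\<^sub>0_def g_def by (rule weight_basis[OF e \<beta>])
  moreover have "fst (gauss_jordan cscale l ?D (b\<^sub>0 0)) \<noteq> 0" by (simp add: b\<^sub>0_def start)
  moreover have "G b\<^sub>0 = c"
  proof (intro ext)
    fix j s
    show "G b\<^sub>0 j s = c j s"
    proof (cases "j < length ?vs \<and> s < card {k. \<alpha> k \<le> ?vs ! j}")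
      case True
      then have mem: "(?vs ! j, s) \<in> e ` {..<?D}"
        using e vs_le by (auto simp: bij_betw_def weight_index_def)
      have "e (p (?vs ! j) s) = (?vs ! j, s)" "p (?vs ! j) s < ?D"
        unfolding p_def using f_inv_into_f[OF mem] inv_into_into[OF mem] by simp_all
      then show ?thesis
        using True by (simp add: G_def b\<^sub>0_def start g_def \<beta>_def jump_index_nth)
    qed (auto simp: G_def)
  qed
  moreover have "frame (*s) (id (flag_of \<alpha> y)) (G b)"
    if y: "y \<in> F_locus \<alpha>" and b: "frame cscale (quot_embedding m y) b"
      and \<delta>: "fst (gauss_jordan cscale l ?D (b 0)) \<noteq> 0" for y b
  proof -
    obtain B where B: "typed \<alpha> B" and y_eq: "y = sheaf_of B" using y by (auto simp: F_locus_eq)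
    have bB: "basis_family cscale {..<?D} (b 0) (hom_part m B)"
      using b by (simp add: y_eq frame_quot_embedding[OF B])
    have "basis_family (*s) {..<card {k. \<alpha> k \<le> ?vs ! j}} (G b j) (B (?vs ! j))" if j: "j < length ?vs" for j
    proof -
      let ?w = "?vs ! j" and ?N = "card {k. \<alpha> k \<le> ?vs ! j}"
      note wc = weight_components[OF e \<mu>(1) bB \<delta>[unfolded l_def[abs_def]] vs_le[OF j], folded l_def p_def]
      have Gj: "G b j s = bicoeff ?w (m - ?w) (snd (gauss_jordan cscale l ?D (b 0)) (p ?w s))" if "s < ?N" for s
        using that j by (simp add: G_def)
      \<comment> \<open>As y lies in the same locus, \<open>B\<close> has dimension ?N in this
        weight, and independence of ?N vectors suffices.\<close>
      obtain f where f: "basis_family (*s) {..<?N} f (B ?w)"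
        using basis_family_exists[OF typedD(3)[OF B, of ?w]] typedD(2)[OF B, of ?w] by metis
      show ?thesis
      proof (rule basis_familyI_card[OF vec.vector_space_axioms f])
        show "G b j s \<in> B ?w" if "s \<in> {..<?N}" for s
          using that wc(1) by (simp add: Gj)
        show "a s = 0" if "(\<Sum>s<?N. a s *s G b j s) = 0" "s \<in> {..<?N}" for a s
          using wc(2)[of a s] that by (simp add: Gj)
      qed auto
    qed
    then show ?thesis
      by (simp add: y_eq flag_of_sheaf_of typedD(1)[OF B] frame_flag[OF B])
  qed
  ultimately show "\<exists>G \<delta> b\<^sub>0.
      (\<forall>j i. frame_poly_map cscale (*s) (\<lambda>b. G b j i)) \<and> \<delta> \<in> frame_polys cscale \<and>
      frame cscale (quot_embedding m x) b\<^sub>0 \<and> \<delta> b\<^sub>0 \<noteq> 0 \<and> G b\<^sub>0 = c \<and>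
      (\<forall>y\<in>F_locus \<alpha>. \<forall>b. frame cscale (quot_embedding m y) b \<longrightarrow> \<delta> b \<noteq> 0 \<longrightarrow> frame (*s) (id (flag_of \<alpha> y)) (G b))"
    by (intro exI[of _ G] exI[of _ "\<lambda>b. fst (gauss_jordan cscale l ?D (b 0))"] exI[of _ b\<^sub>0]) blast
qed

text \<open>In this direction no elimination is involved: flag frames multiplied by z0^w z1^(m-w)
  give frames of the sections, and a constant matrix moves one of them to the prescribed frame. The
  lift is valid everywhere, with factor 1.\<close>

lemma flag_of_inverse_morphism:
  fixes \<alpha> :: "'r::finite \<Rightarrow> nat"
  shows "variety_morphism (*s) id (flag_variety (partial_sums (multiplicities \<alpha>)))
    cscale (quot_embedding m) (F_locus \<alpha> :: 'n::finite sheaf set) (inv_into (F_locus \<alpha>) (flag_of \<alpha>))"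
proof (rule variety_morphismI)
  let ?X = "flag_variety (partial_sums (multiplicities \<alpha>)) :: (complex ^ 'n) set list set"
  let ?\<psi> = "inv_into (F_locus \<alpha>) (flag_of \<alpha>) :: (complex ^ 'n) set list \<Rightarrow> 'n sheaf"
  let ?D = "card (weight_index \<alpha> m)" and ?vs = "weight_values \<alpha>"
  have bij: "bij_betw (flag_of \<alpha>) (F_locus \<alpha>) ?X" by (rule bij_betw_flag_of)
  show "?\<psi> ` ?X \<subseteq> F_locus \<alpha>"
    using bij_betw_inv_into[OF bij] by (simp add: bij_betw_def)
  have inv: "?\<psi> (map A ?vs) = sheaf_of A" if "typed \<alpha> A" for A
    using bij_betw_inv_into_left[OF bij, of "sheaf_of A"] that
    by (auto simp: F_locus_eq flag_of_sheaf_of typedD(1))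
  fix x c assume x_mem: "x \<in> ?X" and fc: "frame cscale (quot_embedding m (?\<psi> x)) c"
  define A where "A = flag_filtration \<alpha> x"
  have A: "typed \<alpha> A" and x: "x = map A ?vs" using typed_flag_filtration[OF x_mem] by (auto simp: A_def)
  have c: "basis_family cscale {..<?D} (c 0) (hom_part m A)"
    using fc by (simp add: x inv[OF A] frame_quot_embedding[OF A])
  obtain e where e: "bij_betw e {..<?D} (weight_index \<alpha> m)" by (rule weight_enumeration)
  define g :: "(nat \<Rightarrow> nat \<Rightarrow> complex ^ 'n) \<Rightarrow> nat \<Rightarrow> hpoly ^ 'n" where
    "g b t = bimonom (fst (e t)) (m - fst (e t)) (b (jump_index \<alpha> (fst (e t))) (snd (e t)))" for b t
  have g: "basis_family cscale {..<?D} (g b) (hom_part m B)"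
    if "typed \<alpha> B" "frame (*s) (map B ?vs) b" for B b
    unfolding g_def[abs_def]
    by (rule weight_basis[OF e]) (rule frame_flag_jump[OF that])
  have "\<exists>f. basis_family (*s) {..<card {k. \<alpha> k \<le> ?vs ! j}} f (A (?vs ! j))" for j
    using basis_family_exists[OF typedD(3)[OF A, of "?vs ! j"]] typedD(2)[OF A, of "?vs ! j"] by metis
  then obtain b\<^sub>0 where "\<And>j. basis_family (*s) {..<card {k. \<alpha> k \<le> ?vs ! j}} (b\<^sub>0 j) (A (?vs ! j))"
    by metis
  then have b0: "frame (*s) (map A ?vs) b\<^sub>0" by (simp add: frame_flag[OF A])
  \<comment> \<open>The matrix \<open>C\<close> is computed from the prescribed frame c and the
    single flag frame \<open>b\<^sub>0\<close>, and then used unchanged for all flags.\<close>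
  have "\<exists>C. c 0 t = (\<Sum>s<?D. cscale (C s) (g b\<^sub>0 s))" if "t < ?D" for t
  proof -
    have "c 0 t \<in> hvec.span (g b\<^sub>0 ` {..<?D})"
      using basis_familyD(5)[OF vector_space_cscale _ c, of t] that
        basis_familyD(2)[OF vector_space_cscale _ g[OF A b0]] by simp
    then show ?thesis by (simp add: hvec.span_image_iff)
  qed
  then obtain C where C: "\<And>t. t < ?D \<Longrightarrow> c 0 t = (\<Sum>s<?D. cscale (C t s) (g b\<^sub>0 s))" by metis
  define G :: "(nat \<Rightarrow> nat \<Rightarrow> complex ^ 'n) \<Rightarrow> nat \<Rightarrow> nat \<Rightarrow> hpoly ^ 'n" where
    "G b j t = (if j = 0 \<and> t < ?D then \<Sum>s<?D. cscale (C t s) (g b s) else c j t)" for b j t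
  have "frame_poly_map (*s) cscale (\<lambda>b. G b j t)" for j t
  proof -
    have "frame_poly_map (*s) cscale (\<lambda>b. g b s)" for s
      unfolding g_def by (rule frame_poly_map_linear[OF frame_poly_map_coordinate linear_bimonom])
    then have "frame_poly_map (*s) cscale (\<lambda>b. \<Sum>s<?D. cscale (C t s) (g b s))"
      by (intro frame_poly_map_sum frame_poly_map_scale frame_polys.const)
    then show ?thesis
      unfolding G_def by (intro frame_poly_map_if frame_poly_map_const)
  qed
  moreover have "(\<lambda>b. 1) \<in> frame_polys (*s)" by (rule frame_polys.const)
  moreover have "frame (*s) (id x) b\<^sub>0" using b0 by (simp add: x)
  moreover have "G b\<^sub>0 = c" by (auto simp: G_def C fun_eq_iff)
  moreover have "frame cscale (quot_embedding m (?\<psi> y)) (G b)" if y: "y \<in> ?X" and b: "frame (*s) (id y) b" for y b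
  proof -
    define B where "B = flag_filtration \<alpha> y"
    have B: "typed \<alpha> B" and y_eq: "y = map B ?vs" using typed_flag_filtration[OF y] by (auto simp: B_def)
    have gb: "basis_family cscale {..<?D} (g b) (hom_part m B)"
      using b by (intro g[OF B]) (simp add: y_eq)
    have G0: "G b 0 t = (\<Sum>s<?D. cscale (C t s) (g b s))" if "t < ?D" for t
      using that by (simp add: G_def)
    have "basis_family cscale {..<?D} (G b 0) (hom_part m B)"
    proof (rule basis_familyI_card[OF vector_space_cscale gb])
      show "G b 0 t \<in> hom_part m B" if "t \<in> {..<?D}" for t
      proof -
        have "(\<Sum>s<?D. cscale (C t s) (g b s)) \<in> hvec.span (g b ` {..<?D})"
          by (intro hvec.span_sum hvec.span_scale hvec.span_base) auto
        then show ?thesis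
          using that basis_familyD(2)[OF vector_space_cscale _ gb] by (simp add: G0)
      qed
      \<comment> \<open>A relation at b becomes, by independence of \<open>g b\<close>, a relation
        between the rows of \<open>C\<close>, in which b no longer occurs. Read at
        \<open>b\<^sub>0\<close> it is a relation in the frame c; this replaces an explicit inverse
        of \<open>C\<close>.\<close>
      fix a t assume sum: "(\<Sum>t<?D. cscale (a t) (G b 0 t)) = 0" and t: "t \<in> {..<?D}"
      have comb: "(\<Sum>t<?D. cscale (a t) (\<Sum>s<?D. cscale (C t s) (g b' s)))
          = (\<Sum>s<?D. cscale (\<Sum>t<?D. a t * C t s) (g b' s))" for b'
        unfolding hvec.scale_sum_right hvec.scale_scale hvec.scale_sum_left by (rule sum.swap)
      have "(\<Sum>t<?D. cscale (a t) (\<Sum>s<?D. cscale (C t s) (g b s))) = 0"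
        using sum by (simp add: G0)
      then have "(\<Sum>t<?D. a t * C t s) = 0" if "s < ?D" for s
        unfolding comb using basis_familyD(4)[OF vector_space_cscale _ gb, of "\<lambda>s. \<Sum>t<?D. a t * C t s" s] that by simp
      then have "(\<Sum>t<?D. cscale (a t) (c 0 t)) = 0" by (simp add: C comb)
      then show "a t = 0" using basis_familyD(4)[OF vector_space_cscale _ c, of a t] t by simp
    qed auto
    then show ?thesis by (simp add: y_eq inv[OF B] frame_quot_embedding[OF B])
  qed
  ultimately show "\<exists>G \<delta> b\<^sub>0.
      (\<forall>j i. frame_poly_map (*s) cscale (\<lambda>b. G b j i)) \<and> \<delta> \<in> frame_polys (*s) \<and>
      frame (*s) (id x) b\<^sub>0 \<and> \<delta> b\<^sub>0 \<noteq> 0 \<and> G b\<^sub>0 = c \<and>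
      (\<forall>y\<in>?X. \<forall>b. frame (*s) (id y) b \<longrightarrow> \<delta> b \<noteq> 0 \<longrightarrow> frame cscale (quot_embedding m (?\<psi> y)) (G b))"
    by (intro exI[of _ G] exI[of _ "\<lambda>b. 1"] exI[of _ b\<^sub>0]) simp
qed

theorem corollary3p1p2:
  fixes d :: nat
  assumes "CARD('r::{finite,linorder}) \<le> CARD('n::{finite,linorder})"
  shows
    "(E0 TYPE('r) d :: 'n sheaf set) = (\<Union>\<alpha> \<in> (weights d :: ('r \<Rightarrow> nat) set). F_locus \<alpha>) \<and>
     disjoint_family_on (F_locus :: ('r \<Rightarrow> nat) \<Rightarrow> 'n sheaf set) (weights d) \<and>
     (\<forall>\<alpha> \<in> (weights d :: ('r \<Rightarrow> nat) set).
        (\<forall>m\<ge>d. zariski_open cscale (quot_embedding m)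
                  (E0 TYPE('r) d :: 'n sheaf set) (F_locus \<alpha>)) \<and>
        (\<exists>\<phi>. \<forall>m\<ge>d. variety_iso cscale (quot_embedding m) (F_locus \<alpha> :: 'n sheaf set)
                  (*s) id (flag_variety (partial_sums (multiplicities \<alpha>)) :: ((complex, 'n) vec) set list set) \<phi>))"
proof (intro conjI ballI allI impI)
  show "(E0 TYPE('r) d :: 'n sheaf set) = (\<Union>\<alpha> \<in> (weights d :: ('r \<Rightarrow> nat) set). F_locus \<alpha>)"
    by (rule E0_eq_UN_F_locus)
  show "disjoint_family_on (F_locus :: ('r \<Rightarrow> nat) \<Rightarrow> 'n sheaf set) (weights d)"
    unfolding disjoint_family_on_def weights_def using F_locus_disjoint by blast
  fix \<alpha> :: "'r \<Rightarrow> nat" assume \<alpha>: "\<alpha> \<in> weights d"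
  show "zariski_open cscale (quot_embedding m) (E0 TYPE('r) d :: 'n sheaf set) (F_locus \<alpha>)" if "d \<le> m" for m
    by (rule F_locus_zariski_open[OF \<alpha> that])
  have "sum \<alpha> UNIV = d" using \<alpha> by (simp add: weights_def)
  \<comment> \<open>\<open>flag_of\<close> does not involve m, so one map serves for all m \<ge>
    d.\<close>
  then show "\<exists>\<phi>. \<forall>m\<ge>d. variety_iso cscale (quot_embedding m) (F_locus \<alpha> :: 'n sheaf set)
      (*s) id (flag_variety (partial_sums (multiplicities \<alpha>)) :: ((complex, 'n) vec) set list set) \<phi>"
    unfolding variety_iso_def
    using bij_betw_flag_of flag_of_morphism flag_of_inverse_morphism by (intro exI[of _ "flag_of \<alpha>"]) auto
qed

end
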